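(* Assume the ABC conjecture. Let $E$ be an elliptic curve over $\mathbb{Q}$ given by a Weierstrass equation $y^2=x^3+Ax+B$ with $A,B\in\mathbb{Z}$ and with $j$-invariant $0$ or $1728$ (i.e. $A=0$ or $B=0$). Let $Q\in E(\mathbb{Q})$ be a point of infinite order and let $(d_n)_{n\ge1}$ be the elliptic denominator sequence associated to $E$ and $Q$. Then for every $\epsilon>0$, $$P(d_n)\gg_{\epsilon,E,Q} n^{3-\epsilon},$$ equivalently $\log P(d_n)\ge (3-\epsilon)\log n+O_{\epsilon,E,Q}(1)$.
   Context: ABC conjecture: for every $\epsilon>0$ there is a constant $K_\epsilon$ such that whenever $A',B',C'\in\mathbb{Z}$ are relatively prime with $A'+B'+C'=0$, one has $\max\{|A'|,|B'|,|C'|\}\le K_\epsilon\left(\prod_{\pi\mid A'B'C'}\pi\right)^{1+\epsilon}$, the product over primes. Every rational point of $E$ other than the point at infinity can be written uniquely as $(a/d^2, b/d^3)$ with $a,b,d\in\mathbb{Z}$, $d\ge1$, $\gcd(a,d)=\gcd(b,d)=1$. The elliptic denominator sequence is defined by $nQ=(a_n/d_n^2,\,b_n/d_n^3)$ in this normalized form. $P(m)$ denotes the greatest prime factor of the integer $m$ (with $P(1)=1$). *)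

theory Defs
  imports "HOL-Computational_Algebra.Primes" Complex_Main
begin

datatype ecpt = Inf | Pt rat rat

definition on_curve :: "int \<Rightarrow> int \<Rightarrow> ecpt \<Rightarrow> bool" where
  "on_curve A B P = (case P of Inf \<Rightarrow> True
     | Pt x y \<Rightarrow> y^2 = x^3 + of_int A * x + of_int B)"

definition ec_add :: "int \<Rightarrow> int \<Rightarrow> ecpt \<Rightarrow> ecpt \<Rightarrow> ecpt" where
  "ec_add A B P R = (case P of Inf \<Rightarrow> R | Pt x1 y1 \<Rightarrow>
     (case R of Inf \<Rightarrow> P | Pt x2 y2 \<Rightarrow>
        (if x1 = x2 \<and> y1 = - y2 then Inf
         else let l = (if x1 = x2 then (3 * x1^2 + of_int A) / (2 * y1)
                       else (y2 - y1) / (x2 - x1));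
                  x3 = l^2 - x1 - x2
              in Pt x3 (l * (x1 - x3) - y1))))"

primrec ec_mult :: "int \<Rightarrow> int \<Rightarrow> nat \<Rightarrow> ecpt \<Rightarrow> ecpt" where
  "ec_mult A B 0 P = Inf"
| "ec_mult A B (Suc n) P = ec_add A B P (ec_mult A B n P)"

definition ec_denom :: "ecpt \<Rightarrow> nat" where
  "ec_denom P = (case P of Inf \<Rightarrow> 0 | Pt x y \<Rightarrow>
     (THE d::nat. d \<ge> 1 \<and> (\<exists>a b::int. x = of_int a / of_nat d ^ 2 \<and> y = of_int b / of_nat d ^ 3
        \<and> coprime a (int d) \<and> coprime b (int d))))"

definition ell_denom_seq :: "int \<Rightarrow> int \<Rightarrow> ecpt \<Rightarrow> nat \<Rightarrow> nat" where
  "ell_denom_seq A B Q n = ec_denom (ec_mult A B n Q)"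

text \<open>Greatest prime factor, with P(1) = 1 (also 1 for 0 by convention; not used).\<close>
definition gpf :: "nat \<Rightarrow> nat" where
  "gpf m = (if m \<le> 1 then 1 else Max (prime_factors m))"

definition radical :: "int \<Rightarrow> int" where
  "radical m = (\<Prod>p\<in>prime_factors m. p)"

definition abc_conjecture :: bool where
  "abc_conjecture = (\<forall>\<epsilon>::real. \<epsilon> > 0 \<longrightarrow> (\<exists>K::real. \<forall>a b c::int.
     coprime a b \<and> coprime b c \<and> coprime a c \<and> a + b + c = 0 \<longrightarrow>
     real_of_int (max \<bar>a\<bar> (max \<bar>b\<bar> \<bar>c\<bar>)) \<le> K * (real_of_int (radical (a*b*c))) powr (1 + \<epsilon>)))"

end

theory Submission
  imports Defs "Berlekamp_Zassenhaus.Finite_Field"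
begin

text \<open>
  Write \<open>nQ = (a/d\<^sup>2, b/d\<^sup>3)\<close> with \<open>d = d\<^sub>n\<close>. The curve equation is essentially an ABC equation
  (\<open>b\<^sup>2 = a\<^sup>3 + B d\<^sup>6\<close> if \<open>A = 0\<close>, and \<open>b\<^sup>2/a = a\<^sup>2 + A d\<^sup>4\<close> if \<open>B = 0\<close>), and ABC bounds the radical of
  \<open>d\<close> below by a fixed power of the height of \<open>nQ\<close>. As heights grow quadratically, the logarithms of the
  primes dividing \<open>d\<^sub>n\<close> sum to at least a constant times \<open>n\<^sup>2\<close>.

  A prime \<open>p\<close> of good reduction dividing \<open>d\<^sub>n\<close> has a rank of apparition \<open>m\<close> dividing \<open>n\<close>, the order of
  \<open>Q\<close> modulo \<open>p\<close>. Since \<open>ln d\<^sub>m\<close> is at most a constant times \<open>m\<^sup>2\<close>, the ranks \<open>m = n/k\<close> with \<open>k\<close> large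
  contribute little. For the remaining ranks, \<open>m\<close> divides the number \<open>N\<close> of points modulo \<open>p\<close>, and
  Jacobsthal's character sum argument shows that either \<open>N = p + 1\<close> or \<open>4 N = U\<^sup>2 + D V\<^sup>2\<close> with
  \<open>4 p = (U - 2)\<^sup>2 + D V\<^sup>2\<close> and \<open>D\<close> equal to \<open>1\<close> or \<open>3\<close>. Hence at most \<open>n\<^sup>\<epsilon> (P/n + n)\<close> primes up to
  \<open>P\<close> can have such a rank, and comparison with the lower bound forces \<open>P\<close> to be of size \<open>n\<^sup>3\<^sup>-\<^sup>\<epsilon>\<close>.
\<close>

section \<open>The group law of a Weierstrass cubic\<close>

text \<open>Divisibility of the number N of points modulo p by m is by itself too weak for the count
  of primes: N only lies within about 2 sqrt p of p + 1, so one multiple of m could serve for on the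
  order of sqrt P primes up to P. The special shape of N for the two j-invariants removes this
  obstacle. The pair (U, V) determines both p and N, the pairs belonging to primes up to P lie in a
  box of side about sqrt P, and in such a box m divides the norm form U^2 + D V^2 with density about
  1/m. The exponent 3 can then be read off. Up to n^\<epsilon>, the quantity n^2 is bounded by
  boundedly many terms P/n + n; the second summand is negligible against n^2, so the first gives P
  of size n^3. The \<epsilon> pays for divisor counts and for ln P alone: from ABC only a fixed
  positive proportion of the height is taken, here 1/4, so ABC is used with one fixed exponent for
  each of the two families.\<close>

datatype 'a point = Infty | Aff 'a 'a

text \<open>The field is a parameter so that one proof of associativity serves both the rational
  curve and its reductions. Characteristic 3 is covered: there \<open>disc\<close> says A \<noteq>
  0, which is the condition for x^3 + A x + B to have no double root.\<close>

locale weierstrass =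
  fixes A B :: "'a :: field"
  assumes two_neq_0: "(2::'a) \<noteq> 0"
    and disc: "4 * A^3 + 27 * B^2 \<noteq> 0"
begin

fun on :: "'a point \<Rightarrow> bool" where
  "on Infty = True"
| "on (Aff x y) = (y^2 = x^3 + A * x + B)"

fun neg :: "'a point \<Rightarrow> 'a point" where
  "neg Infty = Infty"
| "neg (Aff x y) = Aff x (- y)"

fun add :: "'a point \<Rightarrow> 'a point \<Rightarrow> 'a point" where
  "add Infty R = R"
| "add (Aff x y) Infty = Aff x y"
| "add (Aff x1 y1) (Aff x2 y2) =
    (if x1 = x2 \<and> y1 = - y2 then Infty
     else let l = (if x1 = x2 then (3 * x1^2 + A) / (2 * y1) else (y2 - y1) / (x2 - x1));
              x3 = l^2 - x1 - x2
          in Aff x3 (l * (x1 - x3) - y1))"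

text \<open>The last three equations are Vieta's formulas for x^3 + A x + B - (l x + c)^2 = (x - x1)
  (x - x2) (x - x3): the line y = l x + c meets the cubic in the three points, counted with
  multiplicity. Tangent lines are included, and the relation is symmetric in the three
  points.\<close>

definition coll :: "'a \<Rightarrow> 'a \<Rightarrow> 'a \<Rightarrow> 'a \<Rightarrow> 'a \<Rightarrow> 'a \<Rightarrow> 'a \<Rightarrow> 'a \<Rightarrow> bool" where
  "coll l c x1 y1 x2 y2 x3 y3 \<longleftrightarrow>
     y1 = l * x1 + c \<and> y2 = l * x2 + c \<and> y3 = l * x3 + c \<and>
     l^2 = x1 + x2 + x3 \<and> A - 2 * l * c = x1*x2 + x1*x3 + x2*x3 \<and> c^2 - B = x1*x2*x3"

lemma neg_neg [simp]: "neg (neg P) = P"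
  by (cases P) auto

lemma on_neg [simp]: "on (neg P) = on P"
  by (cases P) auto

lemma add_Infty_right [simp]: "add P Infty = P"
  by (cases P) auto

lemma add_neg [simp]: "add P (neg P) = Infty"
  by (cases P) auto

lemma neg_add_self [simp]: "add (neg P) P = Infty"
  by (cases P) auto

lemma nonsingular:
  assumes "x^3 + A * x + B = 0"
  shows "3 * x^2 + A \<noteq> 0"
proof
  assume a: "3 * x^2 + A = 0"
  have "A = - 3 * x^2" "B = 2 * x^3" using a assms by Groebner_Basis.algebra+
  then have "4 * A^3 + 27 * B^2 = 0" by Groebner_Basis.algebra
  then show False using disc by simp
qed

lemma coll_swap: "coll l c x1 y1 x2 y2 x3 y3 \<Longrightarrow> coll l c x2 y2 x1 y1 x3 y3"
  unfolding coll_def by (auto simp: algebra_simps)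

lemma coll_rot: "coll l c x1 y1 x2 y2 x3 y3 \<Longrightarrow> coll l c x2 y2 x3 y3 x1 y1"
  unfolding coll_def by (auto simp: algebra_simps)

lemma coll_neg: "coll l c x1 y1 x2 y2 x3 y3 \<Longrightarrow> coll (-l) (-c) x1 (-y1) x2 (-y2) x3 (-y3)"
  unfolding coll_def by (auto simp: algebra_simps)

lemma coll_on:
  assumes "coll l c x1 y1 x2 y2 x3 y3"
  shows "on (Aff x1 y1)"
  using assms unfolding coll_def by simp Groebner_Basis.algebra

lemma coll_tangent:
  assumes "coll l c x y x y x3 y3"
  shows "2 * y * l = 3 * x^2 + A"
  using assms unfolding coll_def by Groebner_Basis.algebra

text \<open>Two opposite points on the non-vertical line y = l x + c share x, hence y, so y = 0.
  Double contact there gives 3 x^2 + A = 0 by \<open>coll_tangent\<close>, which is a singular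
  point.\<close>

lemma coll_not_neg:
  assumes "coll l c x1 y1 x2 y2 x3 y3"
  shows "\<not> (x1 = x2 \<and> y1 = - y2)"
proof
  assume a: "x1 = x2 \<and> y1 = - y2"
  moreover have "y1 = l * x1 + c" "y2 = l * x2 + c" using assms by (simp_all only: coll_def)
  ultimately have "y1 = y2" by simp
  then have "2 * y1 = 0" using a by (metis mult_2 add.right_inverse)
  then have y: "y1 = 0" using two_neq_0 by simp
  have "3 * x1^2 + A = 0" using coll_tangent[of l c x1 y1 x3 y3] assms a y by simp
  moreover have "x1^3 + A * x1 + B = 0" using coll_on[OF assms] y by simp
  ultimately show False using nonsingular by blast
qed

lemma on_x_eq:
  assumes "on (Aff x y)" "on (Aff x z)"
  shows "y = z \<or> y = - z"
  using assms by (simp flip: power2_eq_iff)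

lemma two_collinear:
  assumes on: "on (Aff x1 y1)" "on (Aff x2 y2)" and y: "y1 = l*x1+c" "y2 = l*x2+c"
    and ne: "x1 \<noteq> x2" and x3: "x3 = l^2 - x1 - x2"
  shows "coll l c x1 y1 x2 y2 x3 (l*x3+c)"
proof -
  have e: "(l*x1+c)^2 = x1^3 + A*x1 + B" "(l*x2+c)^2 = x2^3 + A*x2 + B"
    using on y by auto
  have "(x1 - x2) * (l^2*(x1+x2) + 2*l*c - (x1^2+x1*x2+x2^2) - A) =
      ((l*x1+c)^2 - (x1^3 + A*x1 + B)) - ((l*x2+c)^2 - (x2^3 + A*x2 + B))"
    by Groebner_Basis.algebra
  then have "(x1 - x2) * (l^2*(x1+x2) + 2*l*c - (x1^2+x1*x2+x2^2) - A) = 0"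
    using e by simp
  then have 1: "l^2*(x1+x2) + 2*l*c - (x1^2+x1*x2+x2^2) - A = 0" using ne by simp
  have 3: "l^2 = x1+x2+x3" using x3 by simp
  have 4: "A - 2*l*c = x1*x2+x1*x3+x2*x3" using 1 3 by Groebner_Basis.algebra
  have 5: "c^2 - B = x1*x2*x3" using e(1) 3 4 by Groebner_Basis.algebra
  show ?thesis using 3 4 5 y by (simp add: coll_def)
qed

lemma three_collinear:
  assumes on: "on (Aff x1 y1)" "on (Aff x2 y2)" "on (Aff x3 y3)"
    and y: "y1 = l*x1+c" "y2 = l*x2+c" "y3 = l*x3+c"
    and ne: "x1 \<noteq> x2" "x1 \<noteq> x3" "x2 \<noteq> x3"
  shows "coll l c x1 y1 x2 y2 x3 y3"
proof -
  define z where "z = l^2 - x1 - x2"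
  have "coll l c x1 y1 x2 y2 z (l*z+c)"
    using two_collinear on y ne z_def by blast
  then have z: "l^2 = x1+x2+z" "A - 2*l*c = x1*x2+x1*z+x2*z" "c^2 - B = x1*x2*z"
    by (simp_all only: coll_def)
  have e: "(l*x3+c)^2 = x3^3 + A*x3 + B" using on y by auto
  have "(x3 - x1) * (x3 - x2) * (x3 - z) = x3^3 + A*x3 + B - (l*x3+c)^2"
  proof -
    have "x3^3 + A*x3 + B - (l*x3+c)^2 = x3^3 - l^2*x3^2 + (A - 2*l*c)*x3 - (c^2 - B)" by Groebner_Basis.algebra
    then show ?thesis unfolding z by Groebner_Basis.algebra
  qed
  then have "(x3 - x1) * (x3 - x2) * (x3 - z) = 0" using e by simp
  then have "x3 = z" using ne by auto
  then show ?thesis using \<open>coll l c x1 y1 x2 y2 z (l*z+c)\<close> y by simp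
qed

lemma tangent_collinear:
  assumes on: "on (Aff x1 y1)" and y1: "y1 = l*x1+c" and t: "2 * y1 * l = 3 * x1^2 + A"
    and x3: "x3 = l^2 - x1 - x1"
  shows "coll l c x1 y1 x1 y1 x3 (l*x3+c)"
proof -
  have e: "(l*x1+c)^2 = x1^3 + A*x1 + B"
    using on y1 by auto
  have 3: "l^2 = x1+x1+x3" using x3 by simp
  have 4: "A - 2*l*c = x1*x1+x1*x3+x1*x3" using t y1 3 by Groebner_Basis.algebra
  have 5: "c^2 - B = x1*x1*x3" using e(1) 3 4 by Groebner_Basis.algebra
  show ?thesis using 3 4 5 y1 by (simp add: coll_def)
qed

lemma add_coll:
  assumes "on (Aff x1 y1)" "on (Aff x2 y2)" "\<not> (x1 = x2 \<and> y1 = - y2)"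
  obtains l c x3 y3 where "coll l c x1 y1 x2 y2 x3 (- y3)" "add (Aff x1 y1) (Aff x2 y2) = Aff x3 y3"
proof -
  define l where "l = (if x1 = x2 then (3 * x1^2 + A) / (2 * y1) else (y2 - y1) / (x2 - x1))"
  define c where "c = y1 - l * x1"
  define x3 where "x3 = l^2 - x1 - x2"
  have s: "add (Aff x1 y1) (Aff x2 y2) = Aff x3 (l * (x1 - x3) - y1)"
    using assms(3) by (auto simp: l_def x3_def Let_def)
  have y1: "y1 = l * x1 + c" by (simp add: c_def)
  have y3: "- (l * (x1 - x3) - y1) = l * x3 + c" by (simp add: c_def algebra_simps)
  have "coll l c x1 y1 x2 y2 x3 (- (l * (x1 - x3) - y1))"
  proof (cases "x1 = x2")
    case True
    then have yy: "y1 = y2" "y1 \<noteq> - y2" using on_x_eq assms by blast+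
    then have "y1 \<noteq> 0" by auto
    then have "2 * y1 * l = 3 * x1^2 + A" using two_neq_0 True by (simp add: l_def)
    then have "coll l c x1 y1 x1 y1 x3 (l*x3+c)"
      using tangent_collinear[OF assms(1) y1, of x3] True by (simp add: x3_def)
    then show ?thesis by (simp only: y3 True[symmetric] yy(1)[symmetric])
  next
    case False
    then have "l * (x2 - x1) = y2 - y1" by (simp add: l_def)
    then have y2: "y2 = l * x2 + c" by (simp add: c_def algebra_simps)
    show ?thesis unfolding y3 by (rule two_collinear[OF assms(1,2) y1 y2 False x3_def])
  qed
  then show thesis using that s by blast
qed

text \<open>The first two points determine the line, by their difference quotient if the abscissae
  differ and by the tangent identity otherwise. This turns permutations of \<open>coll\<close> into
  identities for \<open>add\<close>.\<close>

lemma coll_add: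
  assumes "coll l c x1 y1 x2 y2 x3 y3"
  shows "add (Aff x1 y1) (Aff x2 y2) = Aff x3 (- y3)"
proof -
  have on: "on (Aff x1 y1)" "on (Aff x2 y2)"
    using coll_on[OF assms] coll_on[OF coll_swap[OF assms]] by auto
  obtain l' c' x3' y3' where 1: "coll l' c' x1 y1 x2 y2 x3' (- y3')"
      "add (Aff x1 y1) (Aff x2 y2) = Aff x3' y3'"
    using add_coll[OF on coll_not_neg[OF assms]] by blast
  have "l = l'"
  proof (cases "x1 = x2")
    case True
    then have y: "y1 = y2" using assms by (simp add: coll_def)
    then have "y1 \<noteq> 0" using coll_not_neg[OF assms] True by auto
    moreover have "2 * y1 * l = 2 * y1 * l'"
      using coll_tangent[of l c x1 y1 x3 y3] coll_tangent[of l' c' x1 y1 x3' "- y3'"] assms 1 True y by auto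
    ultimately show ?thesis using two_neq_0 by simp
  next
    case False
    have "(l - l') * (x1 - x2) = 0" using assms 1(1) unfolding coll_def by Groebner_Basis.algebra
    then show ?thesis using False by simp
  qed
  moreover from this have "c = c'" using assms 1(1) unfolding coll_def by auto
  ultimately have "x3 = x3'" "y3 = - y3'"
    using assms 1(1) unfolding coll_def by auto
  then show ?thesis using 1 by simp
qed

lemma add_on [simp]: "on P \<Longrightarrow> on Q \<Longrightarrow> on (add P Q)"
proof (cases P; cases Q)
  fix x1 y1 x2 y2 assume "on P" "on Q" and PQ: "P = Aff x1 y1" "Q = Aff x2 y2"
  show "on (add P Q)"
  proof (cases "x1 = x2 \<and> y1 = - y2")
    case False
    then obtain l c x3 y3 where "coll l c x1 y1 x2 y2 x3 (- y3)" "add P Q = Aff x3 y3"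
      using add_coll[OF _ _ False] PQ \<open>on P\<close> \<open>on Q\<close> by metis
    then show ?thesis using coll_on[OF coll_rot[OF coll_rot]] by fastforce
  qed (use PQ in auto)
qed auto

lemma add_commute: "on P \<Longrightarrow> on Q \<Longrightarrow> add P Q = add Q P"
proof (cases P; cases Q)
  fix x1 y1 x2 y2 assume "on P" "on Q" and PQ: "P = Aff x1 y1" "Q = Aff x2 y2"
  show "add P Q = add Q P"
  proof (cases "x1 = x2 \<and> y1 = - y2")
    case False
    then obtain l c x3 y3 where "coll l c x1 y1 x2 y2 x3 (- y3)" "add P Q = Aff x3 y3"
      using add_coll[OF _ _ False] PQ \<open>on P\<close> \<open>on Q\<close> by metis
    then show ?thesis using coll_add[OF coll_swap] PQ by fastforce
  qed (use PQ in auto)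
qed auto

lemma neg_add: "on P \<Longrightarrow> on Q \<Longrightarrow> neg (add P Q) = add (neg P) (neg Q)"
proof (cases P; cases Q)
  fix x1 y1 x2 y2 assume "on P" "on Q" and PQ: "P = Aff x1 y1" "Q = Aff x2 y2"
  show "neg (add P Q) = add (neg P) (neg Q)"
  proof (cases "x1 = x2 \<and> y1 = - y2")
    case False
    then obtain l c x3 y3 where "coll l c x1 y1 x2 y2 x3 (- y3)" "add P Q = Aff x3 y3"
      using add_coll[OF _ _ False] PQ \<open>on P\<close> \<open>on Q\<close> by metis
    then show ?thesis using coll_add[OF coll_neg] PQ by fastforce
  qed (use PQ in auto)
qed auto

text \<open>Negating the line through P, Q and -(P + Q) gives the line through -P, -Q and P + Q;
  read in another order it says -P + (P + Q) = Q. This cancellation law is thus available in the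
  proof of associativity.\<close>

lemma add_cancel: "on P \<Longrightarrow> on Q \<Longrightarrow> add (neg P) (add P Q) = Q"
proof (cases P; cases Q)
  fix x1 y1 x2 y2 assume "on P" "on Q" and PQ: "P = Aff x1 y1" "Q = Aff x2 y2"
  show "add (neg P) (add P Q) = Q"
  proof (cases "x1 = x2 \<and> y1 = - y2")
    case False
    then obtain l c x3 y3 where *: "coll l c x1 y1 x2 y2 x3 (- y3)" "add P Q = Aff x3 y3"
      using add_coll[OF _ _ False] PQ \<open>on P\<close> \<open>on Q\<close> by metis
    have "coll (-l) (-c) x1 (-y1) x3 y3 x2 (- y2)"
      using coll_swap[OF coll_rot[OF coll_rot[OF coll_neg[OF *(1)]]]] by simp
    then show ?thesis using coll_add * PQ by fastforce
  qed (use PQ in auto)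
qed auto

text \<open>The product of two lines meeting in \<open>S\<close> and \<open>-S\<close>, divided by the vertical line through
  \<open>S\<close>, is a conic \<open>x\<^sup>2 + \<alpha> x + \<beta> = \<gamma> y\<close> with divisor \<open>P + Q + R + (-T)\<close>.\<close>

lemma conic:
  assumes 1: "coll l1 c1 xP yP xQ yQ xS (- yS)" and 2: "coll l2 c2 xS yS xR yR xT (- yT)"
    and defs: "\<gamma> = l1 + l2" "\<alpha> = \<gamma> * l1 - (xP + xQ)" "\<beta> = xP * xQ + \<gamma> * c1"
  shows "\<gamma> * yP = xP^2 + \<alpha> * xP + \<beta>" "\<gamma> * yQ = xQ^2 + \<alpha> * xQ + \<beta>"
    "\<gamma> * yR = xR^2 + \<alpha> * xR + \<beta>" "- \<gamma> * yT = xT^2 + \<alpha> * xT + \<beta>"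
    "xT = \<gamma>^2 - 2 * \<alpha> - xP - xQ - xR"
proof -
  have s: "c1 + c2 + \<gamma> * xS = 0" using 1 2 defs(1) unfolding coll_def by Groebner_Basis.algebra
  have a: "\<alpha> = \<gamma> * l2 - (xR + xT)" using 1 2 unfolding coll_def defs by Groebner_Basis.algebra
  have "xR * xT - xP * xQ = \<gamma> * (c1 - c2)"
    using 1 2 s defs(1) unfolding coll_def by Groebner_Basis.algebra
  then have b: "\<beta> = xR * xT + \<gamma> * c2" unfolding defs(3) by Groebner_Basis.algebra
  show "\<gamma> * yP = xP^2 + \<alpha> * xP + \<beta>" "\<gamma> * yQ = xQ^2 + \<alpha> * xQ + \<beta>"
    using 1 unfolding coll_def defs(2,3) by Groebner_Basis.algebra+
  show "\<gamma> * yR = xR^2 + \<alpha> * xR + \<beta>" "- \<gamma> * yT = xT^2 + \<alpha> * xT + \<beta>"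
    using 2 unfolding coll_def a b by Groebner_Basis.algebra+
  show "xT = \<gamma>^2 - 2 * \<alpha> - xP - xQ - xR"
    using a defs(1,2) by Groebner_Basis.algebra
qed

text \<open>Each bracketing yields a conic g y = x^2 + a x + b through P, Q and R whose fourth point
  is the negative of the result. If the two values of g differed, subtracting the equations would
  put P, Q and R on a line, so that S = -R, against the line \<open>2\<close> through S and R. Equal
  g forces the conics to agree, and with them the fourth points.\<close>

lemma assoc_generic:
  assumes 1: "coll l1 c1 xP yP xQ yQ xS (- yS)" and 2: "coll l2 c2 xS yS xR yR xT (- yT)"
    and 3: "coll l3 c3 xR yR xQ yQ xU (- yU)" and 4: "coll l4 c4 xU yU xP yP xV (- yV)"
    and ne: "xP \<noteq> xQ" "xP \<noteq> xR" "xQ \<noteq> xR"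
  shows "Aff xT yT = Aff xV yV"
proof -
  obtain g a b where c1: "g * yP = xP^2 + a * xP + b" "g * yQ = xQ^2 + a * xQ + b"
    "g * yR = xR^2 + a * xR + b" "- g * yT = xT^2 + a * xT + b" "xT = g^2 - 2 * a - xP - xQ - xR"
    using conic[OF 1 2 refl refl refl] by blast
  obtain g' a' b' where c2: "g' * yR = xR^2 + a' * xR + b'" "g' * yQ = xQ^2 + a' * xQ + b'"
    "g' * yP = xP^2 + a' * xP + b'" "- g' * yV = xV^2 + a' * xV + b'" "xV = g'^2 - 2 * a' - xR - xQ - xP"
    using conic[OF 3 4 refl refl refl] by blast
  note on = coll_on[OF 1] coll_on[OF coll_swap[OF 1]] coll_on[OF 3]
  have gg: "g = g'"
  proof (rule ccontr)
    assume ne': "g \<noteq> g'"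
    define l c where "l = (a - a') / (g - g')" and "c = (b - b') / (g - g')"
    have l: "y = l * x + c" if "g * y = x^2 + a * x + b" "g' * y = x^2 + a' * x + b'" for x y
    proof -
      have "(g - g') * y = (a - a') * x + (b - b')" using that by Groebner_Basis.algebra
      moreover have "g - g' \<noteq> 0" using ne' by simp
      ultimately have "y = ((a - a') * x + (b - b')) / (g - g')"
        by (simp add: nonzero_eq_divide_eq mult.commute)
      then show ?thesis by (simp add: l_def c_def add_divide_distrib)
    qed
    have "coll l c xP yP xQ yQ xR yR"
      by (rule three_collinear[OF on l[OF c1(1) c2(3)] l[OF c1(2) c2(2)] l[OF c1(3) c2(1)] ne])
    then have "Aff xS yS = Aff xR (- yR)" using coll_add 1 by (metis minus_minus)
    then show False using coll_not_neg[OF 2] by simp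
  qed
  have "(a - a') * (xP - xQ) = 0" using c1(1,2) c2(2,3) unfolding gg by Groebner_Basis.algebra
  then have aa: "a = a'" using ne by simp
  have bb: "b = b'" using c1(1) c2(3) gg aa by simp
  \<comment> \<open>With g = 0 the quadratic x^2 + a x + b would vanish at three different
    abscissae. A nonzero g lets y be read off the conic.\<close>
  have g0: "g \<noteq> 0"
  proof
    assume g: "g = 0"
    have "(xP - xQ) * (xP + xQ + a) = 0" using c1(1,2) g by Groebner_Basis.algebra
    moreover have "(xP - xR) * (xP + xR + a) = 0" using c1(1,3) g by Groebner_Basis.algebra
    ultimately have "xP + xQ + a = 0" "xP + xR + a = 0" using ne by auto
    then have "xP + xQ + a = xP + xR + a" by simp
    then have "xQ = xR" by simp
    then show False using ne by simp
  qed
  have x: "xT = xV" unfolding c1(5) c2(5) gg aa by (simp add: algebra_simps)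
  then have "- g * yT = - g * yV" using c1(4) c2(4) gg aa bb by simp
  then show ?thesis using g0 x by simp
qed

text \<open>Here Q = P, and the condition lost with the third point is replaced by tangency of both
  conics at P: \<open>t1\<close> and \<open>t2\<close> combine the derivative of g y = x^2 + a x + b
  with 2 y y' = 3 x^2 + A.\<close>

lemma assoc_tangent:
  assumes 1: "coll l1 c1 xP yP xP yP xS (- yS)" and 2: "coll l2 c2 xS yS xR yR xT (- yT)"
    and 3: "coll l3 c3 xR yR xP yP xU (- yU)" and 4: "coll l4 c4 xU yU xP yP xV (- yV)"
    and ne: "xP \<noteq> xR"
  shows "Aff xT yT = Aff xV yV"
proof -
  define g a b where d1: "g = l1 + l2" "a = g * l1 - (xP + xP)" "b = xP * xP + g * c1"
  note c1 = conic[OF 1 2 d1]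
  define g' a' b' where d2: "g' = l3 + l4" "a' = g' * l3 - (xR + xP)" "b' = xR * xP + g' * c3"
  note c2 = conic[OF 3 4 d2]
  note on = coll_on[OF 1] coll_on[OF 3]
  have y0: "yP \<noteq> 0" using coll_not_neg[OF 1] by auto
  have t1: "2 * yP * (2 * xP + a) = g * (3 * xP^2 + A)"
    using coll_tangent[OF 1] unfolding d1(2) by Groebner_Basis.algebra
  have "yP = l3 * xP + c3" "yP = l4 * xP + c4" "- yU = l3 * xU + c3" "yU = l4 * xU + c4"
    using 3 4 by (simp_all only: coll_def)
  then have y2: "2 * yP = g' * (xP - xU)"
    unfolding d2(1) by Groebner_Basis.algebra
  have "yP = l3 * xP + c3" "l3^2 = xR + xP + xU" "A - 2 * l3 * c3 = xR * xP + xR * xU + xP * xU"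
    using 3 by (simp_all only: coll_def)
  then have "3 * xP^2 + A - 2 * l3 * yP = (xP - xR) * (xP - xU)"
    by Groebner_Basis.algebra
  moreover have "2 * yP * (2 * xP + a') - g' * (3 * xP^2 + A) = (xP - xR) * (2 * yP - g' * (xP - xU))
      - g' * ((3 * xP^2 + A - 2 * l3 * yP) - (xP - xR) * (xP - xU))"
    unfolding d2(2) by Groebner_Basis.algebra
  ultimately have t2: "2 * yP * (2 * xP + a') = g' * (3 * xP^2 + A)"
    using y2 by simp
  have gg: "g = g'"
  proof (rule ccontr)
    assume ne': "g \<noteq> g'"
    define l c where "l = (a - a') / (g - g')" and "c = (b - b') / (g - g')"
    have g: "g - g' \<noteq> 0" using ne' by simp
    have l: "y = l * x + c" if "g * y = x^2 + a * x + b" "g' * y = x^2 + a' * x + b'" for x y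
    proof -
      have "(g - g') * y = (a - a') * x + (b - b')" using that by Groebner_Basis.algebra
      then have "y = ((a - a') * x + (b - b')) / (g - g')"
        using g by (simp add: nonzero_eq_divide_eq mult.commute)
      then show ?thesis by (simp add: l_def c_def add_divide_distrib)
    qed
    have P: "yP = l * xP + c" and R: "yR = l * xR + c"
      using l[OF c1(1) c2(2)] l[OF c1(3) c2(1)] .
    have "2 * yP * (a - a') = 2 * yP * (2 * xP + a) - 2 * yP * (2 * xP + a')" by Groebner_Basis.algebra
    then have "2 * yP * (a - a') = (g - g') * (3 * xP^2 + A)" unfolding t1 t2 by Groebner_Basis.algebra
    then have t: "2 * yP * l = 3 * xP^2 + A" using g by (simp add: l_def nonzero_divide_eq_eq mult.commute mult.left_commute)
    have "coll l c xP yP xP yP (l^2 - xP - xP) (l * (l^2 - xP - xP) + c)"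
      using tangent_collinear[OF on(1) P t] by simp
    \<comment> \<open>The cubic x^3 + A x + B minus the square of the tangent has the double root
      xP; dividing it out at xR leaves the third root.\<close>
    moreover have "xR = l^2 - xP - xP"
    proof -
      have "(l * xR + c)^2 = xR^3 + A * xR + B" "(l * xP + c)^2 = xP^3 + A * xP + B"
        using on P R by auto
      moreover have "2 * (l * xP + c) * l = 3 * xP^2 + A" using t P by simp
      moreover have "(xR - xP)^2 * (xR - (l^2 - xP - xP)) =
         ((xR^3 + A * xR + B) - (l * xR + c)^2) - ((xP^3 + A * xP + B) - (l * xP + c)^2)
         - (xR - xP) * ((3 * xP^2 + A) - 2 * (l * xP + c) * l)" by Groebner_Basis.algebra
      ultimately have "(xR - xP)^2 * (xR - (l^2 - xP - xP)) = 0" by simp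
      then show ?thesis using ne by simp
    qed
    ultimately have "coll l c xP yP xP yP xR yR" using R by simp
    then have "Aff xS yS = Aff xR (- yR)" using coll_add 1 by (metis minus_minus)
    then show False using coll_not_neg[OF 2] by simp
  qed
  have "2 * yP * (a - a') = 2 * yP * (2 * xP + a) - 2 * yP * (2 * xP + a')" by Groebner_Basis.algebra
  then have "2 * yP * (a - a') = 0" unfolding t1 t2 gg by simp
  then have aa: "a = a'" using y0 two_neq_0 by simp
  have bb: "b = b'" using c1(1) c2(2) gg aa by simp
  have g0: "g \<noteq> 0"
    using y2 y0 two_neq_0 gg by auto
  have x: "xT = xV" unfolding c1(5) c2(5) gg aa by (simp add: algebra_simps)
  then have "- g * yT = - g * yV" using c1(4) c2(4) gg aa bb by simp
  then show ?thesis using g0 x by simp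
qed

text \<open>Once the degenerate cases are gone, P and R have different abscissae, so Q coincides
  with at most one of them, and at most one of the lines PQ and RQ is a tangent. The claim is put as
  (P + Q) + R = (R + Q) + P, which is symmetric in P and R, so R = Q is the case P = Q with
  exchanged roles.\<close>

lemma add_assoc:
  assumes on: "on P" "on Q" "on R"
  shows "add (add P Q) R = add P (add Q R)"
proof -
  have can: "add (add X Y) (neg Y) = X" "add (neg Y) (add X Y) = X" if "on X" "on Y" for X Y
    using add_cancel that add_commute by (metis add_on on_neg)+
  have can': "add (add Y X) (neg Y) = X" "add (neg Y) (add Y X) = X"
     "add (add (neg Y) X) Y = X" "add Y (add (neg Y) X) = X"
     if "on X" "on Y" for X Y
    using can that by (metis add_commute add_cancel add_on on_neg neg_neg)+
  show ?thesis
  proof (cases "P = Infty \<or> Q = Infty \<or> R = Infty \<or> P = neg Q \<or> Q = neg R \<or> P = R \<or> P = neg R")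
    case True
    then consider "P = Infty \<or> Q = Infty \<or> R = Infty" | "P = neg Q" | "Q = neg R" | "P = R" | "P = neg R"
      by blast
    then show ?thesis
    proof cases
      case 2 then show ?thesis using can'[of R Q] on by simp
    next
      case 3 then show ?thesis using can(1)[of P "neg R"] on by simp
    next
      case 4 then show ?thesis using on add_commute by (metis add_on)
    next
      case 5
      have "add (neg R) (add Q R) = Q" using can on by simp
      moreover have "add (add (neg R) Q) R = Q" using can' on by simp
      ultimately show ?thesis using 5 by simp
    qed auto
  next
    case False
    obtain xP yP xQ yQ xR yR where P: "P = Aff xP yP" and Q: "Q = Aff xQ yQ" and R: "R = Aff xR yR"
      using False by (cases P; cases Q; cases R) auto
    have nPQ: "\<not> (xP = xQ \<and> yP = - yQ)" and nRQ: "\<not> (xR = xQ \<and> yR = - yQ)"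
      using False P Q R by auto
    have xPR: "xP \<noteq> xR" using on_x_eq on False P R by fastforce
    obtain l1 c1 xS yS where 1: "coll l1 c1 xP yP xQ yQ xS (- yS)" "add P Q = Aff xS yS"
      using add_coll[OF _ _ nPQ] on P Q by metis
    obtain l3 c3 xU yU where 3: "coll l3 c3 xR yR xQ yQ xU (- yU)" "add R Q = Aff xU yU"
      using add_coll[OF _ _ nRQ] on R Q by metis
    have onS: "on (Aff xS yS)" "on (Aff xU yU)" using 1 3 on add_on by metis+
    have g: "add (add P Q) R = add (add R Q) P"
    proof (cases "add P Q = neg R \<or> add R Q = neg P")
      case True
      have a: "add Y Q = neg X" if "add X Q = neg Y" "on X" "on Y" for X Y
      proof -
        have "neg X = add Q (neg (add X Q))"
          using that on neg_add add_commute can' by (metis add_on on_neg)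
        also have "\<dots> = add Y Q" using that on add_commute by simp
        finally show ?thesis by simp
      qed
      then have "add P Q = neg R" "add R Q = neg P" using True on by blast+
      then show ?thesis by simp
    next
      case False
      then have nSR: "\<not> (xS = xR \<and> yS = - yR)" and nUP: "\<not> (xU = xP \<and> yU = - yP)"
        using 1 3 P R by auto
      obtain l2 c2 xT yT where 2: "coll l2 c2 xS yS xR yR xT (- yT)" "add (add P Q) R = Aff xT yT"
        using add_coll[OF _ _ nSR] on onS R 1 by metis
      obtain l4 c4 xV yV where 4: "coll l4 c4 xU yU xP yP xV (- yV)" "add (add R Q) P = Aff xV yV"
        using add_coll[OF _ _ nUP] on onS P 3 by metis
      consider "xP \<noteq> xQ" "xR \<noteq> xQ" | "xP = xQ" | "xR = xQ" by blast
      then have "Aff xT yT = Aff xV yV"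
      proof cases
        case 1
        then show ?thesis using assoc_generic[OF \<open>coll l1 c1 _ _ _ _ _ _\<close> 2(1) 3(1) 4(1)] xPR by auto
      next
        case 2
        then have "yP = yQ" using on_x_eq on P Q nPQ by metis
        then show ?thesis
          using assoc_tangent[of l1 c1 xP yP xS yS l2 c2 xR yR xT yT l3 c3 xU yU l4 c4 xV yV]
            1 \<open>coll l2 c2 _ _ _ _ _ _\<close> 3 4 2 xPR by simp
      next
        case 3
        then have "yR = yQ" using on_x_eq on R Q nRQ by metis
        then show ?thesis
          using assoc_tangent[of l3 c3 xR yR xU yU l4 c4 xP yP xV yV l1 c1 xS yS l2 c2 xT yT]
            1 2 \<open>coll l3 c3 _ _ _ _ _ _\<close> 4 3 xPR coll_swap by simp
      qed
      then show ?thesis using 2 4 by simp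
    qed
    show ?thesis using g on add_commute by (metis add_on)
  qed
qed

end

section \<open>Jacobsthal sums and the number of points\<close>

definition quad_char :: "'a::field \<Rightarrow> int" where
  "quad_char a = (if a = 0 then 0 else if \<exists>y. y^2 = a then 1 else - 1)"

lemma quad_char_0 [simp]: "quad_char 0 = 0"
  by (simp add: quad_char_def)

lemma quad_char_eq_0_iff [simp]: "quad_char a = 0 \<longleftrightarrow> a = 0"
  by (simp add: quad_char_def)

lemma quad_char_square [simp]: "quad_char (x^2) = (if x = 0 then 0 else 1)"
  by (auto simp: quad_char_def)

lemma quad_char_1 [simp]: "quad_char 1 = 1"
  using quad_char_square[of 1] by simp

lemma quad_char_cases:
  assumes "a \<noteq> 0"
  shows "quad_char a = 1 \<or> quad_char a = - 1"
  using assms by (simp add: quad_char_def)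

lemma quad_char_sq: "a \<noteq> 0 \<Longrightarrow> (quad_char a)^2 = 1"
  using quad_char_cases[of a] by auto

lemma square_roots:
  fixes x :: "'a::field"
  shows "{y. y^2 = x^2} = {x, - x}"
  by (auto simp: power2_eq_iff)

lemma card_square_roots:
  fixes a :: "'a::{field,finite}"
  assumes "(2::'a) \<noteq> 0"
  shows "int (card {y. y^2 = a}) = 1 + quad_char a"
proof (cases "\<exists>x. x^2 = a")
  case True
  then obtain x where x: "a = x^2" by auto
  have "x = - x \<longleftrightarrow> x = 0"
    using assms by (metis add.inverse_neutral add_eq_0_iff mult_2 mult_eq_0_iff)
  then show ?thesis unfolding x square_roots by (auto simp: card_insert_if)
next
  case False
  then have "{y. y^2 = a} = {}" "a \<noteq> 0" by (auto intro: exI[of _ 0])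
  then show ?thesis using False by (simp add: quad_char_def)
qed

lemma sum_card_fibres:
  fixes f :: "'a::finite \<Rightarrow> 'b::finite"
  shows "(\<Sum>a\<in>UNIV. card {x. f x = a}) = CARD('a)"
proof -
  have "card (\<Union>a\<in>UNIV. {x. f x = a}) = (\<Sum>a\<in>UNIV. card {x. f x = a})"
    by (rule card_UN_disjoint) auto
  moreover have "(\<Union>a\<in>UNIV. {x. f x = a}) = UNIV" by auto
  ultimately show ?thesis by simp
qed

lemma sum_quad_char:
  assumes "(2::'a) \<noteq> 0"
  shows "(\<Sum>a\<in>(UNIV::'a::{field,finite} set). quad_char a) = 0"
proof -
  have "(\<Sum>a\<in>(UNIV::'a set). 1 + quad_char a) = int (\<Sum>a\<in>(UNIV::'a set). card {y. y^2 = a})"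
    by (simp add: card_square_roots[OF assms])
  also have "\<dots> = int CARD('a)" by (simp only: sum_card_fibres)
  finally show ?thesis by (simp add: sum.distrib)
qed

text \<open>The character sums to zero, so there are as many nonzero squares as non-squares.
  Multiplication by a non-square maps the squares injectively into the non-squares, hence onto them,
  and a product of two non-squares cannot land there again.\<close>

lemma quad_char_mult:
  fixes a b :: "'a::{field,finite}"
  assumes two: "(2::'a) \<noteq> 0"
  shows "quad_char (a * b) = quad_char a * quad_char b"
proof -
  define S N where "S = {a::'a. quad_char a = 1}" and "N = {a::'a. quad_char a = - 1}"
  have SN: "S \<inter> N = {}" "UNIV - {0} = S \<union> N"
    using quad_char_cases by (auto simp: S_def N_def)
  have "(\<Sum>a\<in>(UNIV::'a set). quad_char a) = (\<Sum>a\<in>(UNIV - {0::'a}). quad_char a)"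
    by (subst sum.remove[of _ 0]) auto
  also have "\<dots> = (\<Sum>a\<in>S. quad_char a) + (\<Sum>a\<in>N. quad_char a)"
    unfolding SN(2) by (rule sum.union_disjoint) (use SN in auto)
  also have "\<dots> = int (card S) - int (card N)"
    by (simp add: S_def N_def)
  finally have card: "card S = card N" using sum_quad_char[OF two] by simp
  have sq: "quad_char (x * y) = quad_char y" if "quad_char x = 1" for x y :: 'a
  proof -
    have "\<exists>y. y^2 = x" "x \<noteq> 0"
      using that by (auto simp: quad_char_def split: if_splits)
    then obtain u where u: "x = u^2" "u \<noteq> 0" by auto
    have "(\<exists>z. z^2 = u^2 * y) \<longleftrightarrow> (\<exists>z. z^2 = y)"
    proof
      assume "\<exists>z. z^2 = u^2 * y"
      then obtain z where "z^2 = u^2 * y" by auto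
      then have "(z / u)^2 = y" using u by (simp add: power_divide)
      then show "\<exists>z. z^2 = y" by blast
    next
      assume "\<exists>z. z^2 = y"
      then show "\<exists>z. z^2 = u^2 * y" by (metis power_mult_distrib)
    qed
    then show ?thesis using u by (simp add: quad_char_def)
  qed
  have ns: "quad_char (x * y) = 1" if x: "quad_char x = - 1" and y: "quad_char y = - 1" for x y :: 'a
  proof -
    have x0: "x \<noteq> 0" using x by auto
    have "(\<lambda>s. x * s) ` S \<subseteq> N"
      using sq x by (auto simp: S_def N_def mult.commute)
    moreover have "card ((\<lambda>s. x * s) ` S) = card S"
      using x0 by (intro card_image inj_onI) auto
    ultimately have im: "(\<lambda>s. x * s) ` S = N"
      using card by (metis card_subset_eq finite)
    show ?thesis
    proof (rule ccontr)
      assume "quad_char (x * y) \<noteq> 1"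
      moreover have "x * y \<noteq> 0" using x y by auto
      ultimately have "x * y \<in> N" using quad_char_cases[of "x * y"] by (auto simp: N_def)
      then obtain s where "s \<in> S" "x * y = x * s" using im by blast
      then show False using x0 y by (auto simp: S_def)
    qed
  qed
  show ?thesis
  proof (cases "a = 0 \<or> b = 0")
    case False
    then consider "quad_char a = 1" | "quad_char b = 1" | "quad_char a = - 1" "quad_char b = - 1"
      using quad_char_cases by blast
    then show ?thesis
    proof cases
      case 2
      then show ?thesis using sq[of b a] by (simp add: mult.commute)
    qed (use sq ns in auto)
  qed auto
qed

section \<open>Quadratic character sums over a finite field\<close>

lemma sum_shift:
  fixes f :: "'a::{field,finite} \<Rightarrow> int"
  shows "(\<Sum>x\<in>UNIV. f (x + c)) = (\<Sum>x\<in>UNIV. f x)"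
  by (rule sum.reindex_bij_witness[of _ "\<lambda>x. x - c" "\<lambda>x. x + c"]) auto

lemma sum_scale:
  fixes f :: "'a::{field,finite} \<Rightarrow> int"
  assumes "c \<noteq> 0"
  shows "(\<Sum>x\<in>UNIV. f (c * x)) = (\<Sum>x\<in>UNIV. f x)"
  by (rule sum.reindex_bij_witness[of _ "\<lambda>x. x / c" "\<lambda>x. c * x"]) (use assms in auto)

text \<open>For u \<noteq> v, shift to k (k + w) with w = v - u and divide by the square k^2: the
  argument 1 + w/k then runs through every field element except 1, whose character is 1.\<close>

lemma sum_quad_char_quadratic:
  fixes u v :: "'a::{field,finite}"
  assumes two: "(2::'a) \<noteq> 0"
  shows "(\<Sum>k\<in>UNIV. quad_char ((k + u) * (k + v))) = (if u = v then int CARD('a) - 1 else - 1)"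
proof (cases "u = v")
  case True
  have "(\<Sum>k\<in>UNIV. quad_char ((k + u) * (k + v))) = (\<Sum>k\<in>(UNIV::'a set). quad_char (k^2))"
    using sum_shift[of "\<lambda>k. quad_char (k^2)" u] True by (simp add: power2_eq_square)
  also have "\<dots> = (\<Sum>k\<in>(UNIV::'a set) - {0}. 1)"
    by (subst sum.remove[of _ 0]) auto
  finally show ?thesis using True by (simp add: of_nat_diff Suc_le_eq)
next
  case False
  define w where "w = v - u"
  have w: "w \<noteq> 0" using False by (simp add: w_def)
  have "(\<Sum>k\<in>UNIV. quad_char ((k + u) * (k + v))) = (\<Sum>k\<in>UNIV. quad_char (k * (k + w)))"
    using sum_shift[of "\<lambda>k. quad_char (k * (k + w))" u] by (simp add: w_def algebra_simps)
  also have "\<dots> = (\<Sum>k\<in>UNIV - {0}. quad_char (k * (k + w)))"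
    by (subst sum.remove[of _ 0]) auto
  also have "\<dots> = (\<Sum>k\<in>UNIV - {0}. quad_char (1 + w / k))"
  proof (rule sum.cong)
    fix k :: 'a assume "k \<in> UNIV - {0}"
    then have "k * (k + w) = k^2 * (1 + w / k)" "k \<noteq> 0"
      by (auto simp: power2_eq_square field_simps)
    then show "quad_char (k * (k + w)) = quad_char (1 + w / k)"
      using quad_char_mult[OF two, of "k^2"] by simp
  qed simp
  also have "\<dots> = (\<Sum>t\<in>UNIV - {1::'a}. quad_char t)"
    by (rule sum.reindex_bij_witness[of _ "\<lambda>t. w / (t - 1)" "\<lambda>k. 1 + w / k"]) (use w in auto)
  also have "\<dots> = - 1"
    using sum.remove[of "UNIV :: 'a set" 1 quad_char] sum_quad_char[OF two] by simp
  finally show ?thesis using False by simp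
qed

lemma card_affine_points:
  fixes f :: "'a::{field,finite} \<Rightarrow> 'a"
  assumes two: "(2::'a) \<noteq> 0"
  shows "int (card {(x, y). y^2 = f x}) = int CARD('a) + (\<Sum>x\<in>UNIV. quad_char (f x))"
proof -
  have "{(x, y). y^2 = f x} = (SIGMA x:UNIV. {y. y^2 = f x})" by auto
  then have "int (card {(x, y). y^2 = f x}) = (\<Sum>x\<in>UNIV. int (card {y. y^2 = f x}))"
    by simp
  then show ?thesis by (simp add: card_square_roots[OF two] sum.distrib)
qed

lemma sum_swap3:
  fixes f :: "'a::finite \<Rightarrow> 'a \<Rightarrow> int"
  shows "(\<Sum>k\<in>UNIV. (\<Sum>x\<in>UNIV. f k x)^2) = (\<Sum>x\<in>UNIV. \<Sum>y\<in>UNIV. \<Sum>k\<in>UNIV. f k x * f k y)"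
proof -
  have "(\<Sum>k\<in>UNIV. (\<Sum>x\<in>UNIV. f k x)^2) = (\<Sum>k\<in>UNIV. \<Sum>x\<in>UNIV. \<Sum>y\<in>UNIV. f k x * f k y)"
    by (simp add: power2_eq_square sum_product)
  also have "\<dots> = (\<Sum>x\<in>UNIV. \<Sum>k\<in>UNIV. \<Sum>y\<in>UNIV. f k x * f k y)"
    by (rule sum.swap)
  also have "\<dots> = (\<Sum>x\<in>UNIV. \<Sum>y\<in>UNIV. \<Sum>k\<in>UNIV. f k x * f k y)"
    by (intro sum.cong refl sum.swap)
  finally show ?thesis .
qed

text \<open>\<open>H\<close> is a subgroup of the unit group, described by closure under division,
  and \<open>U\<close> is a union of its cosets. Splitting off the coset of k leaves a set of the
  same kind, so for small index the units are exhausted by repeating this step; an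
  \<open>H\<close>-invariant function is constant on each piece.\<close>

lemma coset_step:
  fixes H U :: "'a::{field,finite} set" and k :: 'a
  assumes H: "0 \<notin> H" "1 \<in> H" "\<And>a b. a \<in> H \<Longrightarrow> b \<in> H \<Longrightarrow> a / b \<in> H"
    and U: "0 \<notin> U" "\<And>u h. u \<in> U \<Longrightarrow> h \<in> H \<Longrightarrow> u * h \<in> U" and k: "k \<in> U"
  defines "U' \<equiv> U - (\<lambda>h. k * h) ` H"
  shows "0 \<notin> U'" "\<And>u h. u \<in> U' \<Longrightarrow> h \<in> H \<Longrightarrow> u * h \<in> U'"
    "card U = card H + card U'"
    "\<And>g::'a \<Rightarrow> int. (\<And>x h. h \<in> H \<Longrightarrow> g (x * h) = g x) \<Longrightarrow>
       (\<Sum>x\<in>U. g x) = int (card H) * g k + (\<Sum>x\<in>U'. g x)"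
proof -
  have k0: "k \<noteq> 0" using k U(1) by auto
  have sub: "(\<lambda>h. k * h) ` H \<subseteq> U" using k U(2) by auto
  have inj: "inj_on (\<lambda>h. k * h) H" using k0 by (auto intro: inj_onI)
  show "0 \<notin> U'" using U by (simp add: U'_def)
  show "u * h \<in> U'" if "u \<in> U'" "h \<in> H" for u h
  proof -
    have "u * h \<notin> (\<lambda>h. k * h) ` H"
    proof
      assume "u * h \<in> (\<lambda>h. k * h) ` H"
      then obtain h' where h': "h' \<in> H" "u * h = k * h'" by auto
      moreover have "h \<noteq> 0" using that H(1) by auto
      ultimately have "u = k * (h' / h)"
        by (metis nonzero_mult_div_cancel_right times_divide_eq_right)
      then have "u \<in> (\<lambda>h. k * h) ` H" using H(3)[OF h'(1) that(2)] by blast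
      then show False using that by (simp add: U'_def)
    qed
    then show ?thesis using that U by (auto simp: U'_def)
  qed
  have "card U' = card U - card ((\<lambda>h. k * h) ` H)" "card ((\<lambda>h. k * h) ` H) \<le> card U"
    unfolding U'_def using sub by (auto intro!: card_Diff_subset card_mono)
  then show "card U = card H + card U'" using card_image[OF inj] by simp
  fix g :: "'a \<Rightarrow> int" assume g: "\<And>x h. h \<in> H \<Longrightarrow> g (x * h) = g x"
  have "(\<Sum>x\<in>U. g x) = (\<Sum>x\<in>U'. g x) + (\<Sum>x\<in>(\<lambda>h. k * h) ` H. g x)"
    unfolding U'_def by (rule sum.subset_diff[OF sub]) simp
  also have "(\<Sum>x\<in>(\<lambda>h. k * h) ` H. g x) = (\<Sum>h\<in>H. g k)"
    by (subst sum.reindex[OF inj]) (simp add: g)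
  finally show "(\<Sum>x\<in>U. g x) = int (card H) * g k + (\<Sum>x\<in>U'. g x)" by simp
qed

lemma card_nonzero: "int (card (UNIV - {0::'a::{field,finite}})) = int CARD('a) - 1"
  by (simp add: of_nat_diff Suc_le_eq)

text \<open>The first representative is prescribed, so that the coefficient of the curve under study
  can be taken as one of them.\<close>

lemma coset_sum2:
  fixes H :: "'a::{field,finite} set" and k :: 'a
  assumes H: "0 \<notin> H" "1 \<in> H" "\<And>a b. a \<in> H \<Longrightarrow> b \<in> H \<Longrightarrow> a / b \<in> H"
    and card: "card (UNIV - {0::'a}) = 2 * card H" and k: "k \<noteq> 0"
  obtains k' where "k' \<noteq> 0" "\<And>g::'a \<Rightarrow> int. (\<And>x h. h \<in> H \<Longrightarrow> g (x * h) = g x) \<Longrightarrow>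
       (\<Sum>x\<in>UNIV - {0}. g x) = int (card H) * (g k + g k')"
proof -
  have H0: "card H > 0" using H(2) by (auto simp: card_gt_0_iff)
  define U1 where "U1 = UNIV - {0} - (\<lambda>h. k * h) ` H"
  have z: "0 \<notin> UNIV - {0::'a}" "\<And>u h. u \<in> UNIV - {0} \<Longrightarrow> h \<in> H \<Longrightarrow> u * h \<in> UNIV - {0}" "k \<in> UNIV - {0}"
    using H(1) k by auto
  note 1 = coset_step[OF H z, folded U1_def]
  have u1: "0 \<notin> U1" "\<And>u h. u \<in> U1 \<Longrightarrow> h \<in> H \<Longrightarrow> u * h \<in> U1" "card U1 = card H"
    using 1(1-3) card by auto
  then obtain k' where k': "k' \<in> U1" using H0 by (metis card_gt_0_iff ex_in_conv)
  define U2 where "U2 = U1 - (\<lambda>h. k' * h) ` H"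
  note 2 = coset_step[OF H u1(1,2) k', folded U2_def]
  have "U2 = {}" using 2(3) u1(3) by simp
  then have "(\<Sum>x\<in>UNIV - {0}. g x) = int (card H) * (g k + g k')"
    if "\<And>x h. h \<in> H \<Longrightarrow> g (x * h) = g x" for g :: "'a \<Rightarrow> int"
    using 1(4)[of g] 2(4)[of g] that by (auto simp: algebra_simps)
  moreover have "k' \<noteq> 0" using k' u1 by auto
  ultimately show thesis using that by blast
qed

lemma coset_sum3:
  fixes H :: "'a::{field,finite} set" and k :: 'a
  assumes H: "0 \<notin> H" "1 \<in> H" "\<And>a b. a \<in> H \<Longrightarrow> b \<in> H \<Longrightarrow> a / b \<in> H"
    and card: "card (UNIV - {0::'a}) = 3 * card H" and k: "k \<noteq> 0"
  obtains k' k'' where "\<And>g::'a \<Rightarrow> int. (\<And>x h. h \<in> H \<Longrightarrow> g (x * h) = g x) \<Longrightarrow>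
       (\<Sum>x\<in>UNIV - {0}. g x) = int (card H) * (g k + g k' + g k'')"
proof -
  have H0: "card H > 0" using H(2) by (auto simp: card_gt_0_iff)
  define U1 where "U1 = UNIV - {0} - (\<lambda>h. k * h) ` H"
  have z: "0 \<notin> UNIV - {0::'a}" "\<And>u h. u \<in> UNIV - {0} \<Longrightarrow> h \<in> H \<Longrightarrow> u * h \<in> UNIV - {0}" "k \<in> UNIV - {0}"
    using H(1) k by auto
  note 1 = coset_step[OF H z, folded U1_def]
  have u1: "0 \<notin> U1" "\<And>u h. u \<in> U1 \<Longrightarrow> h \<in> H \<Longrightarrow> u * h \<in> U1" "card U1 = 2 * card H"
    using 1(1-3) card by auto
  then obtain k' where k': "k' \<in> U1" using H0
    by (metis card_gt_0_iff ex_in_conv nat_0_less_mult_iff zero_less_numeral)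
  define U2 where "U2 = U1 - (\<lambda>h. k' * h) ` H"
  note 2 = coset_step[OF H u1(1,2) k', folded U2_def]
  have c2: "card U2 = card H" using 2(3) u1(3) by simp
  then obtain k'' where k'': "k'' \<in> U2" using H0 by (metis card_gt_0_iff ex_in_conv)
  define U3 where "U3 = U2 - (\<lambda>h. k'' * h) ` H"
  note 3 = coset_step[OF H 2(1,2) k'', folded U3_def]
  have "U3 = {}" using 3(3) c2 by simp
  then have "(\<Sum>x\<in>UNIV - {0}. g x) = int (card H) * (g k + g k' + g k'')"
    if "\<And>x h. h \<in> H \<Longrightarrow> g (x * h) = g x" for g :: "'a \<Rightarrow> int"
    using 1(4)[of g] 2(4)[of g] 3(4)[of g] that by (auto simp: algebra_simps)
  then show thesis using that by blast
qed

section \<open>Jacobsthal's moments for x^3 + k and x^3 + k x\<close>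

lemma card_image_fibres:
  assumes "finite X" "\<And>x. x \<in> X \<Longrightarrow> card {y \<in> X. f y = f x} = n"
  shows "card X = n * card (f ` X)"
proof -
  have "card X = (\<Sum>c\<in>f ` X. card {x \<in> X. f x = c})"
    using sum.image_gen[OF assms(1), of "\<lambda>_. 1::nat" f] by simp
  also have "\<dots> = (\<Sum>c\<in>f ` X. n)" using assms(2) by (intro sum.cong) auto
  finally show ?thesis by simp
qed

text \<open>Without a nontrivial cube root of unity cubing is a bijection and the sum vanishes.
  Otherwise S (k t^3) = \<open>quad_char t * S k\<close>, so the twist T k =
  \<open>quad_char k * S k\<close> depends only on the class of k modulo cubes and takes three
  values T0, T1, T2 on nonzero k. The first and second moments over k show that their sum is 0 and
  the sum of their squares is 6 q. Hence (T1 - T2)^2 = 12 q - 3 T0^2, and T1 - T2 = 3 V.\<close>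

lemma cube_sum_cubic_trace:
  fixes k0 :: "'a::{field,finite}"
  defines "S \<equiv> (\<lambda>k::'a. \<Sum>x\<in>UNIV. quad_char (x^3 + k))"
  assumes two: "(2::'a) \<noteq> 0" and k0: "k0 \<noteq> 0"
  shows "S k0 = 0 \<or> (\<exists>V. 4 * int CARD('a) = (S k0)^2 + 3 * V^2)"
proof (cases "\<exists>w::'a. w \<noteq> 1 \<and> w^3 = 1")
  case False
  have inj: "inj (\<lambda>x::'a. x^3)"
  proof (rule injI)
    fix x y :: 'a assume e: "x^3 = y^3"
    show "x = y"
    proof (cases "y = 0")
      case False
      then have "(x / y)^3 = 1" using e by (simp add: power_divide)
      then have "x / y = 1" using \<open>\<nexists>w. w \<noteq> 1 \<and> w^3 = 1\<close> by blast
      then show ?thesis using False by simp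
    qed (use e in auto)
  qed
  then have bij: "bij (\<lambda>x::'a. x^3)" by (simp add: finite_UNIV_inj_surj bij_def)
  have "S k0 = (\<Sum>x\<in>UNIV. quad_char (x + k0))"
    unfolding S_def using sum.reindex_bij_betw[OF bij, of "\<lambda>x. quad_char (x + k0)"] by simp
  also have "\<dots> = 0" using sum_shift[of quad_char k0] sum_quad_char[OF two] by simp
  finally show ?thesis by simp
next
  case True
  then obtain w :: 'a where w: "w \<noteq> 1" "w^3 = 1" by auto
  define q where "q = int CARD('a)"
  have "(w - 1) * (w^2 + w + 1) = 0" using w(2) by Groebner_Basis.algebra
  then have w2: "w^2 + w + 1 = 0" using w(1) by simp
  have w0: "w \<noteq> 0" using w by auto
  have ww: "w^2 \<noteq> 1" "w^2 \<noteq> w"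
  proof -
    show "w^2 \<noteq> w" using w w0 by (simp add: power2_eq_square)
    show "w^2 \<noteq> 1"
    proof
      assume "w^2 = 1"
      then have "w^3 = w" by (simp add: power3_eq_cube power2_eq_square)
      then show False using w by simp
    qed
  qed
  have cubes: "{y. y^3 = x^3} = {x, w * x, w^2 * x}" for x :: 'a
  proof (intro equalityI subsetI)
    fix y assume "y \<in> {y. y^3 = x^3}"
    then have "y^3 - x^3 = 0" by simp
    moreover have "(y - x) * ((y - w * x) * (y - w^2 * x)) =
        y^3 - x^3 - (w^2+w+1) * y^2 * x + ((w^2+w+1) * w) * y * x^2 - (w^3 - 1) * x^3"
      by Groebner_Basis.algebra
    ultimately have "(y - x) * ((y - w * x) * (y - w^2 * x)) = 0" using w2 w by simp
    then show "y \<in> {x, w * x, w^2 * x}" by auto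
  next
    fix y assume "y \<in> {x, w * x, w^2 * x}"
    moreover have "(w^2)^3 = 1" using w(2) by (metis power_mult mult.commute power_one)
    ultimately show "y \<in> {y. y^3 = x^3}" using w by (auto simp: power_mult_distrib)
  qed
  have card_cubes: "card {y. y^3 = x^3} = (if x = 0 then 1 else 3)" for x :: 'a
    unfolding cubes using w ww w0 by (auto simp: card_insert_if)
  define T where "T k = quad_char k * S k" for k
  have cm: "quad_char (x * y) = quad_char x * quad_char y" for x y :: 'a
    by (rule quad_char_mult[OF two])
  have c3: "quad_char (t^3) = quad_char t" for t :: 'a
    using quad_char_cases[of t] by (cases "t = 0") (auto simp: power3_eq_cube cm)
  \<comment> \<open>First moment: after exchanging the sums, the inner sum over k has argument k (k
    + x^3), whose two roots coincide exactly for x = 0.\<close>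
  have "(\<Sum>k\<in>UNIV. T k) = (\<Sum>x\<in>(UNIV::'a set). \<Sum>k\<in>UNIV. quad_char ((k + 0) * (k + x^3)))"
    unfolding T_def S_def by (subst sum.swap) (simp add: sum_distrib_left cm add.commute)
  also have "\<dots> = (\<Sum>x\<in>UNIV. if (x::'a) = 0 then q - 1 else - 1)"
    by (simp only: sum_quad_char_quadratic[OF two] q_def) (auto intro!: sum.cong)
  also have "\<dots> = 0"
    by (subst sum.remove[of _ 0]) (auto simp: q_def of_nat_diff Suc_le_eq)
  finally have T1: "(\<Sum>k\<in>UNIV. T k) = 0" .
  have S0: "S 0 = 0" using sum_quad_char[OF two] by (simp add: S_def c3)
  have "(\<Sum>k\<in>UNIV. (S k)^2) =
      (\<Sum>x\<in>(UNIV::'a set). \<Sum>y\<in>UNIV. \<Sum>k\<in>UNIV. quad_char ((k + x^3) * (k + y^3)))"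
    unfolding S_def sum_swap3 cm by (simp add: add.commute)
  also have "\<dots> = (\<Sum>x\<in>(UNIV::'a set). \<Sum>y\<in>UNIV. if x^3 = y^3 then q - 1 else - 1)"
    by (simp only: sum_quad_char_quadratic[OF two] q_def)
  also have "\<dots> = (\<Sum>x\<in>(UNIV::'a set). q * int (card {y. y^3 = x^3}) - q)"
  proof (rule sum.cong)
    fix x :: 'a
    have "(\<Sum>y\<in>UNIV. if x^3 = y^3 then q - 1 else - 1) = (\<Sum>y\<in>UNIV. (if y^3 = x^3 then q else 0) - 1)"
      by (rule sum.cong) auto
    also have "\<dots> = q * int (card {y. y^3 = x^3}) - q"
      by (simp add: sum_subtractf sum.If_cases q_def mult.commute)
    finally show "(\<Sum>y\<in>UNIV. if x^3 = y^3 then q - 1 else - 1) = q * int (card {y. y^3 = x^3}) - q" .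
  qed simp
  \<comment> \<open>The fibre of cubing has one element at 0 and three elsewhere: x = 0 contributes
    q - q, and each of the other q - 1 elements 3 q - q.\<close>
  also have "\<dots> = 2 * q * (q - 1)"
    unfolding card_cubes
    by (subst sum.remove[of _ 0]) (auto simp: q_def of_nat_diff Suc_le_eq algebra_simps)
  finally have S2: "(\<Sum>k\<in>UNIV. (S k)^2) = 2 * q * (q - 1)" .
  have T2: "(T k)^2 = (S k)^2" for k
    using S0 quad_char_sq[of k] by (cases "k = 0") (auto simp: T_def power_mult_distrib)
  have Tinv: "T (k * t^3) = T k" if t: "t \<noteq> 0" for k t
  proof -
    have "S (k * t^3) = (\<Sum>x\<in>UNIV. quad_char ((t * x)^3 + k * t^3))"
      unfolding S_def using sum_scale[OF t, of "\<lambda>x. quad_char (x^3 + k * t^3)"] by simp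
    also have "\<dots> = (\<Sum>x\<in>UNIV. quad_char (t^3 * (x^3 + k)))"
      by (simp add: algebra_simps power_mult_distrib)
    also have "\<dots> = quad_char t * S k"
      unfolding S_def cm c3 by (simp add: sum_distrib_left)
    finally have "S (k * t^3) = quad_char t * S k" .
    then show ?thesis using quad_char_sq[OF t] by (simp add: T_def cm c3 power2_eq_square)
  qed
  define H where "H = (\<lambda>t::'a. t^3) ` (UNIV - {0})"
  have H: "0 \<notin> H" "1 \<in> H" "\<And>a b. a \<in> H \<Longrightarrow> b \<in> H \<Longrightarrow> a / b \<in> H"
  proof -
    show "a / b \<in> H" if ab: "a \<in> H" "b \<in> H" for a b
    proof -
      obtain x y where "a = x^3" "b = y^3" "x \<noteq> 0" "y \<noteq> 0" using ab unfolding H_def by blast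
      then have "a / b = (x / y)^3" "x / y \<noteq> 0" by (auto simp: power_divide)
      then show ?thesis by (auto simp: H_def)
    qed
  qed (auto simp: H_def intro: image_eqI[of _ _ 1])
  have "card (UNIV - {0::'a}) = 3 * card H"
    unfolding H_def
  proof (rule card_image_fibres)
    fix x :: 'a assume x: "x \<in> UNIV - {0}"
    then have "{y \<in> UNIV - {0}. y^3 = x^3} = {y. y^3 = x^3}" by auto
    then show "card {y \<in> UNIV - {0}. y^3 = x^3} = 3" using card_cubes[of x] x by simp
  qed simp
  then obtain k1 k2 where k12: "\<And>g::'a \<Rightarrow> int. (\<And>x h. h \<in> H \<Longrightarrow> g (x * h) = g x) \<Longrightarrow>
       (\<Sum>x\<in>UNIV - {0}. g x) = int (card H) * (g k0 + g k1 + g k2)"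
    using coset_sum3[OF H _ k0] by blast
  have cardH: "3 * int (card H) = q - 1" "card H > 0"
    using \<open>card (UNIV - {0::'a}) = 3 * card H\<close> card_nonzero[where 'a='a] H(2)
    by (auto simp: q_def card_gt_0_iff)
  have inv: "T (x * h) = T x" if "h \<in> H" for x h using that Tinv by (auto simp: H_def)
  have "(\<Sum>k\<in>UNIV - {0}. T k) = 0"
    using T1 sum.remove[of "UNIV::'a set" 0 T] by (simp add: T_def)
  then have s1: "T k0 + T k1 + T k2 = 0"
    using k12[of T] inv H(2) by auto
  have "(\<Sum>k\<in>UNIV - {0}. (T k)^2) = 2 * q * (q - 1)"
    using S2 S0 sum.remove[of "UNIV::'a set" 0 "\<lambda>k. (S k)^2"] by (simp add: T2)
  then have "int (card H) * ((T k0)^2 + (T k1)^2 + (T k2)^2) = int (card H) * (6 * q)"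
    using k12[of "\<lambda>k. (T k)^2"] inv cardH(1)[symmetric] by simp
  then have s2: "(T k0)^2 + (T k1)^2 + (T k2)^2 = 6 * q" using H(2) by auto
  have d: "(T k1 - T k2)^2 = 12 * q - 3 * (T k0)^2"
  proof -
    have "(T k1 - T k2)^2 = 2 * ((T k0)^2 + (T k1)^2 + (T k2)^2) - 2 * (T k0)^2 - (T k1 + T k2)^2"
      by (simp add: power2_eq_square algebra_simps)
    moreover have "T k1 + T k2 = - T k0" using s1 by simp
    ultimately show ?thesis using s2 by simp
  qed
  have "3 dvd (T k1 - T k2)^2"
    unfolding d by (simp add: dvd_diff)
  then have "3 dvd T k1 - T k2"
    using prime_dvd_power[of "3::int"] by (simp add: prime_int_numeral_eq)
  then obtain V where "T k1 - T k2 = 3 * V" by auto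
  then have "4 * q = (T k0)^2 + 3 * V^2" using d by (simp add: power_mult_distrib)
  then show ?thesis using T2 q_def by auto
qed

text \<open>Scaling x by t gives S (k t^2) = \<open>quad_char t * S k\<close>. If -1 is not a
  square, t = -1 shows S k = 0. If it is, (S k)^2 depends only on the class of k modulo squares, and
  the second moment over the two classes reads (S k0)^2 + (S k1)^2 = 4 q, so V is the value at the
  other class.\<close>

lemma square_sum_cubic_trace:
  fixes k0 :: "'a::{field,finite}"
  defines "S \<equiv> (\<lambda>k::'a. \<Sum>x\<in>UNIV. quad_char (x^3 + k * x))"
  assumes two: "(2::'a) \<noteq> 0" and k0: "k0 \<noteq> 0"
  shows "S k0 = 0 \<or> (\<exists>V. 4 * int CARD('a) = (S k0)^2 + V^2)"
proof -
  define q where "q = int CARD('a)"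
  have cm: "quad_char (x * y) = quad_char x * quad_char y" for x y :: 'a
    by (rule quad_char_mult[OF two])
  have c3: "quad_char (t^3) = quad_char t" for t :: 'a
    using quad_char_cases[of t] by (cases "t = 0") (auto simp: power3_eq_cube cm)
  have Sinv: "S (k * t^2) = quad_char t * S k" if t: "t \<noteq> 0" for k t
  proof -
    have "S (k * t^2) = (\<Sum>x\<in>UNIV. quad_char ((t * x)^3 + k * t^2 * (t * x)))"
      unfolding S_def using sum_scale[OF t, of "\<lambda>x. quad_char (x^3 + k * t^2 * x)"] by simp
    also have "\<dots> = (\<Sum>x\<in>UNIV. quad_char (t^3 * (x^3 + k * x)))"
      by (simp add: algebra_simps power_mult_distrib power2_eq_square power3_eq_cube)
    also have "\<dots> = quad_char t * S k"
      unfolding S_def cm c3 by (simp add: sum_distrib_left)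
    finally show ?thesis .
  qed
  show ?thesis
  proof (cases "quad_char (- 1 :: 'a) = 1")
    case False
    then have "quad_char (- 1 :: 'a) = - 1" using quad_char_cases[of "- 1 :: 'a"] by auto
    then have "S k0 = - S k0" using Sinv[of "- 1" k0] by simp
    then show ?thesis by simp
  next
    case True
    have S0: "S 0 = 0" using sum_quad_char[OF two] by (simp add: S_def c3)
    have "(\<Sum>k\<in>UNIV. (S k)^2) = (\<Sum>x\<in>(UNIV::'a set). \<Sum>y\<in>UNIV. \<Sum>k\<in>UNIV.
        (quad_char x * quad_char y) * quad_char ((k + x^2) * (k + y^2)))"
    proof -
      have e: "quad_char (x^3 + k * x) = quad_char x * quad_char (k + x^2)" for x k :: 'a
        unfolding cm[symmetric] by (simp add: algebra_simps power2_eq_square power3_eq_cube)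
      show ?thesis unfolding S_def sum_swap3 e cm by (simp add: mult_ac)
    qed
    also have "\<dots> = (\<Sum>x\<in>(UNIV::'a set). \<Sum>y\<in>UNIV.
        (quad_char x * quad_char y) * (if x^2 = y^2 then q - 1 else - 1))"
      by (simp only: sum_distrib_left[symmetric] sum_quad_char_quadratic[OF two] q_def)
    also have "\<dots> = (\<Sum>x\<in>(UNIV::'a set). \<Sum>y\<in>UNIV.
        (if y^2 = x^2 then q * (quad_char x * quad_char y) else 0) - quad_char x * quad_char y)"
      by (intro sum.cong) (auto simp: algebra_simps)
    also have "\<dots> = (\<Sum>x\<in>(UNIV::'a set). (\<Sum>y\<in>{y. y^2 = x^2}. q * (quad_char x * quad_char y)))
        - (\<Sum>x\<in>UNIV. \<Sum>y\<in>(UNIV::'a set). quad_char (x::'a) * quad_char y)"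
      by (simp add: sum_subtractf sum.If_cases)
    also have "(\<Sum>x\<in>UNIV. \<Sum>y\<in>(UNIV::'a set). quad_char (x::'a) * quad_char y) = 0"
      using sum_quad_char[OF two] by (simp add: sum_distrib_left[symmetric])
    also have "(\<Sum>x\<in>(UNIV::'a set). (\<Sum>y\<in>{y. y^2 = x^2}. q * (quad_char x * quad_char y)))
        = (\<Sum>x\<in>(UNIV::'a set). if x = 0 then 0 else 2 * q)"
    proof (rule sum.cong)
      fix x :: 'a
      show "(\<Sum>y\<in>{y. y^2 = x^2}. q * (quad_char x * quad_char y)) = (if x = 0 then 0 else 2 * q)"
      proof (cases "x = 0")
        case False
        have "x \<noteq> - x"
          using two False by (metis add_eq_0_iff mult_2 mult_eq_0_iff)
        moreover have "quad_char (- x) = quad_char x" using cm[of "- 1" x] True by simp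
        moreover have "quad_char x * quad_char x = 1"
          using quad_char_sq[OF False] by (simp add: power2_eq_square)
        ultimately show ?thesis using False unfolding square_roots by simp
      qed simp
    qed simp
    also have "\<dots> = 2 * q * (q - 1)"
      by (subst sum.remove[of _ 0]) (auto simp: q_def of_nat_diff Suc_le_eq algebra_simps)
    finally have S2: "(\<Sum>k\<in>UNIV. (S k)^2) = 2 * q * (q - 1)" by simp
    define H where "H = (\<lambda>t::'a. t^2) ` (UNIV - {0})"
    have H: "0 \<notin> H" "1 \<in> H" "\<And>a b. a \<in> H \<Longrightarrow> b \<in> H \<Longrightarrow> a / b \<in> H"
    proof -
      show "a / b \<in> H" if ab: "a \<in> H" "b \<in> H" for a b
      proof -
        obtain x y where "a = x^2" "b = y^2" "x \<noteq> 0" "y \<noteq> 0" using ab unfolding H_def by blast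
        then have "a / b = (x / y)^2" "x / y \<noteq> 0" by (auto simp: power_divide)
        then show ?thesis by (auto simp: H_def)
      qed
    qed (auto simp: H_def intro: image_eqI[of _ _ 1])
    have card: "card (UNIV - {0::'a}) = 2 * card H"
      unfolding H_def
    proof (rule card_image_fibres)
      fix x :: 'a assume x: "x \<in> UNIV - {0}"
      then have "x \<noteq> - x"
        using two by (metis DiffD2 add_eq_0_iff mult_2 mult_eq_0_iff singletonI)
      moreover have "{y \<in> UNIV - {0}. y^2 = x^2} = {x, - x}" using square_roots[of x] x by auto
      ultimately show "card {y \<in> UNIV - {0}. y^2 = x^2} = 2" by simp
    qed simp
    obtain k1 where k1: "\<And>g::'a \<Rightarrow> int. (\<And>x h. h \<in> H \<Longrightarrow> g (x * h) = g x) \<Longrightarrow>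
         (\<Sum>x\<in>UNIV - {0}. g x) = int (card H) * (g k0 + g k1)"
      using coset_sum2[OF H card k0] by blast
    have cardH: "2 * int (card H) = q - 1" "card H > 0"
      using card card_nonzero[where 'a='a] H(2) by (auto simp: q_def card_gt_0_iff)
    have inv: "(S (x * h))^2 = (S x)^2" if "h \<in> H" for x h
    proof -
      obtain t where t: "h = t^2" "t \<noteq> 0" using \<open>h \<in> H\<close> by (auto simp: H_def)
      then show ?thesis using Sinv[OF t(2)] quad_char_sq[OF t(2)] by (simp add: power_mult_distrib)
    qed
    have "(\<Sum>k\<in>UNIV - {0}. (S k)^2) = 2 * q * (q - 1)"
      using S2 S0 sum.remove[of "UNIV::'a set" 0 "\<lambda>k. (S k)^2"] by simp
    then have "int (card H) * ((S k0)^2 + (S k1)^2) = int (card H) * (4 * q)"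
      using k1[of "\<lambda>k. (S k)^2"] inv cardH(1)[symmetric] by simp
    then have "(S k0)^2 + (S k1)^2 = 4 * q" using H(2) by auto
    then show ?thesis using q_def by metis
  qed
qed

text \<open>The final 1 in N is the point at infinity, so N = q + 1 + S for the character sum S, and
  U = S + 2. In terms of complex multiplication, (S^2 + D V^2) / 4 is the norm of Frobenius and (U^2
  + D V^2) / 4 the norm of Frobenius minus 1.\<close>

lemma card_points_CM:
  fixes A B :: "'a::{field,finite}"
  assumes two: "(2::'a) \<noteq> 0" and AB: "A = 0 \<or> B = 0" "A \<noteq> 0 \<or> B \<noteq> 0"
  defines "N \<equiv> int (card {(x, y). y^2 = x^3 + A * x + B}) + 1"
  shows "N = int CARD('a) + 1 \<or>
    (\<exists>D\<in>{1,3}. \<exists>U V. 4 * N = U^2 + D * V^2 \<and> 4 * int CARD('a) = (U - 2)^2 + D * V^2)"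
proof -
  define q where "q = int CARD('a)"
  define S where "S = (\<Sum>x\<in>UNIV. quad_char (x^3 + A * x + B))"
  have N: "N = q + S + 1"
    unfolding N_def q_def S_def using card_affine_points[OF two, of "\<lambda>x. x^3 + A * x + B"] by simp
  have "S = 0 \<or> (\<exists>D\<in>{1,3}. \<exists>V. 4 * q = S^2 + D * V^2)"
  proof (cases "A = 0")
    case True
    then show ?thesis
      using cube_sum_cubic_trace[OF two, of B] AB by (auto simp: S_def q_def)
  next
    case False
    then show ?thesis
      using square_sum_cubic_trace[OF two, of A] AB by (auto simp: S_def q_def)
  qed
  then consider "S = 0" | D V where "D \<in> {1,3}" "4 * q = S^2 + D * V^2" by blast
  then show ?thesis
  proof cases
    case 1
    then show ?thesis using N q_def by simp
  next
    case 2
    then have "4 * N = (S + 2)^2 + D * V^2" "4 * q = (S + 2 - 2)^2 + D * V^2"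
      using N by (auto simp: power2_eq_square algebra_simps)
    then show ?thesis using 2(1) q_def by blast
  qed
qed

section \<open>Divisors and multiples represented by binary forms\<close>

definition num_divisors :: "nat \<Rightarrow> nat" where
  "num_divisors n = card {d. d dvd n}"

lemma num_divisors_prime_power_mult:
  assumes p: "prime p" and n: "n > 0"
  shows "num_divisors (p ^ e * n) \<le> (e + 1) * num_divisors n"
proof -
  have "{d. d dvd p ^ e * n} \<subseteq> (\<lambda>(i, d). p ^ i * d) ` ({..e} \<times> {d. d dvd n})"
  proof
    fix d assume "d \<in> {d. d dvd p ^ e * n}"
    then obtain b c where "d = b * c" "b dvd p ^ e" "c dvd n"
      using division_decomp[of d "p ^ e" n] by auto
    moreover from this obtain i where "b = p ^ i" "i \<le> e"
      using p by (auto simp: divides_primepow_nat)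
    ultimately show "d \<in> (\<lambda>(i, d). p ^ i * d) ` ({..e} \<times> {d. d dvd n})" by auto
  qed
  then have "num_divisors (p ^ e * n) \<le> card ((\<lambda>(i, d). p ^ i * d) ` ({..e} \<times> {d. d dvd n}))"
    unfolding num_divisors_def using n by (intro card_mono) auto
  also have "\<dots> \<le> card ({..e} \<times> {d. d dvd n})"
    using n by (intro card_image_le) auto
  finally show ?thesis by (simp add: num_divisors_def card_cartesian_product)
qed

lemma num_divisors_pos: "n > 0 \<Longrightarrow> num_divisors n > 0"
  unfolding num_divisors_def by (auto simp: card_gt_0_iff intro: exI[of _ 1])

text \<open>Peeling off a prime power p^e multiplies the divisor count by at most e + 1. If
  p^\<epsilon> \<ge> 2, this is at most 2^e and hence at most p^(e \<epsilon>); each of the finitely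
  many smaller primes costs one extra factor \<open>M\<close>, in total at most
  \<open>M ^ card K\<close>.\<close>

lemma num_divisors_bound:
  assumes "\<epsilon> > 0"
  obtains C where "C > 0" "\<And>n. n > 0 \<Longrightarrow> real (num_divisors n) \<le> C * real n powr \<epsilon>"
proof -
  define K where "K = {p::nat. prime p \<and> real p powr \<epsilon> < 2}"
  \<comment> \<open>Chosen so that e + 1 \<le> M (1 + e \<epsilon> ln 2) for every e, where 1 + e
    \<epsilon> ln 2 is at most 2^(e \<epsilon>).\<close>
  define M where "M = 1 + 1 / (\<epsilon> * ln 2)"
  have M1: "M \<ge> 1" using assms by (simp add: M_def)
  have "K \<subseteq> {..nat \<lceil>2 powr (1 / \<epsilon>)\<rceil>}"
  proof
    fix p assume "p \<in> K"
    then have p: "prime p" "real p powr \<epsilon> < 2" by (auto simp: K_def)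
    then have "(real p powr \<epsilon>) powr (1 / \<epsilon>) \<le> 2 powr (1 / \<epsilon>)"
      using assms by (intro powr_mono2) auto
    then have "real p \<le> 2 powr (1 / \<epsilon>)" using assms prime_gt_0_nat[OF p(1)] by (simp add: powr_powr)
    then show "p \<in> {..nat \<lceil>2 powr (1 / \<epsilon>)\<rceil>}" by (simp add: le_nat_iff) linarith
  qed
  then have finK: "finite K" by (rule finite_subset) auto
  have step: "real (e + 1) \<le> (if p \<in> K then M else 1) * real (p ^ e) powr \<epsilon>" if p: "prime p" for p e
  proof -
    have p2: "real p \<ge> 2" using prime_ge_2_nat[OF p] by simp
    have pe: "real (p ^ e) powr \<epsilon> = (real p powr \<epsilon>) ^ e"
      using p2 by (simp add: powr_power powr_realpow[symmetric] powr_powr mult.commute)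
    show ?thesis
    proof (cases "p \<in> K")
      case False
      then have "2 ^ e \<le> (real p powr \<epsilon>) ^ e" using p by (intro power_mono) (auto simp: K_def)
      moreover have "real (e + 1) \<le> 2 ^ e"
        using of_nat_mono[OF Suc_leI[OF less_exp[of e]], where 'a=real] by simp
      ultimately show ?thesis using False pe by simp
    next
      case True
      have "1 + real e * (\<epsilon> * ln 2) \<le> exp (real e * (\<epsilon> * ln 2))"
        using exp_ge_add_one_self by (simp add: add.commute)
      also have "\<dots> = (2 powr \<epsilon>) ^ e"
        by (simp add: powr_def exp_of_nat_mult)
      also have "\<dots> \<le> (real p powr \<epsilon>) ^ e"
        using p2 assms by (intro power_mono powr_mono2) auto
      finally have a: "1 + real e * (\<epsilon> * ln 2) \<le> real (p ^ e) powr \<epsilon>" by (simp only: pe)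
      have "real (e + 1) \<le> M * (1 + real e * (\<epsilon> * ln 2))"
        using assms by (simp add: M_def field_simps)
      also have "\<dots> \<le> M * real (p ^ e) powr \<epsilon>"
        using a M1 by (intro mult_left_mono) auto
      finally show ?thesis using True by simp
    qed
  qed
  have main: "real (num_divisors n) \<le> M ^ card (prime_factors n \<inter> K) * real n powr \<epsilon>" if "n > 0" for n
    using that
  proof (induction n rule: less_induct)
    case (less n)
    show ?case
    proof (cases "n = 1")
      case True
      then show ?thesis by (simp add: num_divisors_def)
    next
      case False
      then obtain p where p: "prime p" "p dvd n" using prime_factor_nat by blast
      define e where "e = multiplicity p n"
      obtain n' where n': "n = p ^ e * n'" "\<not> p dvd n'"
        unfolding e_def using less.prems p(1)
        by (metis multiplicity_decompose' not_prime_unit less_irrefl)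
      have e: "e > 0" using p less.prems by (simp add: e_def prime_multiplicity_gt_zero_iff)
      have n0: "n' > 0" using less.prems n' by (cases n') auto
      have "1 < p ^ e" by (rule one_less_power[OF prime_gt_1_nat[OF p(1)] e])
      then have "1 * n' < p ^ e * n'" using n0 by (simp only: mult_less_mono1)
      then have "n' < n" using n' by simp
      note IH = less.IH[OF this n0]
      have pf: "prime_factors n = insert p (prime_factors n')"
        unfolding n'(1) using n0 p(1) e
        by (simp add: prime_factors_product prime_factorization_prime_power)
      have "p \<notin> prime_factors n'" using n' by (auto simp: prime_factors_dvd)
      then have c: "(if p \<in> K then M else 1) * M ^ card (prime_factors n' \<inter> K) = M ^ card (prime_factors n \<inter> K)"
        unfolding pf by auto
      have "real (num_divisors n) \<le> real (e + 1) * real (num_divisors n')"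
        using num_divisors_prime_power_mult[OF p(1) n0, of e] n'(1) by (metis of_nat_le_iff of_nat_mult)
      also have "\<dots> \<le> ((if p \<in> K then M else 1) * real (p ^ e) powr \<epsilon>)
           * (M ^ card (prime_factors n' \<inter> K) * real n' powr \<epsilon>)"
        using step[OF p(1), of e] IH M1 by (intro mult_mono) auto
      also have "\<dots> = M ^ card (prime_factors n \<inter> K) * (real (p ^ e) powr \<epsilon> * real n' powr \<epsilon>)"
        unfolding c[symmetric] by simp
      also have "real (p ^ e) powr \<epsilon> * real n' powr \<epsilon> = real n powr \<epsilon>"
        unfolding n'(1) of_nat_mult by (rule powr_mult[symmetric])
      finally show ?thesis .
    qed
  qed
  have "real (num_divisors n) \<le> M ^ card K * real n powr \<epsilon>" if "n > 0" for n
  proof -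
    have "M ^ card (prime_factors n \<inter> K) \<le> M ^ card K"
      using M1 finK by (intro power_increasing card_mono) auto
    then have "M ^ card (prime_factors n \<inter> K) * real n powr \<epsilon> \<le> M ^ card K * real n powr \<epsilon>"
      by (intro mult_right_mono) auto
    then show ?thesis using main[OF that] by linarith
  qed
  then show thesis using that[of "M ^ card K"] M1 by simp
qed

section \<open>Counting pairs in a box with m dividing U^2 + D V^2\<close>

lemma card_residue_class:
  fixes S :: "int set" and X :: nat and L :: int
  assumes S: "S \<subseteq> {- int X..int X}" and L: "L > 0" and d: "\<And>u v. u \<in> S \<Longrightarrow> v \<in> S \<Longrightarrow> L dvd u - v"
  shows "real (card S) \<le> 2 * real X / real_of_int L + 1"
proof -
  have "card S = card ((\<lambda>u. (u + int X) div L) ` S)"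
  proof (rule card_image[symmetric], rule inj_onI)
    fix u v assume uv: "u \<in> S" "v \<in> S" "(u + int X) div L = (v + int X) div L"
    have "L dvd (u + int X) - (v + int X)" using d uv by simp
    then have "(u + int X) mod L = (v + int X) mod L" by (simp add: mod_eq_dvd_iff)
    then show "u = v" using uv(3) by (metis add_right_cancel div_mult_mod_eq)
  qed
  also have "\<dots> \<le> card {0..(2 * int X) div L}"
  proof (rule card_mono)
    show "(\<lambda>u. (u + int X) div L) ` S \<subseteq> {0..(2 * int X) div L}"
      using S L by (force intro!: zdiv_mono1 pos_imp_zdiv_nonneg_iff[THEN iffD2])
  qed simp
  also have "\<dots> = nat ((2 * int X) div L + 1)" by simp
  finally have "card S \<le> nat ((2 * int X) div L + 1)" .
  moreover have "(2 * int X) div L \<ge> 0" using L by (simp add: pos_imp_zdiv_nonneg_iff)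
  ultimately have "real (card S) \<le> real_of_int ((2 * int X) div L + 1)" by linarith
  also have "\<dots> \<le> 2 * real X / real_of_int L + 1"
    using real_of_int_div4[of "2 * int X" L] by simp
  finally show ?thesis .
qed

text \<open>Fix one solution U0. For any other U, m divides (U - U0) (U + U0); with u = gcd m (U -
  U0) and v = m div u this confines U to a single class modulo lcm u v = m / gcd u v. There are at
  most as many u as divisors of m, and gcd u v divides 12 gcd m V, so the modulus is nearly m unless
  V shares a large factor with m.\<close>

lemma card_square_roots_mod:
  fixes D V m :: int and X :: nat
  assumes m: "m > 0" and D: "D \<in> {1, 3}"
  shows "real (card {U. \<bar>U\<bar> \<le> int X \<and> m dvd U^2 + D * V^2}) \<le>
    real (num_divisors (nat m)) * (12 * real_of_int (gcd m V) * (2 * real X / real_of_int m + 1))"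
proof (cases "{U. \<bar>U\<bar> \<le> int X \<and> m dvd U^2 + D * V^2} = {}")
  case False
  define S where "S = {U. \<bar>U\<bar> \<le> int X \<and> m dvd U^2 + D * V^2}"
  obtain U0 where U0: "U0 \<in> S" using False by (auto simp: S_def)
  have Sfin: "finite S" by (rule finite_subset[of _ "{- int X..int X}"]) (auto simp: S_def)
  define f where "f U = gcd m (U - U0)" for U
  have fib: "real (card {U \<in> S. f U = u}) \<le> 12 * real_of_int (gcd m V) * (2 * real X / real_of_int m + 1)"
    (is "_ \<le> ?R") if u: "u \<in> f ` S" for u
  proof -
    have um: "u dvd m" "u > 0" using u m by (auto simp: f_def)
    define v where "v = m div u"
    have mv: "m = u * v" using um by (simp add: v_def)
    have v0: "v > 0" using m um mv by (simp add: zero_less_mult_iff)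
    define g where "g = gcd u v"
    have g0: "g > 0" using um by (simp add: g_def)
    have dv: "u dvd U - U0" "v dvd U + U0" if "U \<in> S" "f U = u" for U
    proof -
      have fU: "gcd m (U - U0) = u" using that by (simp add: f_def)
      then show uU: "u dvd U - U0" by auto
      then obtain w where w: "U - U0 = u * w" by (rule dvdE)
      have "m dvd U^2 + D * V^2" "m dvd U0^2 + D * V^2" using that U0 by (simp_all add: S_def)
      then have "m dvd (U^2 + D * V^2) - (U0^2 + D * V^2)" by (rule dvd_diff)
      also have "(U^2 + D * V^2) - (U0^2 + D * V^2) = (U - U0) * (U + U0)"
        by (simp add: power2_eq_square algebra_simps)
      also have "\<dots> = u * (w * (U + U0))" by (simp only: w mult.assoc)
      finally have "u * v dvd u * (w * (U + U0))" by (simp only: mv[symmetric])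
      then have "v dvd w * (U + U0)" using um by simp
      moreover have "coprime v w"
      proof -
        have "gcd (u * v) (u * w) = u" using fU by (simp only: w mv[symmetric])
        moreover have "gcd (u * v) (u * w) = u * gcd v w" using um by (simp add: gcd_mult_left)
        ultimately have "u * gcd v w = u * 1" by simp
        then have "gcd v w = 1" using um by (subst (asm) mult_cancel_left) auto
        then show ?thesis by (simp add: coprime_iff_gcd_eq_1)
      qed
      ultimately show "v dvd U + U0" by (simp add: coprime_dvd_mult_right_iff)
    qed
    have g12: "g dvd 12 * V"
    proof -
      obtain U where U: "U \<in> S" "f U = u" using u by auto
      have "g dvd u" "g dvd v" by (simp_all add: g_def)
      then have "g dvd U - U0" "g dvd U + U0" using dv[OF U] dvd_trans by blast+
      then have "g dvd (U + U0) - (U - U0)" by (rule dvd_diff[rotated])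
      then have "g dvd 2 * U0" by simp
      then have a: "g^2 dvd 4 * U0^2"
        using dvd_power_same[of g "2 * U0" 2] by (simp add: power_mult_distrib)
      have "g * g dvd m" unfolding mv g_def by (intro mult_dvd_mono) auto
      then have b: "g^2 dvd U0^2 + D * V^2" using U0 by (auto simp: S_def power2_eq_square intro: dvd_trans)
      have "g^2 dvd 4 * (U0^2 + D * V^2) - 4 * U0^2" by (rule dvd_diff[OF dvd_mult[OF b] a])
      then have "g^2 dvd 4 * D * V^2" by (simp add: algebra_simps)
      \<comment> \<open>4 D is 4 or 12, and both divide 144: this is the origin of the 12.\<close>
      moreover have "4 * D * V^2 dvd (12 * V)^2" using D by (auto simp: power_mult_distrib intro!: mult_dvd_mono)
      ultimately have "g^2 dvd (12 * V)^2" by (rule dvd_trans)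
      then show ?thesis by (subst (asm) pow_divides_pow_iff) auto
    qed
    have "{U \<in> S. f U = u} \<subseteq> {- int X..int X}" by (auto simp: S_def)
    moreover have "v * (u div g) dvd a - b" if "a \<in> {U \<in> S. f U = u}" "b \<in> {U \<in> S. f U = u}" for a b
    proof -
      have "u dvd (a - U0) - (b - U0)" "v dvd (a + U0) - (b + U0)"
        using dv that by (blast intro: dvd_diff)+
      then have "lcm u v dvd a - b" by simp
      moreover have "lcm u v = v * (u div g)"
      proof -
        have "gcd u v * lcm u v = u * v" using um v0 by (simp add: prod_gcd_lcm_int[symmetric])
        also have "\<dots> = g * (v * (u div g))" by (simp add: g_def mult.left_commute)
        finally have "g * lcm u v = g * (v * (u div g))" by (simp only: g_def)
        then show ?thesis using g0 by (subst (asm) mult_cancel_left) auto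
      qed
      ultimately show ?thesis by simp
    qed
    moreover have ug: "u div g > 0" using um g0 g_def by (simp add: pos_imp_zdiv_pos_iff zdvd_imp_le)
    ultimately have "real (card {U \<in> S. f U = u}) \<le> 2 * real X / real_of_int (v * (u div g)) + 1"
      using v0 by (intro card_residue_class) auto
    also have "2 * real X / real_of_int (v * (u div g)) = real_of_int g * (2 * real X / real_of_int m)"
    proof -
      have "v * (u div g) * g = m" using mv g_def by (simp add: mult.assoc)
      then have "real_of_int m = real_of_int (v * (u div g)) * real_of_int g" by (metis of_int_mult)
      then show ?thesis using g0 by simp
    qed
    also have "real_of_int g * (2 * real X / real_of_int m) + 1 \<le> real_of_int g * (2 * real X / real_of_int m + 1)"
      using g0 by (simp add: distrib_left)
    also have "\<dots> \<le> ?R"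
    proof (rule mult_right_mono)
      have "g dvd 12 * gcd m V"
      proof -
        have "g dvd 12 * m" unfolding mv g_def by (simp add: dvd_mult)
        then have "g dvd gcd (12 * m) (12 * V)" using g12 by simp
        then show ?thesis by (simp add: gcd_mult_left)
      qed
      then have "g \<le> 12 * gcd m V" using m by (intro zdvd_imp_le) auto
      then show "real_of_int g \<le> 12 * real_of_int (gcd m V)" by linarith
      show "0 \<le> 2 * real X / real_of_int m + 1" using m by simp
    qed
    finally show ?thesis .
  qed
  have "real (card S) = (\<Sum>u\<in>f ` S. real (card {U \<in> S. f U = u}))"
    using sum.image_gen[OF Sfin, of "\<lambda>_. 1::nat" f] by simp
  also have "\<dots> \<le> (\<Sum>u\<in>f ` S. 12 * real_of_int (gcd m V) * (2 * real X / real_of_int m + 1))"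
    by (rule sum_mono) (rule fib)
  also have "\<dots> = real (card (f ` S)) * (12 * real_of_int (gcd m V) * (2 * real X / real_of_int m + 1))"
    by simp
  also have "\<dots> \<le> real (num_divisors (nat m)) * (12 * real_of_int (gcd m V) * (2 * real X / real_of_int m + 1))"
  proof (rule mult_right_mono)
    have "card (f ` S) = card (nat ` f ` S)"
      by (rule card_image[symmetric]) (auto intro!: inj_onI simp: f_def eq_nat_nat_iff)
    also have "\<dots> \<le> num_divisors (nat m)"
      unfolding num_divisors_def using m
      by (intro card_mono) (auto simp: f_def nat_dvd_iff)
    finally show "real (card (f ` S)) \<le> real (num_divisors (nat m))" by simp
    show "0 \<le> 12 * real_of_int (gcd m V) * (2 * real X / real_of_int m + 1)" using m by simp
  qed
  finally show ?thesis by (simp add: S_def)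
next
  case True
  show ?thesis unfolding True using m by simp
qed

text \<open>The loss gcd m V in \<open>card_square_roots_mod\<close> averages out: a divisor d of m
  is the gcd for at most 2 X / d + 1 values of V, and d times this is at most 2 X + m.\<close>

lemma sum_gcd_interval:
  fixes m :: int and X :: nat
  assumes m: "m > 0"
  shows "(\<Sum>V\<in>{- int X..int X}. real_of_int (gcd m V)) \<le> real (num_divisors (nat m)) * (2 * real X + real_of_int m)"
proof -
  define Ds where "Ds = (\<lambda>V. gcd m V) ` {- int X..int X}"
  have "(\<Sum>V\<in>{- int X..int X}. real_of_int (gcd m V)) =
     (\<Sum>d\<in>Ds. \<Sum>V\<in>{V \<in> {- int X..int X}. gcd m V = d}. real_of_int (gcd m V))"
    unfolding Ds_def by (rule sum.image_gen) simp
  also have "\<dots> = (\<Sum>d\<in>Ds. real_of_int d * real (card {V \<in> {- int X..int X}. gcd m V = d}))"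
    by (rule sum.cong) auto
  also have "\<dots> \<le> (\<Sum>d\<in>Ds. 2 * real X + real_of_int m)"
  proof (rule sum_mono)
    fix d assume "d \<in> Ds"
    then have d: "d > 0" "d dvd m" "d \<le> m" using m by (auto simp: Ds_def intro: zdvd_imp_le)
    have "real (card {V \<in> {- int X..int X}. gcd m V = d}) \<le> 2 * real X / real_of_int d + 1"
    proof (rule card_residue_class[OF _ d(1)])
      fix u v assume "u \<in> {V \<in> {- int X..int X}. gcd m V = d}" "v \<in> {V \<in> {- int X..int X}. gcd m V = d}"
      then show "d dvd u - v" by (metis (mono_tags, lifting) dvd_diff gcd_dvd2 mem_Collect_eq)
    qed auto
    then have "real_of_int d * real (card {V \<in> {- int X..int X}. gcd m V = d}) \<le>
        real_of_int d * (2 * real X / real_of_int d + 1)"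
      using d by (intro mult_left_mono) auto
    also have "\<dots> = 2 * real X + real_of_int d" using d by (simp add: field_simps)
    finally show "real_of_int d * real (card {V \<in> {- int X..int X}. gcd m V = d}) \<le> 2 * real X + real_of_int m"
      using d by linarith
  qed
  also have "\<dots> = real (card Ds) * (2 * real X + real_of_int m)" by simp
  also have "\<dots> \<le> real (num_divisors (nat m)) * (2 * real X + real_of_int m)"
  proof (rule mult_right_mono)
    have "card Ds = card (nat ` Ds)"
      by (rule card_image[symmetric]) (auto intro!: inj_onI simp: Ds_def eq_nat_nat_iff)
    also have "\<dots> \<le> num_divisors (nat m)"
      unfolding num_divisors_def using m
      by (intro card_mono) (auto simp: Ds_def nat_dvd_iff)
    finally show "real (card Ds) \<le> real (num_divisors (nat m))" by simp
    show "0 \<le> 2 * real X + real_of_int m" using m by simp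
  qed
  finally show ?thesis .
qed

text \<open>For X of size sqrt P the bound has order P / m + m, up to the square of the divisor
  count. One divisor factor counts the classes of U for fixed V, the other comes from averaging gcd
  m V over V.\<close>

lemma card_norm_form_multiples:
  fixes D m :: int and X :: nat
  assumes m: "m > 0" and D: "D \<in> {1, 3}"
  shows "real (card {(U, V). \<bar>U\<bar> \<le> int X \<and> \<bar>V\<bar> \<le> int X \<and> m dvd U^2 + D * V^2}) \<le>
    12 * (real (num_divisors (nat m)))^2 * (2 * real X / real_of_int m + 1) * (2 * real X + real_of_int m)"
proof -
  define t where "t = real (num_divisors (nat m))"
  define c where "c = 2 * real X / real_of_int m + 1"
  have c0: "c \<ge> 0" "t \<ge> 0" using m by (auto simp: c_def t_def)
  have "{(U, V). \<bar>U\<bar> \<le> int X \<and> \<bar>V\<bar> \<le> int X \<and> m dvd U^2 + D * V^2} =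
     (\<lambda>(V, U). (U, V)) ` (SIGMA V:{- int X..int X}. {U. \<bar>U\<bar> \<le> int X \<and> m dvd U^2 + D * V^2})"
    by (auto simp: image_def)
  then have "card {(U, V). \<bar>U\<bar> \<le> int X \<and> \<bar>V\<bar> \<le> int X \<and> m dvd U^2 + D * V^2} =
     card (SIGMA V:{- int X..int X}. {U. \<bar>U\<bar> \<le> int X \<and> m dvd U^2 + D * V^2})"
    by (simp add: card_image inj_on_def split_beta prod_eq_iff)
  also have "\<dots> = (\<Sum>V\<in>{- int X..int X}. card {U. \<bar>U\<bar> \<le> int X \<and> m dvd U^2 + D * V^2})"
  proof (rule card_SigmaI)
    show "\<forall>V\<in>{- int X..int X}. finite {U. \<bar>U\<bar> \<le> int X \<and> m dvd U^2 + D * V^2}"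
      by (auto intro!: finite_subset[of _ "{- int X..int X}"])
  qed simp
  finally have "real (card {(U, V). \<bar>U\<bar> \<le> int X \<and> \<bar>V\<bar> \<le> int X \<and> m dvd U^2 + D * V^2}) =
     (\<Sum>V\<in>{- int X..int X}. real (card {U. \<bar>U\<bar> \<le> int X \<and> m dvd U^2 + D * V^2}))" by simp
  also have "\<dots> \<le> (\<Sum>V\<in>{- int X..int X}. t * (12 * real_of_int (gcd m V) * c))"
    unfolding t_def c_def by (rule sum_mono) (rule card_square_roots_mod[OF m D])
  also have "\<dots> = 12 * t * c * (\<Sum>V\<in>{- int X..int X}. real_of_int (gcd m V))"
    by (simp add: sum_distrib_left mult_ac)
  also have "\<dots> \<le> 12 * t * c * (t * (2 * real X + real_of_int m))"
    unfolding t_def using sum_gcd_interval[OF m, of X] c0(1) by (intro mult_left_mono) (auto simp: t_def)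
  finally show ?thesis by (simp add: t_def c_def power2_eq_square mult_ac)
qed

text \<open>If N = p + 1, then p lies in one residue class modulo m. Otherwise p is recovered from
  (U, V) by \<open>\<phi>\<close>, and m divides 4 N = U^2 + D V^2, so pairs in a box of side about
  sqrt P are counted in place of primes.\<close>

lemma card_CM_orders:
  fixes S :: "nat set" and m P :: nat
  assumes m: "m > 0" and P: "P > 0" and SP: "\<And>p. p \<in> S \<Longrightarrow> p \<le> P"
    and S: "\<And>p. p \<in> S \<Longrightarrow> \<exists>N. int m dvd N \<and> (N = int p + 1 \<or>
      (\<exists>D\<in>{1,3}. \<exists>U V. 4 * N = U^2 + D * V^2 \<and> 4 * int p = (U - 2)^2 + D * V^2))"
  shows "real (card S) \<le> 2000 * (real (num_divisors m))^2 * (real P / real m + real m)"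
proof -
  define s where "s = sqrt (real P)"
  \<comment> \<open>|U - 2| and |V| are at most 2 sqrt P; the extra 2 turns the first bound into one
    for |U|.\<close>
  define X where "X = nat \<lfloor>2 * s\<rfloor> + 2"
  define t where "t = real (num_divisors m)"
  have s1: "s \<ge> 1" "s^2 = real P" using P by (auto simp: s_def)
  have t1: "t^2 \<ge> 1" using num_divisors_pos[OF m] by (simp add: t_def)
  have X: "real X \<le> 4 * s" using s1 by (simp add: X_def) linarith
  define S0 where "S0 = {p. p \<le> P \<and> m dvd p + 1}"
  define B where "B D = {(U, V). \<bar>U\<bar> \<le> int X \<and> \<bar>V\<bar> \<le> int X \<and> int m dvd U^2 + D * V^2}" for D :: int
  define \<phi> where "\<phi> D = (\<lambda>(U, V). nat (((U - 2)^2 + D * V^2) div 4))" for D :: int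
  have finB: "finite (B D)" for D
    by (rule finite_subset[of _ "{- int X..int X} \<times> {- int X..int X}"]) (auto simp: B_def)
  have le: "\<bar>u\<bar> \<le> int (nat \<lfloor>2 * s\<rfloor>)" if "u^2 \<le> 4 * int P" for u :: int
  proof -
    have "(real_of_int u)^2 \<le> 4 * real P"
      using that by (metis (mono_tags) of_int_le_iff of_int_mult of_int_numeral of_int_of_nat_eq of_int_power)
    also have "\<dots> = (2 * s)^2" by (simp add: power_mult_distrib s1)
    finally have "\<bar>real_of_int u\<bar> \<le> \<bar>2 * s\<bar>" by (simp only: abs_le_square_iff)
    then have "\<bar>real_of_int u\<bar> \<le> 2 * s" using s1 by simp
    then show ?thesis using s1 by linarith
  qed
  have sub: "S \<subseteq> S0 \<union> (\<phi> 1 ` B 1 \<union> \<phi> 3 ` B 3)"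
  proof
    fix p assume p: "p \<in> S"
    then obtain N where N: "int m dvd N" "N = int p + 1 \<or>
      (\<exists>D\<in>{1,3}. \<exists>U V. 4 * N = U^2 + D * V^2 \<and> 4 * int p = (U - 2)^2 + D * V^2)"
      using S[OF p] by (elim exE conjE)
    show "p \<in> S0 \<union> (\<phi> 1 ` B 1 \<union> \<phi> 3 ` B 3)"
    proof (cases "N = int p + 1")
      case True
      then have "int m dvd int (p + 1)" using N by (simp add: add.commute)
      then show ?thesis using SP[OF p] unfolding int_dvd_int_iff by (simp add: S0_def)
    next
      case False
      then obtain D U V where D: "D \<in> {1,3}" "4 * N = U^2 + D * V^2" "4 * int p = (U - 2)^2 + D * V^2"
        using N by blast
      have "int m dvd U^2 + D * V^2" using N(1) D(2) by (metis dvd_mult)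
      have V0: "V^2 \<le> D * V^2" using D(1) by auto
      have "(U - 2)^2 \<le> 4 * int P" "V^2 \<le> 4 * int P"
        using D(3) V0 SP[OF p] zero_le_power2[of V] zero_le_power2[of "U - 2"] by linarith+
      then have "\<bar>U - 2\<bar> \<le> int (nat \<lfloor>2 * s\<rfloor>)" "\<bar>V\<bar> \<le> int (nat \<lfloor>2 * s\<rfloor>)" using le by auto
      then have "\<bar>U\<bar> \<le> int X" "\<bar>V\<bar> \<le> int X" by (auto simp: X_def)
      then have "(U, V) \<in> B D" using \<open>int m dvd U^2 + D * V^2\<close> by (simp add: B_def)
      moreover have "\<phi> D (U, V) = p" by (simp add: \<phi>_def D(3)[symmetric])
      ultimately have "p \<in> \<phi> D ` B D" by (metis imageI)
      then show ?thesis using D(1) by auto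
    qed
  qed
  have c0: "real (card S0) \<le> 2 * real P / real m + 1"
  proof -
    have "real (card (int ` S0)) \<le> 2 * real P / real_of_int (int m) + 1"
    proof (rule card_residue_class)
      show "int ` S0 \<subseteq> {- int P..int P}" by (auto simp: S0_def)
      fix u v assume "u \<in> int ` S0" "v \<in> int ` S0"
      then obtain a b where ab: "u = int a" "v = int b" "m dvd a + 1" "m dvd b + 1" by (auto simp: S0_def)
      then have "int m dvd int (a + 1) - int (b + 1)" by (intro dvd_diff) (simp_all only: int_dvd_int_iff)
      then show "int m dvd u - v" using ab by simp
    qed (use m in simp)
    then show ?thesis by (simp add: card_image)
  qed
  have cB: "real (card (\<phi> D ` B D)) \<le> 12 * t^2 * (72 * (real P / real m) + 9 * real m)" if D: "D \<in> {1, 3}" for D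
  proof -
    have mm: "real m > 0" using m by simp
    have "real (card (\<phi> D ` B D)) \<le> real (card (B D))" using card_image_le[OF finB] by simp
    also have "\<dots> \<le> 12 * t^2 * (2 * real X / real m + 1) * (2 * real X + real m)"
      using card_norm_form_multiples[OF _ D, of "int m" X] m by (simp add: B_def t_def)
    also have "\<dots> \<le> 12 * t^2 * (8 * s / real m + 1) * (8 * s + real m)"
    proof -
      have "2 * real X / real m + 1 \<le> 8 * s / real m + 1" "2 * real X + real m \<le> 8 * s + real m"
        using X mm by (simp_all add: divide_right_mono)
      then show ?thesis using mm s1 by (intro mult_mono mult_left_mono) auto
    qed
    also have "\<dots> = 12 * t^2 * ((8 * s / real m + 1) * (8 * s + real m))" by simp
    also have "(8 * s / real m + 1) * (8 * s + real m) = 64 * (s^2 / real m) + 16 * s + real m"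
      using mm by (simp add: field_simps power2_eq_square)
    \<comment> \<open>The cross term is split by 2 s \<le> s^2 / m + m, that is (s - m)^2 \<ge> 0,
      so 16 s costs 8 of each.\<close>
    also have "\<dots> \<le> 72 * (real P / real m) + 9 * real m"
    proof -
      have "0 \<le> (s - real m)^2 / real m" using mm by simp
      also have "\<dots> = s^2 / real m - 2 * s + real m"
        using mm by (simp add: field_simps power2_eq_square)
      finally show ?thesis unfolding s1(2) by linarith
    qed
    finally show ?thesis by (simp add: mult_left_mono)
  qed
  have S0fin: "finite S0" by (simp add: S0_def)
  have "card S \<le> card (S0 \<union> (\<phi> 1 ` B 1 \<union> \<phi> 3 ` B 3))"
    using sub finB S0fin by (intro card_mono) auto
  also have "\<dots> \<le> card S0 + (card (\<phi> 1 ` B 1) + card (\<phi> 3 ` B 3))"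
    by (meson card_Un_le add_left_mono order_trans)
  finally have "real (card S) \<le> real (card S0) + (real (card (\<phi> 1 ` B 1)) + real (card (\<phi> 3 ` B 3)))"
    by linarith
  also have "\<dots> \<le> (2 * (real P / real m) + 1) + 24 * t^2 * (72 * (real P / real m) + 9 * real m)"
    using c0 cB[of 1] cB[of 3] by simp
  also have "\<dots> \<le> t^2 * (2 * (real P / real m) + real m) + 24 * t^2 * (72 * (real P / real m) + 9 * real m)"
  proof -
    have "1 * (2 * (real P / real m) + 1) \<le> t^2 * (2 * (real P / real m) + real m)"
      using t1 m by (intro mult_mono add_left_mono) auto
    then show ?thesis by simp
  qed
  also have "\<dots> \<le> 2000 * t^2 * (real P / real m + real m)"
  proof -
    have "t^2 * (2 * (real P / real m) + real m) + 24 * t^2 * (72 * (real P / real m) + 9 * real m)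
      = t^2 * (1730 * (real P / real m) + 217 * real m)" by (simp add: algebra_simps)
    also have "\<dots> \<le> t^2 * (2000 * (real P / real m + real m))"
    proof (rule mult_left_mono)
      have "real P / real m \<ge> 0" by simp
      then show "1730 * (real P / real m) + 217 * real m \<le> 2000 * (real P / real m + real m)"
        unfolding distrib_left by (intro add_mono mult_right_mono) auto
    qed simp
    finally show ?thesis by (simp add: mult_ac)
  qed
  finally show ?thesis by (simp add: t_def)
qed

section \<open>Heights of rational points\<close>

definition rat_height :: "rat \<Rightarrow> int" where
  "rat_height x = max \<bar>fst (quotient_of x)\<bar> \<bar>snd (quotient_of x)\<bar>"

lemma rat_height_div:
  fixes a b :: int
  assumes b: "b \<noteq> 0"
  shows "rat_height (of_int a / of_int b) * gcd a b = max \<bar>a\<bar> \<bar>b\<bar>"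
proof -
  have g: "gcd a b > 0" using b by simp
  have "quotient_of (of_int a / of_int b) = Rat.normalize (a, b)"
    by (metis Fract_of_int_quotient quotient_of_Fract)
  then have "rat_height (of_int a / of_int b) = max \<bar>a div gcd a b\<bar> \<bar>b div gcd a b\<bar>"
    using b by (auto simp: rat_height_def Rat.normalize_def Let_def dvd_div_neg)
  then have "rat_height (of_int a / of_int b) * gcd a b = max (\<bar>a div gcd a b\<bar> * gcd a b) (\<bar>b div gcd a b\<bar> * gcd a b)"
    using g by (simp add: max_mult_distrib_right)
  moreover have "\<bar>a div gcd a b\<bar> * gcd a b = \<bar>a\<bar>" "\<bar>b div gcd a b\<bar> * gcd a b = \<bar>b\<bar>"
    using g by (metis abs_mult abs_of_pos dvd_div_mult_self gcd_dvd1 gcd_dvd2)+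
  ultimately show ?thesis by simp
qed

lemma rat_height_le:
  assumes "b \<noteq> 0"
  shows "rat_height (of_int a / of_int b) \<le> max \<bar>a\<bar> \<bar>b\<bar>"
proof -
  have "gcd a b \<ge> 1" using assms by (simp add: int_one_le_iff_zero_less)
  moreover have "rat_height (of_int a / of_int b) \<ge> 0" by (simp add: rat_height_def)
  ultimately have "rat_height (of_int a / of_int b) * 1 \<le> rat_height (of_int a / of_int b) * gcd a b"
    by (intro mult_left_mono) auto
  then show ?thesis using rat_height_div[OF assms, of a] by simp
qed

lemma rat_coprime_cases:
  obtains a b :: int where "x = of_int a / of_int b" "b > 0" "coprime a b" "rat_height x = max \<bar>a\<bar> \<bar>b\<bar>"
proof -
  obtain a b where ab: "quotient_of x = (a, b)" by fastforce
  then have "x = of_int a / of_int b" "b > 0" "coprime a b"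
    using quotient_of_div quotient_of_denom_pos quotient_of_coprime by blast+
  moreover have "rat_height x = max \<bar>a\<bar> \<bar>b\<bar>" using ab by (simp add: rat_height_def)
  ultimately show thesis using that by blast
qed

lemma rat_height_ge_1: "rat_height x \<ge> 1"
  by (rule rat_coprime_cases[of x]) simp

lemma finite_rat_height: "finite {x. rat_height x \<le> K}"
proof (rule finite_subset)
  show "{x. rat_height x \<le> K} \<subseteq> (\<lambda>(a, b). of_int a / of_int b) ` ({- K..K} \<times> {- K..K})"
  proof
    fix x assume "x \<in> {x. rat_height x \<le> K}"
    moreover obtain a b where "x = of_int a / of_int b" "b > 0" "rat_height x = max \<bar>a\<bar> \<bar>b\<bar>"
      by (rule rat_coprime_cases)
    ultimately show "x \<in> (\<lambda>(a, b). of_int a / of_int b) ` ({- K..K} \<times> {- K..K})"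
      by (auto intro!: image_eqI[of _ _ "(a, b)"])
  qed
qed auto

text \<open>The three bounded quantities are, up to sign, the coefficients of a product of two
  linear polynomials. The middle one controls only the sum of u v' and u' v; together with the bound
  M^2 for the product of these two terms it bounds each of them by 2 M.\<close>

lemma max_mult_le:
  fixes u v u' v' M :: int
  assumes "\<bar>u * u'\<bar> \<le> M" "\<bar>v * v'\<bar> \<le> M" "\<bar>u * v' + u' * v\<bar> \<le> M"
  shows "max \<bar>u\<bar> \<bar>v\<bar> * max \<bar>u'\<bar> \<bar>v'\<bar> \<le> 2 * M"
proof -
  have M0: "M \<ge> 0" using assms(1) by linarith
  have cross: "\<bar>p\<bar> \<le> 2 * M" if "\<bar>p * q\<bar> \<le> M^2" "\<bar>p + q\<bar> \<le> M" for p q :: int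
  proof (rule ccontr)
    assume "\<not> \<bar>p\<bar> \<le> 2 * M"
    then have "\<bar>p\<bar> \<ge> 2 * M + 1" "\<bar>q\<bar> \<ge> M + 1" using that by linarith+
    then have "(2 * M + 1) * (M + 1) \<le> \<bar>p\<bar> * \<bar>q\<bar>" using M0 by (intro mult_mono) auto
    then have "(2 * M + 1) * (M + 1) \<le> M^2" using that(1) by (simp add: abs_mult)
    moreover have "M * M \<ge> 0" by simp
    ultimately show False using M0 by (simp add: power2_eq_square algebra_simps)
  qed
  have "\<bar>u * u'\<bar> * \<bar>v * v'\<bar> \<le> M * M" using assms M0 by (intro mult_mono) auto
  then have pq: "\<bar>(u * v') * (u' * v)\<bar> \<le> M^2" by (simp add: abs_mult power2_eq_square mult_ac)
  have "\<bar>u * v'\<bar> \<le> 2 * M" using cross[OF pq assms(3)] .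
  moreover have "\<bar>u' * v\<bar> \<le> 2 * M" using cross[of "u' * v" "u * v'"] pq assms(3) by (simp add: mult_ac add_ac)
  moreover have "max \<bar>u\<bar> \<bar>v\<bar> * max \<bar>u'\<bar> \<bar>v'\<bar> \<in> {\<bar>u * u'\<bar>, \<bar>v * v'\<bar>, \<bar>u * v'\<bar>, \<bar>u' * v\<bar>}"
    by (auto simp: max_def abs_mult)
  ultimately show ?thesis using assms M0 by auto
qed

text \<open>By Gauss's lemma the coefficients of \<open>(v X - u) (v' X - u')\<close> are coprime when the two
  fractions are reduced, so they divide those of any integral multiple.\<close>

lemma rat_height_roots:
  fixes x y :: rat and q r s M :: int
  assumes q: "q \<noteq> 0" and s: "x + y = of_int s / of_int q" and r: "x * y = of_int r / of_int q"
    and M: "\<bar>q\<bar> \<le> M" "\<bar>r\<bar> \<le> M" "\<bar>s\<bar> \<le> M"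
  shows "rat_height x * rat_height y \<le> 2 * M"
proof -
  obtain u v where x: "x = of_int u / of_int v" "v > 0" "coprime u v" "rat_height x = max \<bar>u\<bar> \<bar>v\<bar>"
    by (rule rat_coprime_cases)
  obtain u' v' where y: "y = of_int u' / of_int v'" "v' > 0" "coprime u' v'" "rat_height y = max \<bar>u'\<bar> \<bar>v'\<bar>"
    by (rule rat_coprime_cases)
  have "rat_of_int (u * u' * q) = of_int (r * (v * v'))"
    using r x y q by (simp add: field_simps)
  then have 1: "u * u' * q = r * (v * v')" by (simp only: of_int_eq_iff)
  have "rat_of_int ((u * v' + u' * v) * q) = of_int (s * (v * v'))"
    using s x y q by (simp add: field_simps)
  then have 2: "(u * v' + u' * v) * q = s * (v * v')" by (simp only: of_int_eq_iff)
  have dv: "v * v' dvd q"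
  proof (rule ccontr)
    assume n: "\<not> v * v' dvd q"
    define g where "g = gcd (v * v') q"
    define w where "w = v * v' div g"
    have vv: "v * v' > 0" using x y by simp
    then have g: "g > 0" "v * v' = g * w" by (auto simp: g_def w_def)
    obtain q' where q': "q = g * q'" by (metis g_def dvdE gcd_dvd2)
    have cop: "coprime w q'"
    proof -
      have "gcd (g * w) (g * q') = g * gcd w q'" using g by (simp add: gcd_mult_left)
      moreover have "gcd (g * w) (g * q') = g" using g_def g(2) q' by metis
      ultimately have "g * 1 = g * gcd w q'" by simp
      then have "gcd w q' = 1" using g(1) by (subst (asm) mult_cancel_left) auto
      then show ?thesis by (simp add: coprime_iff_gcd_eq_1)
    qed
    have "g * (u * u' * q') = g * (r * w)" using 1 unfolding g(2) q' by (simp add: mult_ac)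
    then have "w dvd u * u' * q'" using g(1) by (subst (asm) mult_cancel_left) auto
    then have w1: "w dvd u * u'" using cop by (simp add: coprime_dvd_mult_left_iff)
    have "g * ((u * v' + u' * v) * q') = g * (s * w)" using 2 unfolding g(2) q' by (simp add: mult_ac)
    then have "w dvd (u * v' + u' * v) * q'" using g(1) by (subst (asm) mult_cancel_left) auto
    then have w2: "w dvd u * v' + u' * v" using cop by (simp add: coprime_dvd_mult_left_iff)
    have w3: "w dvd v * v'" using g(2) by simp
    have "is_unit w"
    proof (rule ccontr)
      assume nu: "\<not> is_unit w"
      then have "w \<noteq> 0" using vv g by auto
      then obtain p where p: "prime p" "p dvd w" using nu prime_divisor_exists by blast
      have "p dvd u * u'" "p dvd u * v' + u' * v" "p dvd v * v'" using w1 w2 w3 p(2) dvd_trans by blast+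
      then consider "p dvd u" "p dvd v'" | "p dvd u'" "p dvd v" | "p dvd u" "p dvd v" | "p dvd u'" "p dvd v'"
        using p(1) by (auto simp: prime_dvd_mult_iff)
      then show False
      proof cases
        case 1
        then have "p dvd u' * v" using \<open>p dvd u * v' + u' * v\<close> by (metis dvd_add_right_iff dvd_mult2)
        then show False using 1 x(3) y(3) p(1) by (auto simp: prime_dvd_mult_iff dest!: coprime_common_divisor)
      next
        case 2
        then have "p dvd u * v'" using \<open>p dvd u * v' + u' * v\<close> by (metis dvd_add_left_iff dvd_mult2)
        then show False using 2 x(3) y(3) p(1) by (auto simp: prime_dvd_mult_iff dest!: coprime_common_divisor)
      qed (use x(3) y(3) p(1) coprime_common_divisor not_prime_unit in blast)+
    qed
    then have "v * v' dvd g" using g(2) by (simp add: mult_unit_dvd_iff)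
    then show False using n g_def by (meson dvd_trans gcd_dvd2)
  qed
  then obtain k where k: "q = v * v' * k" by blast
  have vv: "v * v' \<noteq> 0" using x y by simp
  have "k \<noteq> 0" using q k by auto
  then have k1: "\<bar>k\<bar> \<ge> 1" by simp
  have "v * v' * (u * u' * k) = v * v' * r" using 1 unfolding k by (simp add: mult_ac)
  then have r': "r = u * u' * k" using vv by (subst (asm) mult_cancel_left) auto
  have "v * v' * ((u * v' + u' * v) * k) = v * v' * s" using 2 unfolding k by (simp add: mult_ac)
  then have s': "s = (u * v' + u' * v) * k" using vv by (subst (asm) mult_cancel_left) auto
  have le: "\<bar>t\<bar> \<le> \<bar>t * k\<bar>" for t :: int
    using mult_left_mono[OF k1, of "\<bar>t\<bar>"] by (simp add: abs_mult)
  have "\<bar>u * u'\<bar> \<le> M" "\<bar>v * v'\<bar> \<le> M" "\<bar>u * v' + u' * v\<bar> \<le> M"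
    using le[of "u * u'"] le[of "v * v'"] le[of "u * v' + u' * v"] M r' s' k by linarith+
  then show ?thesis unfolding x(4) y(4) by (rule max_mult_le)
qed

section \<open>Heights under addition and duplication\<close>

locale rational_curve =
  fixes a4 a6 :: int
  assumes nonsing: "4 * a4^3 + 27 * a6^2 \<noteq> 0"

sublocale rational_curve \<subseteq> weierstrass "rat_of_int a4" "rat_of_int a6"
proof
  have "rat_of_int (4 * a4^3 + 27 * a6^2) \<noteq> 0" using nonsing by (simp only: of_int_eq_0_iff not_False_eq_True)
  then show "4 * rat_of_int a4 ^ 3 + 27 * rat_of_int a6 ^ 2 \<noteq> 0" by simp
qed simp

context rational_curve
begin

text \<open>Replacing the second point by its negative only changes the sign of y1 y2 in the secant
  formula. Sum and product of the abscissae of P + R and P - R are therefore rational functions of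
  x1 and x2, with common denominator (x2 - x1)^2.\<close>

lemma secant_x_sum_prod:
  fixes x1 x2 y1 y2 l :: rat
  assumes "y1^2 = x1^3 + of_int a4 * x1 + of_int a6" "y2^2 = x2^3 + of_int a4 * x2 + of_int a6" "x1 \<noteq> x2"
  defines "x3 \<equiv> ((y2 - y1) / (x2 - x1))^2 - x1 - x2" and "x4 \<equiv> ((- y2 - y1) / (x2 - x1))^2 - x1 - x2"
  shows "(x3 + x4) * (x2 - x1)^2 = 2 * ((x1 + x2) * (of_int a4 + x1 * x2) + 2 * of_int a6)"
    "(x3 * x4) * (x2 - x1)^2 = (x1 * x2 - of_int a4)^2 - 4 * of_int a6 * (x1 + x2)"
proof -
  define d A B where "d = x2 - x1" and "A = rat_of_int a4" and "B = rat_of_int a6"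
  define N where "N = (x1 + x2) * (A + x1 * x2) + 2 * B"
  have d: "d \<noteq> 0" using assms(3) by (simp add: d_def)
  have y: "y1^2 = x1^3 + A * x1 + B" "y2^2 = x2^3 + A * x2 + B" using assms by (simp_all add: A_def B_def)
  have yy: "y1^2 + y2^2 - (x1 + x2) * d^2 = N" unfolding y N_def d_def by Groebner_Basis.algebra
  have "x3 * d^2 = (y2 - y1)^2 - (x1 + x2) * d^2"
    using d by (simp add: x3_def d_def[symmetric] power_divide field_simps)
  also have "\<dots> = (y1^2 + y2^2 - (x1 + x2) * d^2) - 2 * y1 * y2" by Groebner_Basis.algebra
  finally have x3: "x3 * d^2 = N - 2 * y1 * y2" unfolding yy .
  have "x4 * d^2 = (- y2 - y1)^2 - (x1 + x2) * d^2"
    using d by (simp add: x4_def d_def[symmetric] power_divide field_simps)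
  also have "\<dots> = (y1^2 + y2^2 - (x1 + x2) * d^2) + 2 * y1 * y2" by Groebner_Basis.algebra
  finally have x4: "x4 * d^2 = N + 2 * y1 * y2" unfolding yy .
  have "(x3 + x4) * d^2 = 2 * N" using x3 x4 by (simp add: distrib_right)
  then show "(x3 + x4) * (x2 - x1)^2 = 2 * ((x1 + x2) * (of_int a4 + x1 * x2) + 2 * of_int a6)"
    by (simp add: d_def N_def A_def B_def)
  have "(x3 * x4 * d^2) * d^2 = (x3 * d^2) * (x4 * d^2)" by simp
  also have "\<dots> = N^2 - 4 * (y1^2 * y2^2)" unfolding x3 x4 by Groebner_Basis.algebra
  also have "\<dots> = ((x1 * x2 - A)^2 - 4 * B * (x1 + x2)) * d^2"
    unfolding y N_def d_def by Groebner_Basis.algebra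
  finally have "x3 * x4 * d^2 = (x1 * x2 - A)^2 - 4 * B * (x1 + x2)" using d by simp
  then show "(x3 * x4) * (x2 - x1)^2 = (x1 * x2 - of_int a4)^2 - 4 * of_int a6 * (x1 + x2)"
    by (simp add: d_def A_def B_def)
qed

text \<open>With x1 = a/b and x2 = c/e, sum and product become s/q and r/q, where q, s and r are
  forms of degree 2 in (a, b) and in (c, e) and hence at most a multiple of the squared product of
  the heights. \<open>rat_height_roots\<close> turns this into the claim; \<open>K\<close> dominates
  the three coefficient bounds.\<close>

lemma height_secant:
  assumes on: "on (Aff x1 y1)" "on (Aff x2 y2)" and ne: "x1 \<noteq> x2"
    and 3: "add (Aff x1 y1) (Aff x2 y2) = Aff x3 y3" and 4: "add (Aff x1 y1) (neg (Aff x2 y2)) = Aff x4 y4"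
  defines "K \<equiv> 4 + 4 * \<bar>a4\<bar> + 8 * \<bar>a6\<bar> + (1 + \<bar>a4\<bar>)^2"
  shows "rat_height x3 * rat_height x4 \<le> 2 * (K * (rat_height x1 * rat_height x2)^2)"
proof -
  obtain a b where x1: "x1 = of_int a / of_int b" "b > 0" "rat_height x1 = max \<bar>a\<bar> \<bar>b\<bar>"
    by (rule rat_coprime_cases)
  obtain c e where x2: "x2 = of_int c / of_int e" "e > 0" "rat_height x2 = max \<bar>c\<bar> \<bar>e\<bar>"
    by (rule rat_coprime_cases)
  define h where "h = rat_height x1 * rat_height x2"
  have h0: "h \<ge> 0" using rat_height_ge_1[of x1] rat_height_ge_1[of x2] by (simp add: h_def)
  have le: "\<bar>a * c\<bar> \<le> h" "\<bar>a * e\<bar> \<le> h" "\<bar>c * b\<bar> \<le> h" "\<bar>b * e\<bar> \<le> h"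
    unfolding h_def x1(3) x2(3) abs_mult by (auto intro!: mult_mono simp: mult.commute[of "\<bar>c\<bar>" "\<bar>b\<bar>"])
  define q where "q = (c * b - a * e)^2"
  define s where "s = 2 * ((a * e + c * b) * (a4 * (b * e) + a * c) + 2 * (a6 * (b * e)^2))"
  define r where "r = (a * c - a4 * (b * e))^2 - 4 * (a6 * ((b * e) * (a * e + c * b)))"
  have be: "rat_of_int b \<noteq> 0" "rat_of_int e \<noteq> 0" using x1 x2 by auto
  have q: "of_int q = (x2 - x1)^2 * (of_int b * of_int e)^2"
    using be by (simp add: q_def x1 x2 field_simps power2_eq_square)
  have q0: "q \<noteq> 0" using q ne be by (metis mult_eq_0_iff of_int_0 power_not_zero right_minus_eq)
  have e1: "of_int a = x1 * of_int b" "of_int c = x2 * of_int e" using be x1 x2 by simp_all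
  have x3: "x3 = ((y2 - y1) / (x2 - x1))^2 - x1 - x2" and x4: "x4 = ((- y2 - y1) / (x2 - x1))^2 - x1 - x2"
    using 3 4 ne by (auto simp: Let_def)
  have sp: "(x3 + x4) * (x2 - x1)^2 = 2 * ((x1 + x2) * (of_int a4 + x1 * x2) + 2 * of_int a6)"
    "(x3 * x4) * (x2 - x1)^2 = (x1 * x2 - of_int a4)^2 - 4 * of_int a6 * (x1 + x2)"
    using secant_x_sum_prod[of y1 x1 y2 x2, folded x3 x4] on ne by simp_all
  have "(x3 + x4) * of_int q = ((x3 + x4) * (x2 - x1)^2) * (of_int b * of_int e)^2" by (simp add: q)
  also have "\<dots> = of_int s"
    unfolding sp by (simp add: s_def e1) Groebner_Basis.algebra
  finally have S: "x3 + x4 = of_int s / of_int q" using q0 by (simp add: field_simps)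
  have "(x3 * x4) * of_int q = ((x3 * x4) * (x2 - x1)^2) * (of_int b * of_int e)^2" by (simp add: q)
  also have "\<dots> = of_int r"
    unfolding sp by (simp add: r_def e1) Groebner_Basis.algebra
  finally have R: "x3 * x4 = of_int r / of_int q" using q0 by (simp add: field_simps)
  have mm: "\<bar>X * Y\<bar> \<le> m * n" if "\<bar>X\<bar> \<le> m" "\<bar>Y\<bar> \<le> n" for X Y m n :: int
    using that by (simp add: abs_mult mult_mono)
  have lin1: "\<bar>2 * (X + 2 * Y)\<bar> \<le> 2 * (m + 2 * n)" if "\<bar>X\<bar> \<le> m" "\<bar>Y\<bar> \<le> n" for X Y m n :: int
    using that by (auto simp: abs_le_iff)
  have lin2: "\<bar>X - 4 * Y\<bar> \<le> m + 4 * n" if "\<bar>X\<bar> \<le> m" "\<bar>Y\<bar> \<le> n" for X Y m n :: int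
    using that by (auto simp: abs_le_iff)
  have t1: "\<bar>a * e + c * b\<bar> \<le> 2 * h" "\<bar>c * b - a * e\<bar> \<le> 2 * h" using le by linarith+
  have t2: "\<bar>a4 * (b * e)\<bar> \<le> \<bar>a4\<bar> * h" using mm[OF order_refl le(4)] .
  then have t3: "\<bar>a4 * (b * e) + a * c\<bar> \<le> (1 + \<bar>a4\<bar>) * h" "\<bar>a * c - a4 * (b * e)\<bar> \<le> (1 + \<bar>a4\<bar>) * h"
    using le by (simp_all add: distrib_right)
  have "\<bar>q\<bar> \<le> (2 * h) * (2 * h)" unfolding q_def power2_eq_square by (rule mm[OF t1(2) t1(2)])
  then have Q: "\<bar>q\<bar> \<le> 4 * h^2" by (simp add: power2_eq_square)
  have "\<bar>(a * e + c * b) * (a4 * (b * e) + a * c)\<bar> \<le> (2 * h) * ((1 + \<bar>a4\<bar>) * h)" by (rule mm[OF t1(1) t3(1)])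
  moreover have "\<bar>a6 * ((b * e) * (b * e))\<bar> \<le> \<bar>a6\<bar> * (h * h)" by (rule mm[OF order_refl mm[OF le(4) le(4)]])
  ultimately have "\<bar>s\<bar> \<le> 2 * ((2 * h) * ((1 + \<bar>a4\<bar>) * h) + 2 * (\<bar>a6\<bar> * (h * h)))"
    unfolding s_def power2_eq_square by (rule lin1)
  then have S': "\<bar>s\<bar> \<le> (4 + 4 * \<bar>a4\<bar> + 4 * \<bar>a6\<bar>) * h^2" by (simp add: power2_eq_square algebra_simps)
  have "\<bar>(a * c - a4 * (b * e)) * (a * c - a4 * (b * e))\<bar> \<le> ((1 + \<bar>a4\<bar>) * h) * ((1 + \<bar>a4\<bar>) * h)"
    by (rule mm[OF t3(2) t3(2)])
  moreover have "\<bar>a6 * ((b * e) * (a * e + c * b))\<bar> \<le> \<bar>a6\<bar> * (h * (2 * h))"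
    by (rule mm[OF order_refl mm[OF le(4) t1(1)]])
  ultimately have "\<bar>r\<bar> \<le> ((1 + \<bar>a4\<bar>) * h) * ((1 + \<bar>a4\<bar>) * h) + 4 * (\<bar>a6\<bar> * (h * (2 * h)))"
    unfolding r_def power2_eq_square by (rule lin2)
  then have R': "\<bar>r\<bar> \<le> ((1 + \<bar>a4\<bar>)^2 + 8 * \<bar>a6\<bar>) * h^2" by (simp add: power2_eq_square algebra_simps)
  have "4 * h^2 \<le> K * h^2" "(4 + 4 * \<bar>a4\<bar> + 4 * \<bar>a6\<bar>) * h^2 \<le> K * h^2"
    "((1 + \<bar>a4\<bar>)^2 + 8 * \<bar>a6\<bar>) * h^2 \<le> K * h^2"
    unfolding K_def by (intro mult_right_mono; simp)+
  then have "\<bar>q\<bar> \<le> K * h^2" "\<bar>r\<bar> \<le> K * h^2" "\<bar>s\<bar> \<le> K * h^2" using Q S' R' by linarith+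
  from rat_height_roots[OF q0 S R this] show ?thesis by (simp add: h_def)
qed

lemma double_x:
  assumes on: "on (Aff x y)" and 2: "add (Aff x y) (Aff x y) = Aff x' y'"
  shows "x' * (4 * (x^3 + of_int a4 * x + of_int a6)) =
     x^4 - 2 * of_int a4 * x^2 - 8 * of_int a6 * x + (of_int a4)^2" "x^3 + of_int a4 * x + of_int a6 \<noteq> 0"
proof -
  have y: "y^2 = x^3 + of_int a4 * x + of_int a6" using on by simp
  have y0: "y \<noteq> 0" using 2 by auto
  then show "x^3 + of_int a4 * x + of_int a6 \<noteq> 0" using y by (metis power_not_zero)
  have "x' = ((3 * x^2 + of_int a4) / (2 * y))^2 - x - x" using 2 y0 by (auto simp: Let_def split: if_splits)
  then have "x' * (4 * y^2) = (3 * x^2 + of_int a4)^2 - 2 * x * (4 * y^2)"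
    using y0 by (simp add: field_simps)
  then show "x' * (4 * (x^3 + of_int a4 * x + of_int a6)) =
     x^4 - 2 * of_int a4 * x^2 - 8 * of_int a6 * x + (of_int a4)^2"
    unfolding y by Groebner_Basis.algebra
qed

text \<open>For x = a/b the double has x' = F/G with quartic forms F and G, which gives the upper
  bound. For the lower bound both cancellation in F/G and small values of F and G have to be
  controlled. The Bezout identities \<open>i1\<close> and \<open>i2\<close>, expressing 4 \<Delta>
  b^7 and 4 \<Delta> a^7 through F and G, do both: gcd F G divides 4 \<Delta>, and h^7 is at most K2
  h^3 times the maximum of |F| and |G|.\<close>

lemma height_double:
  obtains C c :: real where "C > 0" "c > 0"
    "\<And>x y x' y'. on (Aff x y) \<Longrightarrow> add (Aff x y) (Aff x y) = Aff x' y' \<Longrightarrow>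
       c * (rat_height x)^4 \<le> rat_height x' \<and> rat_height x' \<le> C * (rat_height x)^4"
proof -
  define \<Delta> where "\<Delta> = 4 * a4^3 + 27 * a6^2"
  define K1 where "K1 = 1 + 2 * \<bar>a4\<bar> + 8 * \<bar>a6\<bar> + a4^2 + 4 + 4 * \<bar>a4\<bar> + 4 * \<bar>a6\<bar>"
  \<comment> \<open>The sum of the absolute coefficients of the cubic cofactors \<open>f1\<close>,
    \<open>g1\<close>, \<open>f2\<close> and \<open>g2\<close> below.\<close>
  define K2 where "K2 = 12 + 16 * \<bar>a4\<bar> + (3 + 5 * \<bar>a4\<bar> + 27 * \<bar>a6\<bar>)
     + (4 * \<bar>\<Delta>\<bar> + 4 * \<bar>a4^2 * a6\<bar> + 4 * \<bar>a4 * (3 * a4^3 + 22 * a6^2)\<bar> + 12 * \<bar>a6 * (a4^3 + 8 * a6^2)\<bar>)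
     + (\<bar>a4^2 * a6\<bar> + \<bar>a4 * (5 * a4^3 + 32 * a6^2)\<bar> + 2 * \<bar>a6 * (13 * a4^3 + 96 * a6^2)\<bar>
        + 3 * \<bar>a4^2 * (a4^3 + 8 * a6^2)\<bar>)"
  have D0: "\<bar>\<Delta>\<bar> > 0" using nonsing by (simp add: \<Delta>_def)
  have K1: "K1 > 0" unfolding K1_def by (intro add_pos_nonneg) auto
  have K2: "K2 > 0" unfolding K2_def by (intro add_pos_nonneg add_nonneg_nonneg) auto
  have main: "rat_height x' \<le> K1 * (rat_height x)^4 \<and> (rat_height x)^4 \<le> K2 * rat_height x' * (4 * \<bar>\<Delta>\<bar>)"
    if on: "on (Aff x y)" and 2: "add (Aff x y) (Aff x y) = Aff x' y'" for x y x' y'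
  proof -
    obtain a b where x: "x = of_int a / of_int b" "b > 0" "coprime a b" "rat_height x = max \<bar>a\<bar> \<bar>b\<bar>"
      by (rule rat_coprime_cases)
    define h where "h = rat_height x"
    have ab: "\<bar>a\<bar> \<le> h" "\<bar>b\<bar> \<le> h" using x by (auto simp: h_def)
    have h1: "h \<ge> 1" by (simp add: h_def rat_height_ge_1)
    have mon: "\<bar>k * (a^i * b^j)\<bar> \<le> \<bar>k\<bar> * h^(i+j)" for k i j
      unfolding abs_mult power_abs[symmetric] power_add
      using ab h1 by (auto intro!: mult_mono power_mono simp: power_abs)
    define F where "F = a^4 - 2 * a4 * a^2 * b^2 - 8 * a6 * a * b^3 + a4^2 * b^4"
    define G where "G = 4 * a^3 * b + 4 * a4 * a * b^3 + 4 * a6 * b^4"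
    have b: "rat_of_int b \<noteq> 0" using x by simp
    have e: "of_int a = x * of_int b" using b x by simp
    note d = double_x[OF on 2]
    have G: "of_int G = 4 * (x^3 + of_int a4 * x + of_int a6) * (of_int b)^4"
      unfolding G_def by (simp add: e) Groebner_Basis.algebra
    have F: "of_int F = (x^4 - 2 * of_int a4 * x^2 - 8 * of_int a6 * x + (of_int a4)^2) * (of_int b)^4"
      unfolding F_def by (simp add: e) Groebner_Basis.algebra
    have G0: "G \<noteq> 0" using G d(2) b by (metis mult_eq_0_iff of_int_0 power_not_zero zero_neq_numeral)
    have "x' * of_int G = of_int F" unfolding G F d(1)[symmetric] by (simp add: mult_ac)
    then have x': "x' = of_int F / of_int G" using G0 by (simp add: field_simps)
    have "\<bar>F\<bar> \<le> (1 + 2 * \<bar>a4\<bar> + 8 * \<bar>a6\<bar> + a4^2) * h^4"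
    proof -
      have "F = 1 * (a^4 * b^0) - 2 * (a4 * (a^2 * b^2)) - 8 * (a6 * (a^1 * b^3)) + a4^2 * (a^0 * b^4)"
        by (simp add: F_def)
      moreover have "\<bar>X - 2 * Y - 8 * Z + W\<bar> \<le> \<bar>X\<bar> + 2 * \<bar>Y\<bar> + 8 * \<bar>Z\<bar> + \<bar>W\<bar>" for X Y Z W :: int by linarith
      ultimately have "\<bar>F\<bar> \<le> \<bar>1 * (a^4 * b^0)\<bar> + 2 * \<bar>a4 * (a^2 * b^2)\<bar> + 8 * \<bar>a6 * (a^1 * b^3)\<bar> + \<bar>a4^2 * (a^0 * b^4)\<bar>"
        by metis
      also have "\<dots> \<le> \<bar>1\<bar> * h^(4+0) + 2 * (\<bar>a4\<bar> * h^(2+2)) + 8 * (\<bar>a6\<bar> * h^(1+3)) + \<bar>a4^2\<bar> * h^(0+4)"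
        by (intro add_mono mult_left_mono mon) auto
      finally show ?thesis by (simp add: algebra_simps)
    qed
    moreover have "\<bar>G\<bar> \<le> (4 + 4 * \<bar>a4\<bar> + 4 * \<bar>a6\<bar>) * h^4"
    proof -
      have "G = 4 * (1 * (a^3 * b^1)) + 4 * (a4 * (a^1 * b^3)) + 4 * (a6 * (a^0 * b^4))"
        by (simp add: G_def)
      moreover have "\<bar>4 * X + 4 * Y + 4 * Z\<bar> \<le> 4 * \<bar>X\<bar> + 4 * \<bar>Y\<bar> + 4 * \<bar>Z\<bar>" for X Y Z :: int by linarith
      ultimately have "\<bar>G\<bar> \<le> 4 * \<bar>1 * (a^3 * b^1)\<bar> + 4 * \<bar>a4 * (a^1 * b^3)\<bar> + 4 * \<bar>a6 * (a^0 * b^4)\<bar>"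
        by metis
      also have "\<dots> \<le> 4 * (\<bar>1\<bar> * h^(3+1)) + 4 * (\<bar>a4\<bar> * h^(1+3)) + 4 * (\<bar>a6\<bar> * h^(0+4))"
        by (intro add_mono mult_left_mono mon) auto
      finally show ?thesis by (simp add: algebra_simps)
    qed
    moreover have "(1 + 2 * \<bar>a4\<bar> + 8 * \<bar>a6\<bar> + a4^2) * h^4 \<le> K1 * h^4" "(4 + 4 * \<bar>a4\<bar> + 4 * \<bar>a6\<bar>) * h^4 \<le> K1 * h^4"
      unfolding K1_def by (intro mult_right_mono; simp)+
    ultimately have up: "max \<bar>F\<bar> \<bar>G\<bar> \<le> K1 * h^4" by linarith
    have upper: "rat_height x' \<le> K1 * h^4"
      using rat_height_le[OF G0, of F] up unfolding x' by linarith
    define f1 where "f1 = 12 * a^2 * b + 16 * a4 * b^3"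
    define g1 where "g1 = 3 * a^3 - 5 * a4 * a * b^2 - 27 * a6 * b^3"
    define f2 where "f2 = 4 * \<Delta> * a^3 - 4 * (a4^2 * a6) * a^2 * b + 4 * (a4 * (3 * a4^3 + 22 * a6^2)) * a * b^2
       + 12 * (a6 * (a4^3 + 8 * a6^2)) * b^3"
    define g2 where "g2 = (a4^2 * a6) * a^3 + (a4 * (5 * a4^3 + 32 * a6^2)) * a^2 * b
       + 2 * (a6 * (13 * a4^3 + 96 * a6^2)) * a * b^2 - 3 * (a4^2 * (a4^3 + 8 * a6^2)) * b^3"
    have i1: "f1 * F - g1 * G = 4 * \<Delta> * b^7"
      unfolding f1_def g1_def F_def G_def \<Delta>_def by Groebner_Basis.algebra
    have i2: "f2 * F + g2 * G = 4 * \<Delta> * a^7"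
      unfolding f2_def g2_def F_def G_def \<Delta>_def by Groebner_Basis.algebra
    have "gcd F G dvd gcd (4 * \<Delta> * a^7) (4 * \<Delta> * b^7)"
      unfolding i1[symmetric] i2[symmetric] by (intro gcd_greatest dvd_add dvd_diff dvd_mult) auto
    also have "gcd (4 * \<Delta> * a^7) (4 * \<Delta> * b^7) = \<bar>4 * \<Delta>\<bar> * gcd (a^7) (b^7)" by (simp add: gcd_mult_left abs_mult)
    also have "gcd (a^7) (b^7) = 1" using x(3) by (simp add: coprime_iff_gcd_eq_1[symmetric])
    finally have gle: "gcd F G \<le> 4 * \<bar>\<Delta>\<bar>" using D0 by (intro zdvd_imp_le) (auto simp: abs_mult)
    have bnd4: "\<bar>X + Y + Z + W\<bar> \<le> \<bar>X\<bar> + \<bar>Y\<bar> + \<bar>Z\<bar> + \<bar>W\<bar>" for X Y Z W :: int by linarith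
    have poly3: "\<bar>k0 * a^3 + k1 * a^2 * b + k2 * a * b^2 + k3 * b^3\<bar> \<le> (\<bar>k0\<bar> + \<bar>k1\<bar> + \<bar>k2\<bar> + \<bar>k3\<bar>) * h^3" for k0 k1 k2 k3
    proof -
      have "\<bar>k0 * a^3 + k1 * a^2 * b + k2 * a * b^2 + k3 * b^3\<bar> \<le>
        \<bar>k0 * (a^3 * b^0)\<bar> + \<bar>k1 * (a^2 * b^1)\<bar> + \<bar>k2 * (a^1 * b^2)\<bar> + \<bar>k3 * (a^0 * b^3)\<bar>"
        using bnd4[of "k0 * (a^3 * b^0)" "k1 * (a^2 * b^1)" "k2 * (a^1 * b^2)" "k3 * (a^0 * b^3)"]
        by (simp add: mult.assoc)
      also have "\<dots> \<le> \<bar>k0\<bar> * h^(3+0) + \<bar>k1\<bar> * h^(2+1) + \<bar>k2\<bar> * h^(1+2) + \<bar>k3\<bar> * h^(0+3)"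
        by (intro add_mono mon)
      finally show ?thesis unfolding distrib_right by (simp add: power3_eq_cube)
    qed
    have cf: "\<bar>f1\<bar> \<le> (12 + 16 * \<bar>a4\<bar>) * h^3" "\<bar>g1\<bar> \<le> (3 + 5 * \<bar>a4\<bar> + 27 * \<bar>a6\<bar>) * h^3"
      "\<bar>f2\<bar> \<le> (4 * \<bar>\<Delta>\<bar> + 4 * \<bar>a4^2 * a6\<bar> + 4 * \<bar>a4 * (3 * a4^3 + 22 * a6^2)\<bar> + 12 * \<bar>a6 * (a4^3 + 8 * a6^2)\<bar>) * h^3"
      "\<bar>g2\<bar> \<le> (\<bar>a4^2 * a6\<bar> + \<bar>a4 * (5 * a4^3 + 32 * a6^2)\<bar> + 2 * \<bar>a6 * (13 * a4^3 + 96 * a6^2)\<bar>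
        + 3 * \<bar>a4^2 * (a4^3 + 8 * a6^2)\<bar>) * h^3"
      unfolding f1_def g1_def f2_def g2_def
      using poly3[of 0 12 0 "16 * a4"] poly3[of 3 0 "- 5 * a4" "- 27 * a6"]
        poly3[of "4 * \<Delta>" "- 4 * (a4^2 * a6)" "4 * (a4 * (3 * a4^3 + 22 * a6^2))" "12 * (a6 * (a4^3 + 8 * a6^2))"]
        poly3[of "a4^2 * a6" "a4 * (5 * a4^3 + 32 * a6^2)" "2 * (a6 * (13 * a4^3 + 96 * a6^2))" "- 3 * (a4^2 * (a4^3 + 8 * a6^2))"]
      by (simp_all add: abs_mult)
    define M where "M = max \<bar>F\<bar> \<bar>G\<bar>"
    have M0: "M \<ge> 0" by (simp add: M_def)
    have comb: "\<bar>X * F + Y * G\<bar> \<le> K2 * h^3 * M" if "\<bar>X\<bar> + \<bar>Y\<bar> \<le> K2 * h^3" for X Y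
    proof -
      have "\<bar>X * F + Y * G\<bar> \<le> \<bar>X\<bar> * \<bar>F\<bar> + \<bar>Y\<bar> * \<bar>G\<bar>"
        unfolding abs_mult[symmetric] by (rule abs_triangle_ineq)
      also have "\<dots> \<le> \<bar>X\<bar> * M + \<bar>Y\<bar> * M" by (intro add_mono mult_left_mono) (auto simp: M_def)
      also have "\<dots> = (\<bar>X\<bar> + \<bar>Y\<bar>) * M" by (simp add: distrib_right)
      also have "\<dots> \<le> K2 * h^3 * M" using that M0 by (rule mult_right_mono)
      finally show ?thesis .
    qed
    have h3: "h^3 \<ge> 0" using h1 by simp
    have "\<bar>f1\<bar> + \<bar>- g1\<bar> \<le> (12 + 16 * \<bar>a4\<bar> + (3 + 5 * \<bar>a4\<bar> + 27 * \<bar>a6\<bar>)) * h^3"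
      using cf(1,2) by (simp add: distrib_right)
    also have "\<dots> \<le> K2 * h^3" unfolding K2_def using h3 by (intro mult_right_mono) auto
    finally have k1: "\<bar>4 * \<Delta> * b^7\<bar> \<le> K2 * h^3 * M" using comb[of f1 "- g1"] i1 by simp
    have "\<bar>f2\<bar> + \<bar>g2\<bar> \<le> ((4 * \<bar>\<Delta>\<bar> + 4 * \<bar>a4^2 * a6\<bar> + 4 * \<bar>a4 * (3 * a4^3 + 22 * a6^2)\<bar> + 12 * \<bar>a6 * (a4^3 + 8 * a6^2)\<bar>)
     + (\<bar>a4^2 * a6\<bar> + \<bar>a4 * (5 * a4^3 + 32 * a6^2)\<bar> + 2 * \<bar>a6 * (13 * a4^3 + 96 * a6^2)\<bar>
        + 3 * \<bar>a4^2 * (a4^3 + 8 * a6^2)\<bar>)) * h^3"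
      using add_mono[OF cf(3,4)] by (simp only: distrib_right)
    also have "\<dots> \<le> K2 * h^3" unfolding K2_def using h3 by (intro mult_right_mono) auto
    finally have k2: "\<bar>4 * \<Delta> * a^7\<bar> \<le> K2 * h^3 * M" using comb[of f2 g2] i2 by simp
    have one: "\<bar>c\<bar>^7 \<le> K2 * h^3 * M" if "\<bar>4 * \<Delta> * c^7\<bar> \<le> K2 * h^3 * M" for c
    proof -
      have "1 * \<bar>c\<bar>^7 \<le> \<bar>4 * \<Delta>\<bar> * \<bar>c\<bar>^7" using D0 by (intro mult_right_mono) (auto simp: abs_mult)
      then show ?thesis using that by (simp add: abs_mult power_abs)
    qed
    have "h^7 \<le> K2 * h^3 * M"
    proof (cases "\<bar>a\<bar> \<le> \<bar>b\<bar>")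
      case True
      then have "h = \<bar>b\<bar>" using x by (simp add: h_def)
      then show ?thesis using one[OF k1] by simp
    next
      case False
      then have "h = \<bar>a\<bar>" using x by (simp add: h_def)
      then show ?thesis using one[OF k2] by simp
    qed
    then have "h^3 * h^4 \<le> h^3 * (K2 * M)" by (simp add: power_add[symmetric] mult_ac)
    moreover have "0 < h^3" using h1 by simp
    ultimately have l: "h^4 \<le> K2 * M" by (rule mult_left_le_imp_le)
    have "M = rat_height x' * gcd F G" using rat_height_div[OF G0, of F] by (simp add: x' M_def)
    also have "\<dots> \<le> rat_height x' * (4 * \<bar>\<Delta>\<bar>)"
      using gle rat_height_ge_1[of x'] by (intro mult_left_mono) auto
    finally have "K2 * M \<le> K2 * (rat_height x' * (4 * \<bar>\<Delta>\<bar>))" using K2 by (intro mult_left_mono) auto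
    then show ?thesis using upper l unfolding h_def by (simp add: mult_ac)
  qed
  show thesis
  proof (rule that[of "real_of_int K1" "1 / real_of_int (K2 * (4 * \<bar>\<Delta>\<bar>))"])
    fix x y x' y'
    assume "on (Aff x y)" "add (Aff x y) (Aff x y) = Aff x' y'"
    note m = main[OF this]
    have "real_of_int (rat_height x') \<le> real_of_int (K1 * (rat_height x)^4)" using m by (simp only: of_int_le_iff)
    moreover have "real_of_int ((rat_height x)^4) \<le> real_of_int (rat_height x' * (K2 * (4 * \<bar>\<Delta>\<bar>)))"
      using m by (simp only: of_int_le_iff) (simp add: mult_ac)
    ultimately show "1 / real_of_int (K2 * (4 * \<bar>\<Delta>\<bar>)) * (rat_height x)^4 \<le> rat_height x' \<and> rat_height x' \<le> real_of_int K1 * (rat_height x)^4"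
      using K2 D0 by (simp add: divide_le_eq)
  qed (use K1 K2 D0 in auto)
qed

end

section \<open>Quadratic growth of the heights of multiples\<close>

context weierstrass
begin

primrec mul :: "nat \<Rightarrow> 'a point \<Rightarrow> 'a point" where
  "mul 0 P = Infty"
| "mul (Suc n) P = add P (mul n P)"

lemma on_mul [simp]: "on P \<Longrightarrow> on (mul n P)"
  by (induction n) auto

lemma mul_add: "on P \<Longrightarrow> mul (m + n) P = add (mul m P) (mul n P)"
  by (induction m) (simp_all add: add_assoc)

lemma mul_diff:
  assumes "on P" "n \<le> m"
  shows "mul (m - n) P = add (mul m P) (neg (mul n P))"
proof -
  have "mul m P = add (mul n P) (mul (m - n) P)" using mul_add[OF assms(1), of n "m - n"] assms(2) by simp
  then have "add (neg (mul n P)) (mul m P) = mul (m - n) P" using assms(1) add_cancel by simp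
  then show ?thesis using add_commute[of "mul m P" "neg (mul n P)"] assms(1) by simp
qed

lemma mul_inj:
  assumes on: "on P" and ord: "\<And>n. n \<ge> 1 \<Longrightarrow> mul n P \<noteq> Infty"
  shows "inj (\<lambda>n. mul n P)"
proof (rule linorder_injI)
  fix m n :: nat assume "m < n"
  then have "mul (n - m) P = add (mul n P) (neg (mul m P))" "n - m \<ge> 1"
    using mul_diff[OF on, of m n] by auto
  then show "mul m P \<noteq> mul n P" using ord by (metis add_neg)
qed

end

text \<open>\<open>par\<close> with n = 1 bounds the second differences of g, and hence g by a
  multiple of n^2. In the other direction, \<open>par\<close> applied to m + n and m - n together
  with \<open>dbl\<close> yields the reverse estimate \<open>low\<close>. As g is unbounded, some g
  k exceeds the error term, and then the second differences along the multiples of k are at least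
  1.\<close>

lemma quasi_quadratic_growth:
  fixes g :: "nat \<Rightarrow> real" and C :: real
  assumes g0: "g 0 = 0" "\<And>n. g n \<ge> 0"
    and par: "\<And>m n. n \<le> m \<Longrightarrow> g (m + n) + g (m - n) \<le> 2 * g m + 2 * g n + C"
    and dbl: "\<And>n. g (2 * n) \<ge> 4 * g n - C"
    and unb: "\<And>K. \<exists>n. g n > K"
  obtains c c' d :: real where "c > 0" "c' > 0" "\<And>n. c * real n ^ 2 - d \<le> g n" "\<And>n. g n \<le> c' * real n ^ 2"
proof -
  have C0: "C \<ge> 0" using par[of 0 0] g0 by simp
  define K where "K = 2 * g 1 + C"
  have step: "g (Suc (Suc m)) - g (Suc m) \<le> g (Suc m) - g m + K" for m
    using par[of 1 "Suc m"] by (simp add: K_def)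
  have K0: "K \<ge> 0" using C0 g0 by (simp add: K_def)
  have diff: "g (Suc m) - g m \<le> g 1 + real m * K" for m
  proof (induction m)
    case (Suc m)
    have "real (Suc m) * K = real m * K + K" by (simp add: algebra_simps)
    then show ?case using Suc step[of m] by linarith
  qed (use g0 in simp)
  have up: "g n \<le> (g 1 + K) * real n ^ 2" for n
  proof (induction n)
    case (Suc n)
    have "g 1 + real n * K \<le> (g 1 + K) * (2 * real n + 1)"
      using K0 g0(2)[of 1] by (simp add: algebra_simps)
    then have "g (Suc n) \<le> (g 1 + K) * real n ^ 2 + (g 1 + K) * (2 * real n + 1)"
      using Suc diff[of n] by linarith
    also have "\<dots> = (g 1 + K) * (real n ^ 2 + (2 * real n + 1))" by (simp only: distrib_left)
    also have "real n ^ 2 + (2 * real n + 1) = real (Suc n) ^ 2" by (simp add: power2_eq_square algebra_simps)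
    finally show ?case .
  qed (simp add: g0(1))
  \<comment> \<open>One error C comes from \<open>par\<close> and one from each of two uses of
    \<open>dbl\<close>; the inequality is halved at the end.\<close>
  define C' where "C' = 3 * C / 2"
  have low: "2 * g m + 2 * g n - C' \<le> g (m + n) + g (m - n)" if "n \<le> m" for m n
  proof -
    have "(m + n) + (m - n) = 2 * m" "(m + n) - (m - n) = 2 * n" "m - n \<le> m + n"
      using that by linarith+
    then have "g (2 * m) + g (2 * n) \<le> 2 * g (m + n) + 2 * g (m - n) + C"
      using par[of "m - n" "m + n"] by (simp only:)
    then show ?thesis using dbl[of m] dbl[of n] by (simp add: C'_def)
  qed
  obtain k where k: "g k > C' + 1" using unb by blast
  have k0: "k > 0" using k g0 C0 by (cases k) (auto simp: C'_def)
  define b where "b j = g (j * k)" for j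
  have bstep: "b (Suc j) - b j \<ge> real j" for j
  proof (induction j)
    case 0
    then show ?case using g0 by (simp add: b_def)
  next
    case (Suc j)
    have "2 * b (Suc j) + 2 * g k - C' \<le> b (Suc (Suc j)) + b j"
      using low[of k "Suc j * k"] by (simp add: b_def algebra_simps)
    then show ?case using Suc k g0(2)[of k] by simp
  qed
  have bj: "b j \<ge> real j * (real j - 1) / 2" for j
  proof (induction j)
    case (Suc j)
    then show ?case using bstep[of j] by (simp add: field_simps)
  qed (use g0 in \<open>simp add: b_def\<close>)
  define R where "R = (g 1 + K) * real k ^ 2"
  have lower: "g n \<ge> (1 / (8 * real k ^ 2)) * real n ^ 2 - (R + C + 2)" for n
  proof -
    define j r where "j = n div k" and "r = n mod k"
    have n: "n = j * k + r" "r < k" using k0 by (auto simp: j_def r_def)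
    have gr: "g r \<le> R"
    proof -
      have "real r ^ 2 \<le> real k ^ 2" using n by (intro power_mono) auto
      then have "(g 1 + K) * real r ^ 2 \<le> R" unfolding R_def using K0 g0(2)[of 1] by (intro mult_left_mono) auto
      then show ?thesis using up[of r] by linarith
    qed
    \<comment> \<open>\<open>par\<close> at n and r bounds g (n - r) = g (j k), which carries the
      growth along the multiples of k over to every n.\<close>
    have a: "2 * g n + 2 * g r + C \<ge> b j"
    proof (cases "r \<le> n")
      case True
      then show ?thesis using par[of r n] g0(2)[of "n + r"] n by (simp add: b_def)
    qed (use n in simp)
    define x where "x = real n / real k"
    have x: "real j > x - 1" "real j \<ge> 0"
    proof -
      have "real n < (real j + 1) * real k"
        using n by (simp add: algebra_simps flip: of_nat_add of_nat_mult)
      then show "real j > x - 1" using k0 by (simp add: x_def field_simps)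
    qed simp
    \<comment> \<open>Half of x^2 is given up so that j > x - 1 suffices; the 8 is a generous
      allowance that also covers x < 2.\<close>
    have "real j * (real j - 1) \<ge> x^2 / 2 - 8"
    proof (cases "x \<ge> 2")
      case True
      then have "(x - 1) * (x - 2) \<le> real j * (real j - 1)" using x by (intro mult_mono) auto
      moreover have "(x - 1) * (x - 2) = x^2 / 2 - 8 + (x - 3)^2 / 2 + 11/2"
        by (simp add: power2_eq_square field_simps)
      moreover have "(x - 3)^2 \<ge> 0" by simp
      ultimately show ?thesis by linarith
    next
      case False
      have "x \<ge> 0" by (simp add: x_def)
      then have "x^2 \<le> 2^2" using False by (intro power_mono) auto
      moreover have "real j * (real j - 1) \<ge> - 1"
      proof -
        have "(real j - 1/2)^2 \<ge> 0" by simp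
        then show ?thesis by (simp add: power2_eq_square algebra_simps)
      qed
      ultimately show ?thesis by simp
    qed
    then have "(x^2 / 2 - 8) / 2 \<le> real j * (real j - 1) / 2" by (rule divide_right_mono) simp
    also have "\<dots> \<le> b j" by (rule bj)
    finally have "2 * g n + 2 * R + C \<ge> (x^2 / 2 - 8) / 2" using a gr by linarith
    then have "g n \<ge> x^2 / 8 - (R + C + 2)" using C0 by (simp add: field_simps)
    then show ?thesis by (simp add: x_def power_divide)
  qed
  show thesis
  proof (rule that[of "1 / (8 * real k ^ 2)" "g 1 + K + 1" "R + C + 2"])
    show "g n \<le> (g 1 + K + 1) * real n ^ 2" for n
    proof -
      have "(g 1 + K) * real n ^ 2 \<le> (g 1 + K + 1) * real n ^ 2" by (intro mult_right_mono) auto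
      then show ?thesis using up[of n] by linarith
    qed
    show "g 1 + K + 1 > 0" using K0 g0(2)[of 1] by linarith
  qed (use k0 lower in auto)
qed

context rational_curve
begin

text \<open>The value 0 at infinity is the logarithmic height of infinity on the projective x-line,
  and it supplies the starting value g 0 = 0 in \<open>quasi_quadratic_growth\<close>.\<close>

fun log_height :: "rat point \<Rightarrow> real" where
  "log_height Infty = 0"
| "log_height (Aff x y) = ln (real_of_int (rat_height x))"

lemma log_height_nonneg [simp]: "log_height P \<ge> 0"
  using rat_height_ge_1 by (cases P) auto

lemma log_height_neg [simp]: "log_height (neg P) = log_height P"
  by (cases P) auto

text \<open>The lower bound is stated away from points of order two, whose double is at infinity
  with height 0. Multiples of a point of infinite order never meet this exception.\<close>

lemma log_height_double:
  obtains C where "C \<ge> 0" "\<And>P. on P \<Longrightarrow> log_height (add P P) \<le> 4 * log_height P + C"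
    "\<And>P. on P \<Longrightarrow> P = Infty \<or> add P P \<noteq> Infty \<Longrightarrow> log_height (add P P) \<ge> 4 * log_height P - C"
proof -
  obtain D c :: real where Dc: "D > 0" "c > 0" "\<And>x y x' y'. on (Aff x y) \<Longrightarrow> add (Aff x y) (Aff x y) = Aff x' y' \<Longrightarrow>
       c * (rat_height x)^4 \<le> rat_height x' \<and> rat_height x' \<le> D * (rat_height x)^4"
    using height_double by metis
  define C where "C = \<bar>ln D\<bar> + \<bar>ln c\<bar>"
  have key: "log_height (add P P) \<le> 4 * log_height P + C \<and> log_height (add P P) \<ge> 4 * log_height P - C"
    if on: "on P" and "P = Aff x y" "add P P = Aff x' y'" for P x y x' y'
  proof -
    have h: "c * (rat_height x)^4 \<le> rat_height x'" "rat_height x' \<le> D * (rat_height x)^4"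
      using Dc(3)[of x y x' y'] that by auto
    have pos: "real_of_int (rat_height x) > 0" "real_of_int (rat_height x') > 0"
      using rat_height_ge_1[of x] rat_height_ge_1[of x'] by auto
    have "ln (c * (rat_height x)^4) \<le> ln (rat_height x')"
      using h(1) pos Dc by (subst ln_le_cancel_iff) auto
    moreover have "ln (rat_height x') \<le> ln (D * (rat_height x)^4)"
      using h(2) pos Dc by (subst ln_le_cancel_iff) auto
    moreover have "ln (c * (rat_height x)^4) = ln c + 4 * ln (rat_height x)" 
      "ln (D * (rat_height x)^4) = ln D + 4 * ln (rat_height x)"
      using pos Dc by (simp_all add: ln_mult ln_realpow)
    moreover have "log_height P = ln (rat_height x)" "log_height (add P P) = ln (rat_height x')"
      using that(2,3) by simp_all
    ultimately show ?thesis unfolding C_def by linarith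
  qed
  have C0: "C \<ge> 0" by (simp add: C_def)
  show thesis
  proof (rule that[OF C0])
    fix P assume on: "on P"
    show "log_height (add P P) \<le> 4 * log_height P + C"
    proof (cases "add P P")
      case Infty
      then show ?thesis using C0 by simp
    next
      case (Aff x' y')
      then obtain x y where "P = Aff x y" by (cases P) auto
      then show ?thesis using key[OF on _ Aff] by blast
    qed
    assume P: "P = Infty \<or> add P P \<noteq> Infty"
    show "log_height (add P P) \<ge> 4 * log_height P - C"
    proof (cases P)
      case Infty
      then show ?thesis using C0 by simp
    next
      case (Aff x y)
      then obtain x' y' where "add P P = Aff x' y'" using P by (cases "add P P") auto
      then show ?thesis using key[OF on Aff] by blast
    qed
  qed
qed

text \<open>For equal abscissae R is P or -P, so one of P + R and P - R is infinity and the other a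
  double; there \<open>log_height_double\<close> takes the place of the secant estimate.\<close>

lemma log_height_parallelogram:
  obtains C where "\<And>P R. on P \<Longrightarrow> on R \<Longrightarrow>
    log_height (add P R) + log_height (add P (neg R)) \<le> 2 * log_height P + 2 * log_height R + C"
proof -
  obtain C1 where C1: "C1 \<ge> 0" "\<And>P. on P \<Longrightarrow> log_height (add P P) \<le> 4 * log_height P + C1"
    using log_height_double by metis
  define K where "K = 4 + 4 * \<bar>a4\<bar> + 8 * \<bar>a6\<bar> + (1 + \<bar>a4\<bar>)^2"
  have K: "K > 0" unfolding K_def by (intro add_pos_nonneg) auto
  define C where "C = C1 + \<bar>ln (2 * real_of_int K)\<bar>"
  have C: "C1 \<le> C" "0 \<le> C" "ln (2 * real_of_int K) \<le> C" using C1 by (auto simp: C_def)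
  have "log_height (add P R) + log_height (add P (neg R)) \<le> 2 * log_height P + 2 * log_height R + C"
    if on: "on P" "on R" for P R
  proof (cases "P = Infty \<or> R = Infty")
    case True
    then show ?thesis using C by auto
  next
    case False
    then obtain x1 y1 x2 y2 where P: "P = Aff x1 y1" and R: "R = Aff x2 y2"
      by (cases P; cases R) auto
    show ?thesis
    proof (cases "x1 = x2")
      case True
      then have "R = P \<or> R = neg P" using on_x_eq on P R by fastforce
      then show ?thesis using C1(2)[OF on(1)] C by auto
    next
      case False
      obtain x3 y3 where 3: "add (Aff x1 y1) (Aff x2 y2) = Aff x3 y3" using False by (auto simp: Let_def)
      obtain x4 y4 where 4: "add (Aff x1 y1) (neg (Aff x2 y2)) = Aff x4 y4" using False by (auto simp: Let_def)
      have "rat_height x3 * rat_height x4 \<le> 2 * (K * (rat_height x1 * rat_height x2)^2)"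
        unfolding K_def using height_secant[OF _ _ False 3 4] on P R by simp
      then have "real_of_int (rat_height x3 * rat_height x4) \<le> real_of_int (2 * (K * (rat_height x1 * rat_height x2)^2))"
        by (simp only: of_int_le_iff)
      then have le: "real_of_int (rat_height x3) * real_of_int (rat_height x4) \<le>
         (2 * real_of_int K) * (real_of_int (rat_height x1)^2 * real_of_int (rat_height x2)^2)"
        by (simp add: power_mult_distrib)
      have pos: "real_of_int (rat_height x) > 0" for x using rat_height_ge_1[of x] by simp
      have "ln (real_of_int (rat_height x3) * real_of_int (rat_height x4)) \<le>
         ln ((2 * real_of_int K) * (real_of_int (rat_height x1)^2 * real_of_int (rat_height x2)^2))"
      proof (subst ln_le_cancel_iff)
        show "0 < real_of_int (rat_height x3) * real_of_int (rat_height x4)" using pos by simp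
        show "0 < (2 * real_of_int K) * (real_of_int (rat_height x1)^2 * real_of_int (rat_height x2)^2)"
          using pos[of x1] pos[of x2] K by (intro mult_pos_pos) auto
      qed (rule le)
      also have "ln (real_of_int (rat_height x3) * real_of_int (rat_height x4)) =
         ln (rat_height x3) + ln (rat_height x4)"
        using pos by (simp add: ln_mult_pos)
      also have "ln ((2 * real_of_int K) * (real_of_int (rat_height x1)^2 * real_of_int (rat_height x2)^2)) =
         ln (2 * real_of_int K) + (2 * ln (rat_height x1) + 2 * ln (rat_height x2))"
        using pos[of x1] pos[of x2] K by (subst ln_mult_pos; simp add: ln_mult_pos ln_realpow)+
      finally show ?thesis using 3 4 P R C by simp
    qed
  qed
  then show thesis using that by blast
qed

text \<open>Northcott's finiteness: the infinitely many distinct multiples of a point of infinite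
  order cannot have bounded height, which is the unboundedness asked for in
  \<open>quasi_quadratic_growth\<close>.\<close>

lemma finite_log_height: "finite {P. on P \<and> log_height P \<le> K}"
proof (rule finite_subset)
  define X where "X = {x. rat_height x \<le> \<lfloor>exp K\<rfloor>}"
  show "{P. on P \<and> log_height P \<le> K} \<subseteq>
    insert Infty (\<Union>x\<in>X. Aff x ` {y. y^2 = x^3 + of_int a4 * x + of_int a6})"
  proof
    fix P assume P: "P \<in> {P. on P \<and> log_height P \<le> K}"
    show "P \<in> insert Infty (\<Union>x\<in>X. Aff x ` {y. y^2 = x^3 + of_int a4 * x + of_int a6})"
    proof (cases P)
      case (Aff x y)
      then have "ln (rat_height x) \<le> K" using P by simp
      then have "exp (ln (rat_height x)) \<le> exp K" by simp
      then have "real_of_int (rat_height x) \<le> exp K"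
        using rat_height_ge_1[of x] by (subst (asm) exp_ln) auto
      then have "x \<in> X" by (simp add: X_def le_floor_iff)
      then show ?thesis using P Aff by auto
    qed simp
  qed
  have "finite {y::rat. y^2 = c}" for c
  proof (cases "\<exists>z. c = z^2")
    case True
    then obtain z where "c = z^2" by blast
    then have "{y. y^2 = c} = {z, - z}" by (auto simp: power2_eq_iff)
    then show ?thesis by simp
  next
    case False
    then have "{y. y^2 = c} = {}" by auto
    then show ?thesis by simp
  qed
  then show "finite (insert Infty (\<Union>x\<in>X. Aff x ` {y. y^2 = x^3 + of_int a4 * x + of_int a6}))"
    unfolding X_def using finite_rat_height by auto
qed

lemma log_height_mul_quadratic:
  assumes on: "on P" and ord: "\<And>n. n \<ge> 1 \<Longrightarrow> mul n P \<noteq> Infty"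
  obtains c c' d :: real where "c > 0" "c' > 0" "\<And>n. c * real n ^ 2 - d \<le> log_height (mul n P)"
    "\<And>n. log_height (mul n P) \<le> c' * real n ^ 2"
proof -
  obtain C1 where C1: "C1 \<ge> 0"
    "\<And>P. on P \<Longrightarrow> P = Infty \<or> add P P \<noteq> Infty \<Longrightarrow> log_height (add P P) \<ge> 4 * log_height P - C1"
    using log_height_double by metis
  obtain C2 where C2: "\<And>P R. on P \<Longrightarrow> on R \<Longrightarrow>
    log_height (add P R) + log_height (add P (neg R)) \<le> 2 * log_height P + 2 * log_height R + C2"
    using log_height_parallelogram by metis
  define C where "C = max C1 C2"
  show thesis
  proof (rule quasi_quadratic_growth[of "\<lambda>n. log_height (mul n P)" C])
    show "log_height (mul (m + n) P) + log_height (mul (m - n) P)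
      \<le> 2 * log_height (mul m P) + 2 * log_height (mul n P) + C" if "n \<le> m" for m n
      using C2[of "mul m P" "mul n P"] mul_add[OF on, of m n] mul_diff[OF on that] on by (simp add: C_def)
    show "4 * log_height (mul n P) - C \<le> log_height (mul (2 * n) P)" for n
    proof -
      have "mul (2 * n) P = add (mul n P) (mul n P)" using mul_add[OF on, of n n] by (simp add: mult_2)
      moreover have "mul n P = Infty \<or> mul (2 * n) P \<noteq> Infty" using ord[of "2 * n"] by (cases n) auto
      ultimately show ?thesis using C1(2)[of "mul n P"] on by (simp add: C_def)
    qed
    show "\<exists>n. K < log_height (mul n P)" for K
    proof (rule ccontr)
      assume "\<nexists>n. K < log_height (mul n P)"
      then have "range (\<lambda>n. mul n P) \<subseteq> {P. on P \<and> log_height P \<le> K}" using on by (auto simp: not_less)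
      then have "finite (range (\<lambda>n. mul n P))" using finite_log_height finite_subset by blast
      then show False using finite_imageD[OF _ mul_inj[OF on ord]] by auto
    qed
    fix c c' d :: real
    assume "c > 0" "c' > 0" "\<And>n. c * real n ^ 2 - d \<le> log_height (mul n P)"
      "\<And>n. log_height (mul n P) \<le> c' * real n ^ 2"
    then show thesis by (rule that)
  qed auto
qed

end

section \<open>Reduction modulo primes\<close>

context weierstrass
begin

section \<open>The group of points and its order\<close>

definition point_group :: "'a point monoid" where
  "point_group = \<lparr>carrier = {P. on P}, monoid.mult = add, one = Infty\<rparr>"

lemma group_point_group: "Group.group point_group"
proof (rule groupI)
  fix P assume "P \<in> carrier point_group"
  then show "\<exists>R\<in>carrier point_group. R \<otimes>\<^bsub>point_group\<^esub> P = \<one>\<^bsub>point_group\<^esub>"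
    by (auto simp: point_group_def intro!: exI[of _ "neg P"])
qed (auto simp: point_group_def add_assoc)

lemma pow_point_group: "on P \<Longrightarrow> P [^]\<^bsub>point_group\<^esub> n = mul n P"
proof (induction n)
  case 0
  then show ?case using group_point_group by (simp add: Group.group.is_monoid monoid.nat_pow_0) (simp add: point_group_def)
next
  case (Suc n)
  then have "P [^]\<^bsub>point_group\<^esub> Suc n = add (mul n P) P"
    using group_point_group by (simp add: Group.group.is_monoid monoid.nat_pow_Suc) (simp add: point_group_def)
  then show ?case using Suc.prems add_commute by simp
qed

text \<open>Lagrange's theorem; the minimality of m identifies it with the order in
  \<open>point_group\<close>.\<close>

lemma order_dvd_card_points:
  assumes fin: "finite {P. on P}" and on: "on P" and m: "m \<ge> 1" "mul m P = Infty"
    and min: "\<And>k. 1 \<le> k \<Longrightarrow> k < m \<Longrightarrow> mul k P \<noteq> Infty"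
  shows "m dvd card {P. on P}"
proof -
  interpret G: Group.group point_group by (rule group_point_group)
  have P: "P \<in> carrier point_group" using on by (simp add: point_group_def)
  have one: "\<one>\<^bsub>point_group\<^esub> = Infty" by (simp add: point_group_def)
  have dv: "mul n P = Infty \<longleftrightarrow> G.ord P dvd n" for n
    using G.pow_eq_id[OF P, of n] unfolding pow_point_group[OF on] one .
  have "G.ord P dvd m" using dv m by simp
  then have le: "G.ord P \<le> m" and pos: "1 \<le> G.ord P"
    using m(1) by (auto intro: dvd_imp_le)
  moreover have "mul (G.ord P) P = Infty" using dv by simp
  ultimately have "\<not> G.ord P < m" using min by blast
  then have "G.ord P = m" using le by simp
  moreover have "G.ord P dvd card {P. on P}"
    using G.ord_dvd_group_order[OF P] by (simp add: Coset.order_def point_group_def)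
  ultimately show ?thesis by simp
qed

end

lemma card_points_weierstrass:
  fixes A B :: "'a::{field,finite}"
  assumes "weierstrass A B"
  shows "finite {P. weierstrass.on A B P}"
    "card {P. weierstrass.on A B P} = card {(x, y). y^2 = x^3 + A * x + B} + 1"
proof -
  interpret weierstrass A B by fact
  have eq: "{P. on P} = insert Infty ((\<lambda>(x, y). Aff x y) ` {(x, y). y^2 = x^3 + A * x + B})" (is "_ = insert _ ?S")
  proof (intro equalityI subsetI)
    fix P assume "P \<in> {P. on P}"
    then show "P \<in> insert Infty ?S" by (cases P) auto
  qed auto
  then show "finite {P. on P}" by simp
  have "card ?S = card {(x, y). y^2 = x^3 + A * x + B}"
    by (rule card_image) (auto simp: inj_on_def)
  moreover have "Infty \<notin> ?S" by auto
  ultimately show "card {P. on P} = card {(x, y). y^2 = x^3 + A * x + B} + 1"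
    unfolding eq by simp
qed

text \<open>For reduced fractions x = r/s and y = u/v, clearing denominators gives u^2 s^3 = v^2
  (r^3 + A r s^2 + B s^3), where u is prime to v and the bracket is prime to s. Hence s^3 = v^2, so
  s divides v, and v = s d yields s = d^2 and v = d^3.\<close>

lemma rational_point_normal_form:
  fixes A B :: int and x y :: rat
  assumes on: "y^2 = x^3 + of_int A * x + of_int B"
  obtains a b :: int and d :: nat where "d \<ge> 1" "x = of_int a / of_nat d ^ 2" "y = of_int b / of_nat d ^ 3"
    "coprime a (int d)" "coprime b (int d)"
proof -
  obtain r s where x: "x = of_int r / of_int s" "s > 0" "coprime r s" by (rule rat_coprime_cases)
  obtain u v where y: "y = of_int u / of_int v" "v > 0" "coprime u v" by (rule rat_coprime_cases)
  have "rat_of_int (u^2 * s^3) = of_int (v^2 * (r^3 + A * r * s^2 + B * s^3))"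
  proof -
    have "rat_of_int v \<noteq> 0" "rat_of_int s \<noteq> 0" using x y by auto
    then have e: "of_int u = y * of_int v" "of_int r = x * of_int s" using x y by simp_all
    have "rat_of_int (u^2 * s^3) = y^2 * of_int v^2 * of_int s^3" by (simp add: e power_mult_distrib)
    also have "\<dots> = of_int (v^2 * (r^3 + A * r * s^2 + B * s^3))"
      unfolding on by (simp add: e power_mult_distrib power2_eq_square power3_eq_cube algebra_simps)
    finally show ?thesis .
  qed
  then have eq: "u^2 * s^3 = v^2 * (r^3 + A * r * s^2 + B * s^3)" by (simp only: of_int_eq_iff)
  have "coprime (v^2) (u^2)" using y(3) by (simp add: coprime_commute)
  moreover have "v^2 dvd u^2 * s^3" unfolding eq by simp
  ultimately have 1: "v^2 dvd s^3" by (simp add: coprime_dvd_mult_right_iff)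
  have "coprime (s^3) (r^3 + A * r * s^2 + B * s^3)"
  proof -
    have "gcd s ((A * r * s + B * s^2) * s + r^3) = gcd s (r^3)" by (rule gcd_add_mult)
    moreover have "coprime s (r^3)" using x(3) by (simp add: coprime_commute)
    ultimately have "coprime s ((A * r * s + B * s^2) * s + r^3)" by (simp only: coprime_iff_gcd_eq_1)
    moreover have "(A * r * s + B * s^2) * s + r^3 = r^3 + A * r * s^2 + B * s^3"
      by (simp add: power2_eq_square power3_eq_cube algebra_simps)
    ultimately show ?thesis by simp
  qed
  moreover have "s^3 dvd v^2 * (r^3 + A * r * s^2 + B * s^3)" unfolding eq[symmetric] by simp
  ultimately have 2: "s^3 dvd v^2" by (simp add: coprime_dvd_mult_left_iff)
  have sv: "s^3 = v^2" using 1 2 x(2) y(2) by (intro zdvd_antisym_nonneg) auto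
  have "s^2 dvd v^2" unfolding sv[symmetric] by (rule le_imp_power_dvd) simp
  then have "s dvd v" by simp
  then obtain d where d: "v = s * d" by blast
  have d0: "d > 0" using d x y by (simp add: zero_less_mult_iff)
  have "s^2 * s = s^2 * d^2" using sv d by (simp add: power_mult_distrib power2_eq_square power3_eq_cube)
  then have s: "s = d^2" using x(2) by simp
  then have v: "v = d^3" using d by (simp add: power2_eq_square power3_eq_cube)
  show thesis
  proof (rule that[of "nat d" r u])
    show "x = of_int r / of_nat (nat d) ^ 2" "y = of_int u / of_nat (nat d) ^ 3"
      using x(1) y(1) s v d0 by simp_all
    show "coprime r (int (nat d))" "coprime u (int (nat d))"
      using x(3) y(3) s v d0 by simp_all
  qed (use d0 in simp)
qed

lemma quotient_of_normal_form:
  assumes "d \<ge> 1" "coprime a (int d)"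
  shows "quotient_of (of_int a / of_nat d ^ 2) = (a, int d ^ 2)"
proof -
  have "quotient_of (of_int a / of_int (int d ^ 2)) = Rat.normalize (a, int d ^ 2)"
    by (metis Fract_of_int_quotient quotient_of_Fract)
  also have "\<dots> = (a, int d ^ 2)" using assms by (intro normalize_stable) auto
  finally show ?thesis by simp
qed

text \<open>The \<open>itself\<close> parameter only fixes the field of characteristic \<open>p\<close> as a type.\<close>

locale residue_map =
  fixes p :: nat and F :: "'f::field itself"
  assumes p: "prime p" and of_int_0: "\<And>k. (of_int k :: 'f) = 0 \<longleftrightarrow> int p dvd k"
begin

section \<open>Reduction of p-integral rationals\<close>

definition pint :: "rat \<Rightarrow> bool" where
  "pint x \<longleftrightarrow> \<not> int p dvd snd (quotient_of x)"

text \<open>Meaningful on p-integral rationals; elsewhere the denominator maps to 0, and division by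
  zero makes the value 0.\<close>

definition red :: "rat \<Rightarrow> 'f" where
  "red x = of_int (fst (quotient_of x)) / of_int (snd (quotient_of x))"

lemma pp: "prime (int p)" using p by simp

lemma red_frac:
  assumes "\<not> int p dvd b"
  shows "pint (of_int a / of_int b)" "red (of_int a / of_int b) = of_int a / of_int b"
proof -
  obtain u v where uv: "quotient_of (of_int a / of_int b) = (u, v)" by fastforce
  have e: "rat_of_int a / of_int b = of_int u / of_int v" and v: "v > 0" and c: "coprime u v"
    using quotient_of_div[OF uv] quotient_of_denom_pos[OF uv] quotient_of_coprime[OF uv] by auto
  have b: "b \<noteq> 0" using assms by auto
  have "rat_of_int (a * v) = of_int (u * b)" using e b v by (simp add: field_simps)
  then have av: "a * v = u * b" by (simp only: of_int_eq_iff)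
  have pv: "\<not> int p dvd v"
  proof
    assume d: "int p dvd v"
    then have "int p dvd u * b" using av by (metis dvd_mult)
    then have "int p dvd u" using assms pp by (simp add: prime_dvd_mult_iff)
    then show False using d c pp by (meson coprime_common_divisor not_prime_unit)
  qed
  then show "pint (of_int a / of_int b)" by (simp add: pint_def uv)
  have "(of_int a :: 'f) * of_int v = of_int u * of_int b"
    by (simp only: of_int_mult[symmetric] av)
  moreover have "(of_int v :: 'f) \<noteq> 0" "(of_int b :: 'f) \<noteq> 0" using pv assms of_int_0 by auto
  ultimately show "red (of_int a / of_int b) = of_int a / of_int b"
    by (simp add: red_def uv frac_eq_eq)
qed

lemma pintE:
  assumes "pint x"
  obtains a b where "x = of_int a / of_int b" "\<not> int p dvd b" "b \<noteq> 0" "(of_int b :: 'f) \<noteq> 0" "red x = of_int a / of_int b"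
proof -
  obtain u v where uv: "quotient_of x = (u, v)" by fastforce
  then have v: "\<not> int p dvd v" and x: "x = of_int u / of_int v"
    using assms quotient_of_div by (auto simp: pint_def)
  show thesis
  proof (rule that[OF x v])
    show "v \<noteq> 0" "(of_int v :: 'f) \<noteq> 0" using v of_int_0 by auto
    show "red x = of_int u / of_int v" unfolding x by (rule red_frac(2)[OF v])
  qed
qed

lemma pint_of_int [simp]: "pint (of_int k)" and red_of_int [simp]: "red (of_int k) = of_int k"
  using red_frac[of 1 k] pp not_prime_unit by auto

lemma pint_numeral [simp]: "pint (numeral k)" and red_numeral [simp]: "red (numeral k) = numeral k"
  using pint_of_int[of "numeral k"] red_of_int[of "numeral k"] by simp_all

lemma pint_0 [simp]: "pint 0" and red_0 [simp]: "red 0 = 0"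
  using pint_of_int[of 0] red_of_int[of 0] by simp_all

lemma pint_add [simp]: "pint x \<Longrightarrow> pint y \<Longrightarrow> pint (x + y)"
  and red_add [simp]: "pint x \<Longrightarrow> pint y \<Longrightarrow> red (x + y) = red x + red y"
proof -
  assume "pint x" "pint y"
  obtain a b where x: "x = of_int a / of_int b" "\<not> int p dvd b" "b \<noteq> 0" "(of_int b :: 'f) \<noteq> 0" "red x = of_int a / of_int b"
    using pintE[OF \<open>pint x\<close>] .
  obtain c d where y: "y = of_int c / of_int d" "\<not> int p dvd d" "d \<noteq> 0" "(of_int d :: 'f) \<noteq> 0" "red y = of_int c / of_int d"
    using pintE[OF \<open>pint y\<close>] .
  have "x + y = of_int (a * d + c * b) / of_int (b * d)" using x y by (simp add: add_frac_eq)
  moreover have "\<not> int p dvd b * d" using x y pp by (simp add: prime_dvd_mult_iff)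
  ultimately show "pint (x + y)" "red (x + y) = red x + red y"
    using red_frac[of "b * d" "a * d + c * b"] x y by (simp_all add: add_frac_eq)
qed

lemma pint_mult [simp]: "pint x \<Longrightarrow> pint y \<Longrightarrow> pint (x * y)"
  and red_mult [simp]: "pint x \<Longrightarrow> pint y \<Longrightarrow> red (x * y) = red x * red y"
proof -
  assume "pint x" "pint y"
  obtain a b where x: "x = of_int a / of_int b" "\<not> int p dvd b" "b \<noteq> 0" "(of_int b :: 'f) \<noteq> 0" "red x = of_int a / of_int b"
    using pintE[OF \<open>pint x\<close>] .
  obtain c d where y: "y = of_int c / of_int d" "\<not> int p dvd d" "d \<noteq> 0" "(of_int d :: 'f) \<noteq> 0" "red y = of_int c / of_int d"
    using pintE[OF \<open>pint y\<close>] .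
  have "x * y = of_int (a * c) / of_int (b * d)" using x y by simp
  moreover have "\<not> int p dvd b * d" using x y pp by (simp add: prime_dvd_mult_iff)
  ultimately show "pint (x * y)" "red (x * y) = red x * red y"
    using red_frac[of "b * d" "a * c"] x y by simp_all
qed

lemma pint_minus [simp]: "pint x \<Longrightarrow> pint (- x)" and red_minus [simp]: "pint x \<Longrightarrow> red (- x) = - red x"
  using pint_mult[of "of_int (- 1)" x] red_mult[of "of_int (- 1)" x] pint_of_int[of "- 1"] red_of_int[of "- 1"]
  by simp_all

lemma pint_diff [simp]: "pint x \<Longrightarrow> pint y \<Longrightarrow> pint (x - y)"
  and red_diff [simp]: "pint x \<Longrightarrow> pint y \<Longrightarrow> red (x - y) = red x - red y"
  using pint_add[of x "- y"] red_add[of x "- y"] by simp_all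

lemma pint_power [simp]: "pint x \<Longrightarrow> pint (x ^ n)" and red_power [simp]: "pint x \<Longrightarrow> red (x ^ n) = red x ^ n"
proof -
  assume x: "pint x"
  have "pint (x ^ n) \<and> red (x ^ n) = red x ^ n"
    by (induction n) (use x pint_of_int[of 1] red_of_int[of 1] in auto)
  then show "pint (x ^ n)" "red (x ^ n) = red x ^ n" by auto
qed

lemma pint_divide:
  assumes "pint x" "pint y" "red y \<noteq> 0"
  shows "pint (x / y)" "red (x / y) = red x / red y"
proof -
  obtain c d where y: "y = of_int c / of_int d" "\<not> int p dvd d" "d \<noteq> 0" "(of_int d :: 'f) \<noteq> 0" "red y = of_int c / of_int d"
    using pintE[OF assms(2)] .
  have c: "\<not> int p dvd c" using assms(3) y of_int_0 by auto
  have 1: "pint (of_int d / of_int c)" "red (of_int d / of_int c) = of_int d / of_int c"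
    using red_frac[OF c] by auto
  have e: "x / y = x * (of_int d / of_int c)" using y by simp
  show "pint (x / y)" unfolding e by (rule pint_mult[OF assms(1) 1(1)])
  show "red (x / y) = red x / red y" unfolding e red_mult[OF assms(1) 1(1)] 1(2) y(5) by simp
qed

lemma not_pint_divide:
  assumes "pint x" "pint y" "red x \<noteq> 0" "red y = 0" "y \<noteq> 0"
  shows "\<not> pint (x / y)"
proof
  assume "pint (x / y)"
  then have "red (x / y * y) = red (x / y) * red y" using assms(2) by (rule red_mult)
  moreover have "x / y * y = x" using assms(5) by simp
  ultimately show False using assms(3,4) by simp
qed

lemma pint_square: "pint (x^2) \<Longrightarrow> pint x"
proof -
  assume "pint (x^2)"
  obtain u v where uv: "quotient_of x = (u, v)" by fastforce
  have x: "x = of_int u / of_int v" and v: "v > 0" and c: "coprime u v"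
    using quotient_of_div[OF uv] quotient_of_denom_pos[OF uv] quotient_of_coprime[OF uv] by auto
  show "pint x"
  proof (rule ccontr)
    assume "\<not> pint x"
    then have pv: "int p dvd v" by (simp add: pint_def uv)
    then have pu: "\<not> int p dvd u" using c pp by (meson coprime_common_divisor not_prime_unit)
    have "\<not> pint (of_int (u^2) / of_int (v^2))"
      using pv pu pp v of_int_0 by (intro not_pint_divide) (auto simp: prime_dvd_power_iff simp del: of_int_power)
    then show False using \<open>pint (x^2)\<close> x by (simp add: power_divide)
  qed
qed

lemma pint_y:
  assumes "y^2 = x^3 + of_int a * x + of_int b" "pint x"
  shows "pint y"
proof (rule pint_square)
  show "pint (y^2)" unfolding assms(1) using assms(2) by simp
qed

end

section \<open>Reduction of the curve and the rank of apparition\<close>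

locale good_reduction = rational_curve a4 a6 + residue_map p F
  for a4 a6 :: int and p :: nat and F :: "'f::field itself" +
  assumes good: "\<not> int p dvd 2 * (4 * a4^3 + 27 * a6^2)"

sublocale good_reduction \<subseteq> rc: weierstrass "of_int a4 :: 'f" "of_int a6 :: 'f"
proof
  have "\<not> int p dvd 2" "\<not> int p dvd 4 * a4^3 + 27 * a6^2" 
    using good dvd_mult2[of "int p" 2 "4 * a4^3 + 27 * a6^2"] dvd_mult[of "int p" "4 * a4^3 + 27 * a6^2" 2] by blast+
  then have "(of_int 2 :: 'f) \<noteq> 0" "(of_int (4 * a4^3 + 27 * a6^2) :: 'f) \<noteq> 0" unfolding of_int_0 by auto
  then show "(2 :: 'f) \<noteq> 0" "4 * of_int a4 ^ 3 + 27 * of_int a6 ^ 2 \<noteq> (0 :: 'f)" by simp_all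
qed

context good_reduction
begin

fun integral_point :: "rat point \<Rightarrow> bool" where
  "integral_point Infty = False"
| "integral_point (Aff x y) = pint x"

fun red_point :: "rat point \<Rightarrow> 'f point" where
  "red_point Infty = Infty"
| "red_point (Aff x y) = (if pint x then Aff (red x) (red y) else Infty)"

lemma on_red:
  assumes "on (Aff x y)" "pint x"
  shows "pint y" "rc.on (Aff (red x) (red y))"
proof -
  have e: "y^2 = x^3 + of_int a4 * x + of_int a6" using assms by simp
  show y: "pint y" using pint_y[OF e assms(2)] .
  have "red (y^2) = red (x^3 + of_int a4 * x + of_int a6)" by (simp only: e)
  then show "rc.on (Aff (red x) (red y))" using y assms(2) by simp
qed

lemma red_point_eq_Infty: "red_point P = Infty \<longleftrightarrow> \<not> integral_point P"
  by (cases P) auto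

text \<open>It gives the chord slope (y2 - y1) / (x2 - x1) a second expression with denominator y1 +
  y2, which stays usable when the abscissae agree modulo p and becomes the tangent slope when the
  points coincide.\<close>

lemma slope_identity:
  fixes x1 y1 x2 y2 A B :: rat
  assumes "y1^2 = x1^3 + A * x1 + B" "y2^2 = x2^3 + A * x2 + B"
  shows "(y2 - y1) * (y1 + y2) = (x2 - x1) * (x1^2 + x1 * x2 + x2^2 + A)"
proof -
  have "(y2 - y1) * (y1 + y2) = y2^2 - y1^2" by Groebner_Basis.algebra
  also have "\<dots> = (x2 - x1) * (x1^2 + x1 * x2 + x2^2 + A)" unfolding assms by Groebner_Basis.algebra
  finally show ?thesis .
qed

text \<open>If the reduced points are not opposite, one of the two slope expressions has a
  denominator that is nonzero modulo p, and it reduces to the slope in \<open>rc.add\<close>. If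
  they are opposite, either the points themselves are opposite or the slope is not p-integral; in
  the latter case the abscissa of the sum is not p-integral either. Both sides are then
  \<open>Infty\<close>.\<close>

lemma red_point_add_integral:
  assumes on: "on (Aff x1 y1)" "on (Aff x2 y2)" and int: "pint x1" "pint x2"
  shows "red_point (add (Aff x1 y1) (Aff x2 y2)) = rc.add (red_point (Aff x1 y1)) (red_point (Aff x2 y2))"
proof -
  note y = on_red[OF on(1) int(1)] on_red[OF on(2) int(2)]
  define l where "l = (if x1 = x2 then (3 * x1^2 + of_int a4) / (2 * y1) else (y2 - y1) / (x2 - x1))"
  define x3 where "x3 = l^2 - x1 - x2"
  have add: "add (Aff x1 y1) (Aff x2 y2) = (if x1 = x2 \<and> y1 = - y2 then Infty else Aff x3 (l * (x1 - x3) - y1))"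
    by (simp add: l_def x3_def Let_def)
  have e: "y1^2 = x1^3 + of_int a4 * x1 + of_int a6" "y2^2 = x2^3 + of_int a4 * x2 + of_int a6"
    using on by auto
  note sl = slope_identity[OF e]
  have pts: "rc.add (red_point (Aff x1 y1)) (red_point (Aff x2 y2)) = rc.add (Aff (red x1) (red y1)) (Aff (red x2) (red y2))"
    using int by simp
  have two: "(2::'f) \<noteq> 0" by (rule rc.two_neq_0)
  have finish: ?thesis if l: "pint l" "red l = (if red x1 = red x2 then (3 * (red x1)^2 + of_int a4) / (2 * red y1)
      else (red y2 - red y1) / (red x2 - red x1))" and n: "\<not> (red x1 = red x2 \<and> red y1 = - red y2)"
  proof -
    have n': "\<not> (x1 = x2 \<and> y1 = - y2)" using n y by auto
    have x3: "pint x3" "red x3 = (red l)^2 - red x1 - red x2" using l(1) int by (simp_all add: x3_def)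
    have "red_point (add (Aff x1 y1) (Aff x2 y2)) = Aff (red x3) (red l * (red x1 - red x3) - red y1)"
      unfolding add using n' x3(1) l(1) int y by simp
    also have "\<dots> = rc.add (Aff (red x1) (red y1)) (Aff (red x2) (red y2))"
      using n unfolding rc.add.simps x3(2) l(2) Let_def by simp
    finally show ?thesis unfolding pts .
  qed
  show ?thesis
  proof (cases "red x1 = red x2")
    case False
    then have ne: "x1 \<noteq> x2" by auto
    have "pint l" "red l = (red y2 - red y1) / (red x2 - red x1)"
      using ne False pint_divide[of "y2 - y1" "x2 - x1"] int y by (simp_all add: l_def)
    then show ?thesis using finish False by simp
  next
    case X: True
    define s where "s = x1^2 + x1 * x2 + x2^2 + of_int a4"
    have s: "pint s" "red s = 3 * (red x1)^2 + of_int a4"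
      using int X by (simp_all add: s_def power2_eq_square algebra_simps)
    show ?thesis
    proof (cases "red y1 = - red y2")
      case False
      then have Y: "red y1 = red y2" using rc.on_x_eq y X by metis
      have "red y1 \<noteq> 0" using False Y by auto
      then have Y2: "2 * red y1 \<noteq> 0" using two by simp
      have sum: "red (y1 + y2) = 2 * red y1" using y Y by simp
      then have sum0: "y1 + y2 \<noteq> 0" using Y2 by auto
      have "l = s / (y1 + y2)"
      proof (cases "x1 = x2")
        case True
        then have "y1 = y2" using on_x_eq on sum0 by fastforce
        then show ?thesis using True by (simp add: l_def s_def power2_eq_square algebra_simps)
      next
        case False
        then show ?thesis using sl sum0 by (simp add: l_def s_def frac_eq_eq mult.commute)
      qed
      then have "pint l" "red l = (3 * (red x1)^2 + of_int a4) / (2 * red y1)"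
        using pint_divide[OF s(1), of "y1 + y2"] y sum Y2 s(2) by simp_all
      then show ?thesis using finish X False by simp
    next
      case Y: True
      have R: "rc.add (red_point (Aff x1 y1)) (red_point (Aff x2 y2)) = Infty" unfolding pts using X Y by simp
      show ?thesis
      proof (cases "x1 = x2 \<and> y1 = - y2")
        case True
        then show ?thesis unfolding add R by simp
      next
        case False
        have nl: "\<not> pint l"
        proof (cases "x1 \<noteq> x2 \<and> red y1 \<noteq> 0")
          case True
          have "red (y2 - y1) = - (2 * red y1)" using Y y by simp
          then have "red (y2 - y1) \<noteq> 0" using two True by simp
          then show ?thesis using not_pint_divide[of "y2 - y1" "x2 - x1"] True X y int by (simp add: l_def)
        next
          case F2: False
          have Y0: "red y1 = 0"
          proof (cases "x1 = x2")
            case True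
            then have "y1 = y2" using on_x_eq on False by fastforce
            then have "2 * red y1 = 0" using Y by (metis add.right_inverse mult_2)
            then show ?thesis using two by simp
          qed (use F2 in auto)
          \<comment> \<open>A point with y = 0 on the nonsingular reduced curve has 3 x^2 + A
            \<noteq> 0, so in the second slope expression the numerator survives reduction while y1
            + y2 vanishes.\<close>
          have s0: "red s \<noteq> 0" unfolding s(2) using rc.nonsingular[of "red x1"] y(2) Y0 by simp
          then have s1: "s \<noteq> 0" by auto
          have sum: "pint (y1 + y2)" "red (y1 + y2) = 0" using y Y by auto
          have sum0: "y1 + y2 \<noteq> 0"
          proof
            assume z: "y1 + y2 = 0"
            then have "x1 = x2" using sl s1 by (auto simp: s_def)
            then show False using False z by (simp add: eq_neg_iff_add_eq_0)
          qed
          have "l = s / (y1 + y2)"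
          proof (cases "x1 = x2")
            case True
            then have "y1 = y2" using on_x_eq on False by fastforce
            then show ?thesis using True by (simp add: l_def s_def power2_eq_square algebra_simps)
          next
            case False
            then show ?thesis using sl sum0 by (simp add: l_def s_def frac_eq_eq mult.commute)
          qed
          then show ?thesis using not_pint_divide[OF s(1) sum(1) s0 sum(2) sum0] by simp
        qed
        have "\<not> pint x3"
        proof
          assume "pint x3"
          then have "pint (x3 + x1 + x2)" using int by simp
          then have "pint (l^2)" by (simp add: x3_def)
          then show False using nl pint_square by blast
        qed
        then show ?thesis unfolding R add using False by simp
      qed
    qed
  qed
qed

text \<open>A point reducing to infinity cannot move an affine reduced point to infinity. Numerator
  and denominator of the secant formula are multiplied by D^4, where the second abscissa is a / D^2:
  the numerator \<open>t\<close> is p-integral, and the denominator \<open>w\<close> reduces to a^2,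
  which is nonzero because a is prime to D.\<close>

lemma integral_add_nonintegral:
  assumes on: "on (Aff x1 y1)" "on (Aff x2 y2)" and 1: "pint x1" and 2: "\<not> pint x2"
  shows "integral_point (add (Aff x1 y1) (Aff x2 y2))"
proof -
  have e: "y1^2 = x1^3 + of_int a4 * x1 + of_int a6" "y2^2 = x2^3 + of_int a4 * x2 + of_int a6"
    using on by auto
  obtain a b d where d: "d \<ge> 1" "x2 = of_int a / of_nat d ^ 2" "y2 = of_int b / of_nat d ^ 3" "coprime a (int d)"
    using rational_point_normal_form[OF e(2)] by metis
  have q: "quotient_of x2 = (a, int d ^ 2)" unfolding d(2) using quotient_of_normal_form[OF d(1,4)] .
  have pd: "int p dvd int d" using 2 pp by (simp add: pint_def q prime_dvd_power_iff)
  then have pa: "\<not> int p dvd a" using d(4) pp by (meson coprime_common_divisor not_prime_unit)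
  have ne: "x1 \<noteq> x2" using 1 2 by auto
  define D where "D = rat_of_int (int d)"
  have "red D = of_int (int d)" "pint D" unfolding D_def by (rule red_of_int pint_of_int)+
  then have D: "D \<noteq> 0" "pint D" "red D = 0" using d(1) pd of_int_0[of "int d"] by (auto simp: D_def)
  have xy: "x2 * D^2 = of_int a" "y2 * D^3 = of_int b" using d D by (simp_all add: D_def)
  define x3 where "x3 = ((y2 - y1) / (x2 - x1))^2 - x1 - x2"
  have add: "\<exists>y3. add (Aff x1 y1) (Aff x2 y2) = Aff x3 y3" using ne by (simp add: x3_def Let_def)
  define t where "t = (x1 * D^2 + of_int a) * (of_int a4 * D^2 + x1 * of_int a) + 2 * of_int a6 * D^4
     - 2 * y1 * of_int b * D"
  define w where "w = (of_int a - x1 * D^2)^2"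
  have "(y2 - y1)^2 - (x1 + x2) * (x2 - x1)^2 = y2^2 + y1^2 - 2 * y1 * y2 - (x1 + x2) * (x2 - x1)^2" by Groebner_Basis.algebra
  also have "\<dots> = (x1 + x2) * (of_int a4 + x1 * x2) + 2 * of_int a6 - 2 * y1 * y2" unfolding e by Groebner_Basis.algebra
  finally have n: "(y2 - y1)^2 - (x1 + x2) * (x2 - x1)^2 = (x1 + x2) * (of_int a4 + x1 * x2) + 2 * of_int a6 - 2 * y1 * y2" .
  have "x3 * (x2 - x1)^2 = (y2 - y1)^2 - (x1 + x2) * (x2 - x1)^2"
    using ne by (simp add: x3_def power_divide left_diff_distrib distrib_right)
  then have "x3 * (x2 - x1)^2 * D^4 = ((x1 + x2) * (of_int a4 + x1 * x2) + 2 * of_int a6 - 2 * y1 * y2) * D^4" using n by simp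
  also have "\<dots> = t" unfolding t_def xy[symmetric] by Groebner_Basis.algebra
  also have "x3 * (x2 - x1)^2 * D^4 = x3 * w" unfolding w_def xy[symmetric] by Groebner_Basis.algebra
  finally have xw: "x3 * w = t" .
  have y1: "pint y1" using on_red[OF on(1) 1] by simp
  have t: "pint t" unfolding t_def using 1 y1 D by simp
  have "of_int a \<noteq> (0::'f)" using pa of_int_0 by simp
  then have w: "pint w" "red w \<noteq> 0" unfolding w_def using 1 D by simp_all
  then have "w \<noteq> 0" by auto
  then have "x3 = t / w" using xw by (simp add: field_simps)
  then have "pint x3" using pint_divide(1)[OF t w] by simp
  then show ?thesis using add by auto
qed

text \<open>Let m be the least positive index with m Q reducing to infinity. If k Q does so for some
  k > m, then (k - m) Q does too, since otherwise k Q would be the sum of an integral and a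
  non-integral point; hence m divides every such k. Below m all positive multiples are integral, so
  reduction is additive up to m, and m is exactly the order of the reduced point.\<close>

lemma rank_of_apparition:
  assumes on: "on Q" and Q: "integral_point Q" and ord: "\<And>n. n \<ge> 1 \<Longrightarrow> mul n Q \<noteq> Infty"
    and fin: "finite (UNIV :: 'f set)" and n: "n \<ge> 1" "\<not> integral_point (mul n Q)"
  shows "\<exists>m\<ge>1. m dvd n \<and> \<not> integral_point (mul m Q) \<and> m dvd card {P. rc.on P}"
proof -
  define m where "m = (LEAST m. m \<ge> 1 \<and> \<not> integral_point (mul m Q))"
  have m: "m \<ge> 1" "\<not> integral_point (mul m Q)"
    using LeastI[of "\<lambda>m. m \<ge> 1 \<and> \<not> integral_point (mul m Q)", OF conjI[OF n]] by (auto simp: m_def)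
  have least: "m \<le> k" if "k \<ge> 1" "\<not> integral_point (mul k Q)" for k
    unfolding m_def using that by (intro Least_le) simp
  have dv: "m dvd k" if "k \<ge> 1" "\<not> integral_point (mul k Q)" for k
    using that
  proof (induction k rule: less_induct)
    case (less k)
    have mk: "m \<le> k" using least less.prems by blast
    show ?case
    proof (cases "m = k")
      case False
      then have km: "k - m \<ge> 1" "k - m < k" using mk m(1) by auto
      have "\<not> integral_point (mul (k - m) Q)"
      proof
        assume i: "integral_point (mul (k - m) Q)"
        obtain x1 y1 where 1: "mul (k - m) Q = Aff x1 y1" using i by (cases "mul (k - m) Q") auto
        obtain x2 y2 where 2: "mul m Q = Aff x2 y2" using ord[OF m(1)] by (cases "mul m Q") auto
        have "mul (k - m + m) Q = add (Aff x1 y1) (Aff x2 y2)"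
          unfolding mul_add[OF on] 1 2 ..
        then have "mul k Q = add (Aff x1 y1) (Aff x2 y2)" using mk by simp
        moreover have "integral_point (add (Aff x1 y1) (Aff x2 y2))"
        proof (rule integral_add_nonintegral)
          show "on (Aff x1 y1)" "on (Aff x2 y2)" using on_mul[OF on] 1 2 by metis+
          show "pint x1" "\<not> pint x2" using i m(2) unfolding 1 2 by simp_all
        qed
        ultimately show False using less.prems by simp
      qed
      from less.IH[OF km(2,1) this] have "m dvd (k - m) + m" by (rule dvd_add) simp
      then show ?thesis using mk by simp
    qed simp
  qed
  obtain xQ yQ where QA: "Q = Aff xQ yQ" using Q by (cases Q) auto
  have rQ: "rc.on (red_point Q)" using on_red[of xQ yQ] on Q unfolding QA by simp
  have red: "red_point (mul k Q) = rc.mul k (red_point Q)" if "k \<le> m" for k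
    using that
  proof (induction k)
    case (Suc k)
    show ?case
    proof (cases "k = 0")
      case False
      have "integral_point (mul k Q)" using least[of k] False Suc.prems by auto
      then obtain x y where xy: "mul k Q = Aff x y" "pint x" by (cases "mul k Q") auto
      have "red_point (mul (Suc k) Q) = rc.add (red_point (Aff xQ yQ)) (red_point (Aff x y))"
        using red_point_add_integral[of xQ yQ x y] on Q on_mul[OF on, of k] xy unfolding QA
        by (simp only: mul.simps integral_point.simps)
      then show ?thesis using Suc xy QA by (simp only: rc.mul.simps)
    qed (use Suc in simp)
  qed simp
  have "m dvd card {P. rc.on P}"
  proof (rule rc.order_dvd_card_points)
    have "{P. rc.on P} \<subseteq> insert Infty ((\<lambda>(x, y). Aff x y) ` UNIV)"
    proof
      fix P :: "'f point" show "P \<in> insert Infty ((\<lambda>(x, y). Aff x y) ` UNIV)" by (cases P) auto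
    qed
    then show "finite {P. rc.on P}" by (rule finite_subset) (simp add: fin finite_prod)
    show "rc.mul m (red_point Q) = Infty" 
      using red[OF order_refl] m(2) red_point_eq_Infty[of "mul m Q"] by metis
    show "rc.mul k (red_point Q) \<noteq> Infty" if "1 \<le> k" "k < m" for k
      using red[OF less_imp_le[OF that(2)]] least[OF that(1)] that(2) red_point_eq_Infty[of "mul k Q"]
      by (metis not_less)
  qed (use rQ m in auto)
  then show ?thesis using m dv[OF n] by blast
qed

end

section \<open>From residue fields to statements about integers\<close>

fun xdenom :: "rat point \<Rightarrow> int" where
  "xdenom Infty = 0"
| "xdenom (Aff x y) = snd (quotient_of x)"

text \<open>The integer N stands for the number of points modulo p, in the two shapes found in
  \<open>card_points_CM\<close>. These are the hypotheses on p and m under which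
  \<open>card_CM_orders\<close> counts.\<close>

definition CM_order :: "nat \<Rightarrow> nat \<Rightarrow> bool" where
  "CM_order p m \<longleftrightarrow> (\<exists>N. int m dvd N \<and> (N = int p + 1 \<or>
      (\<exists>D\<in>{1,3}. \<exists>U V. 4 * N = U^2 + D * V^2 \<and> 4 * int p = (U - 2)^2 + D * V^2)))"

text \<open>The outcome of reduction at p, quantified over all curves and points and stated without
  the residue field. It is thereby a predicate of p alone, to which the choice of a single
  counterexample applies. For a point in normal form, \<open>xdenom\<close> is the square of its d
  and has the same prime divisors.\<close>

definition rank_property :: "nat \<Rightarrow> bool" where
  "rank_property p \<longleftrightarrow> (\<forall>a4 a6 Q n. a4 = 0 \<or> a6 = 0 \<longrightarrow>
     \<not> int p dvd 2 * (4 * a4^3 + 27 * a6^2) \<longrightarrow> weierstrass.on (of_int a4) (of_int a6) Q \<longrightarrow>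
     (\<forall>n\<ge>1. weierstrass.mul (of_int a4) n Q \<noteq> Infty) \<longrightarrow> \<not> int p dvd xdenom Q \<longrightarrow>
     n \<ge> 1 \<longrightarrow> int p dvd xdenom (weierstrass.mul (of_int a4) n Q) \<longrightarrow>
     (\<exists>m\<ge>1. m dvd n \<and> int p dvd xdenom (weierstrass.mul (of_int a4) m Q) \<and> CM_order p m))"

lemma rank_property_prime_field:
  assumes p: "prime p" and of_int_0: "\<And>k. (of_int k :: 'f::{field,finite}) = 0 \<longleftrightarrow> int p dvd k"
    and card: "CARD('f) = p"
  shows "rank_property p"
  unfolding rank_property_def
proof (intro allI impI)
  fix a4 a6 :: int and Q :: "rat point" and n :: nat
  assume AB: "a4 = 0 \<or> a6 = 0" and good: "\<not> int p dvd 2 * (4 * a4^3 + 27 * a6^2)"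
    and on: "weierstrass.on (of_int a4) (of_int a6) Q"
    and ord: "\<forall>n\<ge>1. weierstrass.mul (of_int a4) n Q \<noteq> Infty" and Q: "\<not> int p dvd xdenom Q"
    and n: "n \<ge> 1" "int p dvd xdenom (weierstrass.mul (of_int a4) n Q)"
  have ns: "4 * a4^3 + 27 * a6^2 \<noteq> 0"
  proof
    assume "4 * a4^3 + 27 * a6^2 = 0"
    then show False using good by (simp only: mult_zero_right dvd_0_right not_True_eq_False)
  qed
  interpret good_reduction a4 a6 p "TYPE('f)"
    by unfold_locales (rule ns p of_int_0 good)+
  have int: "integral_point P \<longleftrightarrow> \<not> int p dvd xdenom P" for P
    by (cases P) (auto simp: pint_def)
  obtain m where m: "m \<ge> 1" "m dvd n" "\<not> integral_point (mul m Q)" "m dvd card {P. rc.on P}"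
    using rank_of_apparition[OF on, of n] ord Q n int by auto
  define N where "N = int (card {(x, y). y^2 = x^3 + (of_int a4 :: 'f) * x + of_int a6}) + 1"
  have "int (card {P. rc.on P}) = N"
    using card_points_weierstrass(2)[OF rc.weierstrass_axioms] by (simp add: N_def)
  then have mN: "int m dvd N" using m(4) by (metis int_dvd_int_iff)
  have "(of_int a4 :: 'f) = 0 \<or> (of_int a6 :: 'f) = 0" using AB by auto
  moreover have "(of_int a4 :: 'f) \<noteq> 0 \<or> (of_int a6 :: 'f) \<noteq> 0" using rc.disc by auto
  ultimately have "N = int p + 1 \<or>
    (\<exists>D\<in>{1,3}. \<exists>U V. 4 * N = U^2 + D * V^2 \<and> 4 * int p = (U - 2)^2 + D * V^2)"
    unfolding N_def card[symmetric] by (rule card_points_CM[OF rc.two_neq_0])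
  then have "CM_order p m"
    unfolding CM_order_def by (intro exI[of _ N] conjI mN)
  then show "\<exists>m\<ge>1. m dvd n \<and> int p dvd xdenom (mul m Q) \<and> CM_order p m"
    using m int by blast
qed

text \<open>A prime field of arbitrary characteristic is not available as a type. It suffices to
  consider one hypothetical counterexample to \<open>rank_property\<close>, chosen by Hilbert's epsilon.\<close>

definition exceptional_prime :: nat where
  "exceptional_prime = (SOME p. prime p \<and> ((\<exists>q. prime q \<and> \<not> rank_property q) \<longrightarrow> \<not> rank_property p))"

lemma exceptional_prime:
  "prime exceptional_prime" "prime q \<Longrightarrow> \<not> rank_property q \<Longrightarrow> \<not> rank_property exceptional_prime"
proof -
  have "\<exists>p::nat. prime p \<and> ((\<exists>q. prime q \<and> \<not> rank_property q) \<longrightarrow> \<not> rank_property p)"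
    using two_is_prime_nat by blast
  from someI_ex[OF this, folded exceptional_prime_def]
  show "prime exceptional_prime" "prime q \<Longrightarrow> \<not> rank_property q \<Longrightarrow> \<not> rank_property exceptional_prime"
    by blast+
qed

typedef residue_index = "{..<exceptional_prime}"
  using prime_gt_0_nat[OF exceptional_prime(1)] by auto

lemma card_residue_index: "CARD(residue_index) = exceptional_prime"
  using type_definition.card[OF type_definition_residue_index] by simp

instance residue_index :: prime_card
  by standard (simp add: card_residue_index exceptional_prime(1))

text \<open>\<open>residue_index mod_ring\<close> is the field with \<open>exceptional_prime\<close>
  elements, so the property holds at that prime. As this prime was chosen to be a counterexample
  whenever one exists, there is none.\<close>

lemma rank_property:
  assumes "prime p"
  shows "rank_property p"
proof -
  have z: "(of_int k :: residue_index mod_ring) = 0 \<longleftrightarrow> int exceptional_prime dvd k" for k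
    unfolding of_int_of_int_mod_ring by transfer (simp add: card_residue_index dvd_eq_mod_eq_0)
  have "rank_property exceptional_prime"
    by (rule rank_property_prime_field[OF exceptional_prime(1) z]) (simp add: card_residue_index)
  then show ?thesis using exceptional_prime(2) assms by blast
qed

section \<open>From orders of apparition to the greatest prime factor\<close>

lemma prod_prime_factors_dvd:
  fixes n :: "'a::factorial_semiring"
  assumes "n \<noteq> 0"
  shows "\<Prod>(prime_factors n) dvd n"
proof -
  have "mset_set (prime_factors n) \<subseteq># prime_factorization n"
    by (rule mset_set_set_mset_msubset)
  then have "prod_mset (mset_set (prime_factors n)) dvd prod_mset (prime_factorization n)"
    by (rule prod_mset_subset_imp_dvd)
  then have "\<Prod>(prime_factors n) dvd prod_mset (prime_factorization n)"
    by (simp add: prod_unfold_prod_mset)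
  then show ?thesis using prod_mset_prime_factorization_weak[OF assms] by (metis dvd_normalize_iff)
qed

lemma sum_ln_prime_factors_le:
  fixes n :: nat
  assumes "n > 0"
  shows "(\<Sum>p\<in>prime_factors n. ln (real p)) \<le> ln (real n)"
proof -
  have pos: "\<Prod>(prime_factors n) > 0" by (intro prod_pos) (auto intro: prime_gt_0_nat)
  have "(\<Sum>p\<in>prime_factors n. ln (real p)) = ln (\<Prod>p\<in>prime_factors n. real p)"
    by (rule ln_prod[symmetric]) (auto intro: prime_gt_0_nat)
  also have "\<dots> = ln (real (\<Prod>(prime_factors n)))" by simp
  also have "\<dots> \<le> ln (real n)"
  proof (rule iffD2[OF ln_le_cancel_iff])
    show "real (\<Prod>(prime_factors n)) > 0" "real n > 0" using pos assms by (simp_all only: of_nat_0_less_iff)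
    show "real (\<Prod>(prime_factors n)) \<le> real n"
      using dvd_imp_le[OF prod_prime_factors_dvd, of n] assms by (simp only: of_nat_le_iff)
  qed
  finally show ?thesis .
qed

lemma sum_inverse_squares_tail:
  fixes K :: "nat set" and M :: nat
  assumes "finite K" "M \<ge> 1" "\<And>k. k \<in> K \<Longrightarrow> k > M"
  shows "(\<Sum>k\<in>K. 1 / (real k)^2) \<le> 1 / real M"
proof -
  define N where "N = Max (insert M K)"
  have N: "M \<le> N" and sub: "K \<subseteq> {M<..N}" using assms by (auto simp: N_def)
  have "(\<Sum>k\<in>K. 1 / (real k)^2) \<le> (\<Sum>k\<in>{M<..N}. 1 / (real k)^2)"
    using sub by (intro sum_mono2) auto
  also have "\<dots> \<le> 1 / real M - 1 / real N"
    using N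
  proof (induction N rule: dec_induct)
    case (step k)
    have k: "real k > 0" using step assms(2) by simp
    have "{M<..Suc k} = insert (Suc k) {M<..k}" using step by auto
    then have "(\<Sum>k\<in>{M<..Suc k}. 1 / (real k)^2) = 1 / (real (Suc k))^2 + (\<Sum>k\<in>{M<..k}. 1 / (real k)^2)"
      by simp
    also have "\<dots> \<le> 1 / (real k * real (Suc k)) + (1 / real M - 1 / real k)"
      using k step by (intro add_mono divide_left_mono) (auto simp: power2_eq_square)
    also have "1 / (real k * real (Suc k)) = 1 / real k - 1 / real (Suc k)"
      using k by (subst diff_frac_eq) auto
    also have "1 / real k - 1 / real (Suc k) + (1 / real M - 1 / real k) = 1 / real M - 1 / real (Suc k)"
      by simp
    finally show ?case .
  qed simp
  also have "\<dots> \<le> 1 / real M" by simp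
  finally show ?thesis .
qed

lemma num_divisors_dvd_mono:
  "m dvd n \<Longrightarrow> n > 0 \<Longrightarrow> num_divisors m \<le> num_divisors n"
  unfolding num_divisors_def by (intro card_mono) (auto intro: dvd_trans)

lemma prime_factors_le_gpf:
  assumes "p \<in> prime_factors n"
  shows "p \<le> gpf n"
proof -
  have "n > 1"
  proof (rule ccontr)
    assume "\<not> n > 1"
    then have "n = 0 \<or> n = 1" by auto
    then show False using assms by auto
  qed
  then show ?thesis using assms by (simp add: gpf_def)
qed

lemma gpf_pos: "gpf n > 0"
proof (cases "n \<le> 1")
  case False
  then have "prime_factors n \<noteq> {}" using prime_factorization_empty_iff[of n] by auto
  then have "Max (prime_factors n) \<in> prime_factors n" by (intro Max_in) auto
  then show ?thesis using False by (auto simp: gpf_def intro: prime_gt_0_nat)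
qed (simp add: gpf_def)

text \<open>A prime of rank m is filed under k = n div m. For k > M the primes divide D (n div k),
  whose logarithm is at most C n^2 / k^2, and the tail of the series leaves C n^2 / M. For each of
  the at most M values k \<le> M, \<open>card_CM_orders\<close> counts the primes and each
  contributes at most ln P; the term P M / n dominates P k / n. \<open>Bd\<close> holds the primes
  excluded from the rank argument.\<close>

lemma sum_ln_prime_factors_CM:
  fixes D :: "nat \<Rightarrow> nat" and C :: real and Bd :: "nat set" and n M :: nat
  assumes D: "\<And>n. n \<ge> 1 \<Longrightarrow> D n \<ge> 1" and DC: "\<And>n. n \<ge> 1 \<Longrightarrow> ln (real (D n)) \<le> C * real n ^ 2" and C: "C \<ge> 0"
    and Bd: "finite Bd" "\<And>p. p \<in> Bd \<Longrightarrow> p > 0" and n: "n \<ge> 1" and M: "M \<ge> 1"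
    and cm: "\<And>p. p \<in> prime_factors (D n) - Bd \<Longrightarrow> \<exists>m\<ge>1. m dvd n \<and> p dvd D m \<and> CM_order p m"
  defines "P \<equiv> gpf (D n)"
  shows "(\<Sum>p\<in>prime_factors (D n). ln (real p)) \<le> (\<Sum>p\<in>Bd. ln (real p)) + C * real n ^ 2 / real M +
     real M * (2000 * (real (num_divisors n))^2 * (real P * real M / real n + real n) * ln (real P))"
proof -
  define K where "K = {k. k dvd n}"
  define PF where "PF = prime_factors (D n)"
  define S where "S k = {p \<in> PF. p dvd D (n div k) \<and> CM_order p (n div k)}" for k
  have fin: "finite K" "finite PF" "finite (S k)" for k using n by (auto simp: K_def PF_def S_def)
  have ln0: "ln (real p) \<ge> 0" if "p > 0" for p :: nat using that by simp
  have PFpos: "p > 0" if "p \<in> PF" for p using that by (auto simp: PF_def intro: prime_gt_0_nat)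
  have P0: "P > 0" unfolding P_def by (rule gpf_pos)
  have lnP: "ln (real P) \<ge> 0" using P0 by simp
  have k: "k \<ge> 1" "n div k \<ge> 1" "real (n div k) = real n / real k" "n div k dvd n" "k \<le> n" if kK: "k \<in> K" for k
  proof -
    obtain j where j: "n = k * j" using kK by (auto simp: K_def)
    then have "k \<ge> 1" "j \<ge> 1" using n by (cases k; cases j; simp)+
    then show "k \<ge> 1" "n div k \<ge> 1" "real (n div k) = real n / real k" "n div k dvd n" "k \<le> n" using j by auto
  qed
  have cover: "\<exists>k\<in>K. p \<in> S k" if pB: "p \<in> PF - Bd" for p
  proof -
    obtain m where m: "m \<ge> 1" "m dvd n" "p dvd D m" "CM_order p m" using cm pB unfolding PF_def by blast
    then obtain j where j: "n = m * j" by auto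
    then have "j \<in> K" "n div j = m" using n by (auto simp: K_def)
    then show ?thesis using m pB by (auto simp: S_def)
  qed
  \<comment> \<open>A prime may be filed under several k; repeated counting only enlarges the right
    side, as the logarithms are nonnegative.\<close>
  have "(\<Sum>p\<in>PF - Bd. ln (real p)) \<le> (\<Sum>p\<in>PF - Bd. \<Sum>k\<in>K. if p \<in> S k then ln (real p) else 0)"
  proof (rule sum_mono)
    fix p assume p: "p \<in> PF - Bd"
    then obtain k where k: "k \<in> K" "p \<in> S k" using cover by blast
    then have "ln (real p) = (if p \<in> S k then ln (real p) else 0)" by simp
    also have "\<dots> \<le> (\<Sum>k\<in>K. if p \<in> S k then ln (real p) else 0)"
      using PFpos[of p] p by (intro member_le_sum k fin) auto
    finally show "ln (real p) \<le> (\<Sum>k\<in>K. if p \<in> S k then ln (real p) else 0)" .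
  qed
  also have "\<dots> \<le> (\<Sum>p\<in>PF. \<Sum>k\<in>K. if p \<in> S k then ln (real p) else 0)"
    using PFpos fin by (intro sum_mono2 sum_nonneg) (auto simp: Suc_le_eq)
  also have "\<dots> = (\<Sum>k\<in>K. \<Sum>p\<in>PF. if p \<in> S k then ln (real p) else 0)" by (rule sum.swap)
  also have "\<dots> = (\<Sum>k\<in>K. \<Sum>p\<in>S k. ln (real p))"
  proof (rule sum.cong)
    fix k
    have "PF \<inter> {p. p \<in> S k} = S k" by (auto simp: S_def)
    then show "(\<Sum>p\<in>PF. if p \<in> S k then ln (real p) else 0) = (\<Sum>p\<in>S k. ln (real p))"
      using fin by (simp add: sum.If_cases)
  qed simp
  also have "\<dots> = (\<Sum>k\<in>{k\<in>K. k > M}. \<Sum>p\<in>S k. ln (real p)) + (\<Sum>k\<in>{k\<in>K. k \<le> M}. \<Sum>p\<in>S k. ln (real p))"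
  proof -
    have split: "K = {k\<in>K. k > M} \<union> {k\<in>K. k \<le> M}" by auto
    show ?thesis by (subst split) (rule sum.union_disjoint; use fin(1) in auto)
  qed
  also have "(\<Sum>k\<in>{k\<in>K. k > M}. \<Sum>p\<in>S k. ln (real p)) \<le> (\<Sum>k\<in>{k\<in>K. k > M}. C * real n ^ 2 * (1 / (real k)^2))"
  proof (rule sum_mono)
    fix k assume "k \<in> {k\<in>K. k > M}"
    then have kK: "k \<in> K" by simp
    have D0: "D (n div k) \<ge> 1" using D k(2)[OF kK] by simp
    have "S k \<subseteq> prime_factors (D (n div k))" using D0 by (auto simp: S_def PF_def prime_factors_dvd)
    then have "(\<Sum>p\<in>S k. ln (real p)) \<le> (\<Sum>p\<in>prime_factors (D (n div k)). ln (real p))"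
      by (intro sum_mono2) (auto intro!: ln0 intro: prime_gt_0_nat)
    also have "\<dots> \<le> ln (real (D (n div k)))" using D0 by (intro sum_ln_prime_factors_le) simp
    also have "\<dots> \<le> C * real (n div k) ^ 2" using DC k(2)[OF kK] by simp
    also have "\<dots> = C * real n ^ 2 * (1 / (real k)^2)" unfolding k(3)[OF kK] by (simp add: power_divide)
    finally show "(\<Sum>p\<in>S k. ln (real p)) \<le> C * real n ^ 2 * (1 / (real k)^2)" .
  qed
  also have "(\<Sum>k\<in>{k\<in>K. k > M}. C * real n ^ 2 * (1 / (real k)^2)) \<le> C * real n ^ 2 * (1 / real M)"
    unfolding sum_distrib_left[symmetric]
    using C M fin by (intro mult_left_mono sum_inverse_squares_tail) auto
  also have "(\<Sum>k\<in>{k\<in>K. k \<le> M}. \<Sum>p\<in>S k. ln (real p)) \<le>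
     (\<Sum>k\<in>{k\<in>K. k \<le> M}. 2000 * (real (num_divisors n))^2 * (real P * real M / real n + real n) * ln (real P))"
  proof (rule sum_mono)
    fix k assume "k \<in> {k\<in>K. k \<le> M}"
    then have kK: "k \<in> K" and kM: "k \<le> M" by auto
    note kk = k[OF kK]
    have "real (card (S k)) \<le> 2000 * (real (num_divisors (n div k)))^2 * (real P / real (n div k) + real (n div k))"
    proof (rule card_CM_orders)
      show "p \<le> P" if "p \<in> S k" for p using that prime_factors_le_gpf by (auto simp: S_def PF_def P_def)
    qed (use kk P0 in \<open>auto simp: S_def CM_order_def\<close>)
    also have "\<dots> \<le> 2000 * (real (num_divisors n))^2 * (real P * real M / real n + real n)"
    proof (rule mult_mono)
      show "2000 * (real (num_divisors (n div k)))^2 \<le> 2000 * (real (num_divisors n))^2"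
        using num_divisors_dvd_mono[OF kk(4)] n by (intro mult_left_mono power_mono) auto
      have "real P / real (n div k) = real P * real k / real n" unfolding kk(3) by simp
      also have "\<dots> \<le> real P * real M / real n" using kM by (intro divide_right_mono mult_left_mono) auto
      finally have "real P / real (n div k) \<le> real P * real M / real n" .
      moreover have "real (n div k) \<le> real n" by simp
      ultimately show "real P / real (n div k) + real (n div k) \<le> real P * real M / real n + real n" by linarith
    qed auto
    finally have c: "real (card (S k)) \<le> 2000 * (real (num_divisors n))^2 * (real P * real M / real n + real n)" .
    have "(\<Sum>p\<in>S k. ln (real p)) \<le> (\<Sum>p\<in>S k. ln (real P))"
    proof (rule sum_mono)
      fix p assume "p \<in> S k"
      then have "p \<le> P" "p > 0" using prime_factors_le_gpf PFpos by (auto simp: S_def PF_def P_def)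
      then show "ln (real p) \<le> ln (real P)" by simp
    qed
    also have "\<dots> = real (card (S k)) * ln (real P)" by simp
    also have "\<dots> \<le> 2000 * (real (num_divisors n))^2 * (real P * real M / real n + real n) * ln (real P)"
      using c lnP by (rule mult_right_mono)
    finally show "(\<Sum>p\<in>S k. ln (real p)) \<le> 2000 * (real (num_divisors n))^2 * (real P * real M / real n + real n) * ln (real P)" .
  qed
  also have "\<dots> \<le> real M * (2000 * (real (num_divisors n))^2 * (real P * real M / real n + real n) * ln (real P))"
  proof -
    have "{k\<in>K. k \<le> M} \<subseteq> {1..M}" using k by auto
    then have "card {k\<in>K. k \<le> M} \<le> M" using card_mono[of "{1..M}"] by simp
    moreover have "0 \<le> 2000 * (real (num_divisors n))^2 * (real P * real M / real n + real n) * ln (real P)"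
      using lnP by simp
    ultimately show ?thesis unfolding sum_constant by (intro mult_right_mono) auto
  qed
  finally have main: "(\<Sum>p\<in>PF - Bd. ln (real p)) \<le> C * real n ^ 2 * (1 / real M) +
     real M * (2000 * (real (num_divisors n))^2 * (real P * real M / real n + real n) * ln (real P))"
    by simp
  have "(\<Sum>p\<in>PF. ln (real p)) = (\<Sum>p\<in>PF - Bd. ln (real p)) + (\<Sum>p\<in>PF \<inter> Bd. ln (real p))"
    using fin(2) sum.Int_Diff[of PF "\<lambda>p. ln (real p)" Bd] by simp
  moreover have "(\<Sum>p\<in>PF \<inter> Bd. ln (real p)) \<le> (\<Sum>p\<in>Bd. ln (real p))"
    using Bd by (intro sum_mono2) (auto simp: Suc_le_eq)
  ultimately show ?thesis using main by (simp add: PF_def)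
qed

text \<open>The lower bound c1 n^2 is spent in quarters: one on the ranks n / k with k > M, one on
  the constants from \<open>Bd\<close> and c2, one on the summand n in P M / n + n. What remains is
  at most a multiple of n^\<theta> P / n, so P is at least a multiple of n^(3 - \<theta>).\<close>

lemma gpf_growth:
  fixes D :: "nat \<Rightarrow> nat" and c1 c2 C \<epsilon> :: real and Bd :: "nat set"
  assumes D: "\<And>n. n \<ge> 1 \<Longrightarrow> D n \<ge> 1" and DC: "\<And>n. n \<ge> 1 \<Longrightarrow> ln (real (D n)) \<le> C * real n ^ 2" and C: "C \<ge> 0"
    and low: "\<And>n. n \<ge> 1 \<Longrightarrow> c1 * real n ^ 2 - c2 \<le> (\<Sum>p\<in>prime_factors (D n). ln (real p))" and c1: "c1 > 0"
    and Bd: "finite Bd" "\<And>p. p \<in> Bd \<Longrightarrow> p > 0"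
    and cm: "\<And>n p. n \<ge> 1 \<Longrightarrow> p \<in> prime_factors (D n) - Bd \<Longrightarrow> \<exists>m\<ge>1. m dvd n \<and> p dvd D m \<and> CM_order p m"
    and eps: "\<epsilon> > 0"
  shows "\<exists>c>0. \<forall>n\<ge>1. real (gpf (D n)) \<ge> c * real n powr (3 - \<epsilon>)"
proof -
  define M where "M = nat \<lceil>4 * C / c1\<rceil> + 1"
  \<comment> \<open>\<theta> \<le> 1/2 keeps n^(1 + \<theta>) small against n^2. Below, \<eta> is a
    third of \<theta> because n^\<eta> enters three times, twice through the squared divisor count
    and once through ln P.\<close>
  define \<theta> where "\<theta> = min \<epsilon> 1 / 2"
  define \<eta> where "\<eta> = \<theta> / 3"
  define B where "B = (\<Sum>p\<in>Bd. ln (real p))"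
  have th: "\<theta> > 0" "\<theta> \<le> 1 / 2" "\<theta> \<le> \<epsilon>" "\<eta> > 0" using eps by (auto simp: \<theta>_def \<eta>_def)
  obtain T where T: "T > 0" "\<And>n. n > 0 \<Longrightarrow> real (num_divisors n) \<le> T * real n powr \<eta>"
    using num_divisors_bound[OF th(4)] by blast
  define E where "E = real M * (2000 * T^2 * (3 / \<eta>))"
  have M: "M \<ge> 1" "real M > 0" by (auto simp: M_def)
  have E: "E > 0" using M T th by (simp add: E_def)
  have CM: "C / real M \<le> c1 / 4"
  proof -
    have "4 * C / c1 \<le> real M" unfolding M_def by linarith
    then show ?thesis using M c1 by (simp add: field_simps)
  qed
  define n1 where "n1 = nat \<lceil>4 * (\<bar>B\<bar> + \<bar>c2\<bar>) / c1\<rceil> + nat \<lceil>(4 * E / c1)^2\<rceil> + 1"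
  define \<kappa> where "\<kappa> = c1 / (4 * E * real M)"
  have k0: "\<kappa> > 0" using c1 E M by (simp add: \<kappa>_def)
  have big: "real (gpf (D n)) \<ge> min \<kappa> 1 * real n powr (3 - \<epsilon>)" if n: "n \<ge> n1" for n
  proof -
    have n1: "n \<ge> 1" using n by (simp add: n1_def)
    define x where "x = real n"
    have x: "x \<ge> 1" using n1 by (simp add: x_def)
    define P where "P = gpf (D n)"
    have P0: "P > 0" unfolding P_def by (rule gpf_pos)
    have mon: "x powr (3 - \<epsilon>) \<le> x powr (3 - \<theta>)" "x powr (3 - \<epsilon>) \<le> x powr 3"
      by (rule powr_mono; use x th eps in simp)+
    show ?thesis
    \<comment> \<open>Either P is already large enough, or ln P \<le> 3 ln n, which makes the factor
      ln P harmless.\<close>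
    proof (cases "real P \<ge> x powr 3")
      case True
      have "min \<kappa> 1 * x powr (3 - \<epsilon>) \<le> 1 * x powr (3 - \<epsilon>)" by (intro mult_right_mono) auto
      then have "min \<kappa> 1 * x powr (3 - \<epsilon>) \<le> real P" using True mon(2) by linarith
      then show ?thesis unfolding x_def P_def .
    next
      case False
      have lnx: "ln x \<le> x powr \<eta> / \<eta>"
      proof -
        have "\<eta> * ln x = ln (x powr \<eta>)" using x by (simp add: ln_powr)
        also have "\<dots> \<le> x powr \<eta>" using x by (intro less_imp_le ln_less_self) auto
        finally show ?thesis using th by (simp add: field_simps)
      qed
      have "ln (real P) \<le> ln (x powr 3)" using False P0 x by (subst ln_le_cancel_iff) auto
      also have "\<dots> = 3 * ln x" using x by (simp add: ln_realpow)
      also have "\<dots> \<le> 3 / \<eta> * x powr \<eta>" using lnx by simp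
      finally have lnP: "ln (real P) \<le> 3 / \<eta> * x powr \<eta>" .
      have tau: "(real (num_divisors n))^2 \<le> T^2 * (x powr \<eta> * x powr \<eta>)"
        using power_mono[OF T(2)[of n], of 2] n1 by (simp add: x_def power_mult_distrib power2_eq_square mult_ac)
      have "2000 * (real (num_divisors n))^2 * (real P * real M / x + x) * ln (real P)
        \<le> 2000 * (T^2 * (x powr \<eta> * x powr \<eta>)) * (real P * real M / x + x) * (3 / \<eta> * x powr \<eta>)"
        using tau lnP x P0 by (intro mult_mono mult_left_mono mult_right_mono) auto
      also have "\<dots> = 2000 * T^2 * (3 / \<eta>) * (x powr \<eta> * x powr \<eta> * x powr \<eta>) * (real P * real M / x + x)"
        by simp
      also have "x powr \<eta> * x powr \<eta> * x powr \<eta> = x powr \<theta>"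
        by (simp add: powr_add[symmetric] \<eta>_def)
      finally have "real M * (2000 * (real (num_divisors n))^2 * (real P * real M / x + x) * ln (real P))
        \<le> real M * (2000 * T^2 * (3 / \<eta>) * x powr \<theta> * (real P * real M / x + x))"
        using M by (intro mult_left_mono) auto
      also have "\<dots> = E * x powr \<theta> * (real P * real M / x + x)" by (simp add: E_def)
      finally have a: "real M * (2000 * (real (num_divisors n))^2 * (real P * real M / x + x) * ln (real P))
        \<le> E * x powr \<theta> * (real P * real M / x + x)" .
      have "c1 * x^2 - c2 \<le> B + C * x^2 / real M +
         real M * (2000 * (real (num_divisors n))^2 * (real P * real M / x + x) * ln (real P))"
        using low[OF n1] sum_ln_prime_factors_CM[OF D DC C Bd n1 M(1) cm[OF n1]]
        unfolding x_def P_def B_def by linarith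
      moreover have "C * x^2 / real M \<le> c1 / 4 * x^2"
        using mult_right_mono[OF CM, of "x^2"] by simp
      moreover have "B + c2 \<le> c1 / 4 * x^2"
      proof -
        have "4 * (\<bar>B\<bar> + \<bar>c2\<bar>) / c1 \<le> x" using n unfolding x_def n1_def by linarith
        also have "x \<le> x^2" using x by (simp add: power2_eq_square)
        finally have "\<bar>B\<bar> + \<bar>c2\<bar> \<le> c1 / 4 * x^2" using c1 by (simp add: field_simps)
        then show ?thesis by linarith
      qed
      ultimately have b: "c1 / 2 * x^2 \<le> E * x powr \<theta> * (real P * real M / x + x)" using a by linarith
      have Ex: "E * x powr \<theta> * x \<le> c1 / 4 * x^2"
      proof -
        have "(4 * E / c1)^2 \<le> x" using n unfolding x_def n1_def by linarith
        then have "4 * E / c1 \<le> sqrt x" by (rule real_le_rsqrt)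
        then have "E \<le> c1 / 4 * sqrt x" using c1 by (simp add: field_simps)
        moreover have "x powr \<theta> \<le> x powr (1/2)" using x th by (intro powr_mono) auto
        then have "x powr \<theta> \<le> sqrt x" using x by (simp add: powr_half_sqrt)
        ultimately have "E * x powr \<theta> \<le> (c1 / 4 * sqrt x) * sqrt x" using E c1 x by (intro mult_mono) auto
        also have "\<dots> = c1 / 4 * x" using x by simp
        finally show ?thesis using x by (simp add: power2_eq_square mult_right_mono)
      qed
      have "E * x powr \<theta> * (real P * real M / x + x) = E * x powr \<theta> * (real P * real M / x) + E * x powr \<theta> * x"
        by (simp add: distrib_left)
      then have "c1 / 4 * x^2 \<le> E * x powr \<theta> * (real P * real M / x)" using b Ex by linarith
      then have "c1 / 4 * x^2 * x \<le> E * x powr \<theta> * real P * real M"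
        using x by (simp add: field_simps)
      then have "\<kappa> * (x^2 * x) \<le> x powr \<theta> * real P"
        using E M by (simp add: \<kappa>_def field_simps)
      also have "x^2 * x = x powr \<theta> * x powr (3 - \<theta>)"
        using x by (simp add: powr_add[symmetric] powr_numeral power2_eq_square power3_eq_cube)
      finally have "x powr \<theta> * (\<kappa> * x powr (3 - \<theta>)) \<le> x powr \<theta> * real P" by (simp add: mult_ac)
      then have "\<kappa> * x powr (3 - \<theta>) \<le> real P" using x by simp
      moreover have "min \<kappa> 1 * x powr (3 - \<epsilon>) \<le> \<kappa> * x powr (3 - \<theta>)"
        using mon k0 by (intro mult_mono) auto
      ultimately show ?thesis by (simp add: x_def P_def)
    qed
  qed
  have "n1 \<ge> 1" unfolding n1_def by (rule le_add2)
  then have N: "real n1 \<ge> 1" by simp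
  \<comment> \<open>For n below \<open>n1\<close> the second entry makes the claimed bound at most
    1, and \<open>gpf\<close> is at least 1.\<close>
  define c where "c = min (min \<kappa> 1) (1 / real n1 ^ 3)"
  have "real (gpf (D n)) \<ge> c * real n powr (3 - \<epsilon>)" if n: "n \<ge> 1" for n
  proof (cases "n \<ge> n1")
    case True
    have "c * real n powr (3 - \<epsilon>) \<le> min \<kappa> 1 * real n powr (3 - \<epsilon>)" by (intro mult_right_mono) (auto simp: c_def)
    then show ?thesis using big[OF True] by linarith
  next
    case False
    have "real n powr (3 - \<epsilon>) \<le> real n powr 3" using n eps by (intro powr_mono) auto
    also have "\<dots> = real n ^ 3" using n by (simp add: powr_numeral)
    also have "\<dots> \<le> real n1 ^ 3" using False by (intro power_mono) auto
    finally have "c * real n powr (3 - \<epsilon>) \<le> 1 / real n1 ^ 3 * real n1 ^ 3"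
      using N by (intro mult_mono) (auto simp: c_def)
    also have "\<dots> = 1" using N by simp
    also have "1 \<le> real (gpf (D n))" using gpf_pos[of "D n"] by simp
    finally show ?thesis .
  qed
  moreover have "c > 0" using k0 N by (simp add: c_def)
  ultimately show ?thesis by blast
qed

section \<open>The ABC conjecture and the radical of the denominator\<close>

text \<open>This includes m = 0, where the set of prime factors is empty and the radical is
  1.\<close>

lemma radical_ge_1: "radical m \<ge> 1"
  unfolding radical_def by (intro prod_ge_1 prime_ge_1_int) (rule in_prime_factors_imp_prime)

lemma radical_le_abs:
  assumes "m \<noteq> 0"
  shows "radical m \<le> \<bar>m\<bar>"
  using dvd_imp_le_int[OF assms, of "radical m"] prod_prime_factors_dvd[OF assms] radical_ge_1[of m]
  by (simp add: radical_def)

lemma radical_le_mult: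
  assumes "m \<noteq> 0" "w \<noteq> 0" "d \<noteq> 0" "\<And>p. prime p \<Longrightarrow> p dvd m \<Longrightarrow> p dvd w \<or> p dvd d"
  shows "radical m \<le> \<bar>w\<bar> * radical d"
proof -
  have pos: "1 \<le> p" if "p \<in> prime_factors k" for p k :: int
    using that by (intro prime_ge_1_int) (rule in_prime_factors_imp_prime)
  have pos0: "0 \<le> p" if "p \<in> prime_factors k" for p k :: int
    using pos[OF that] by simp
  have "prime_factors m \<subseteq> prime_factors w \<union> prime_factors d"
    using assms by (auto simp: prime_factors_dvd)
  then have "radical m \<le> \<Prod>(prime_factors w \<union> prime_factors d)"
    unfolding radical_def using pos pos0 by (intro prod_mono2) auto
  also have "prime_factors w \<union> prime_factors d = prime_factors w \<union> (prime_factors d - prime_factors w)" by auto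
  also have "\<Prod>\<dots> = \<Prod>(prime_factors w) * \<Prod>(prime_factors d - prime_factors w)"
    by (rule prod.union_disjoint) auto
  also have "\<dots> \<le> radical w * radical d"
    unfolding radical_def using pos pos0 by (intro mult_mono prod_mono2 prod_nonneg) auto
  also have "\<dots> \<le> \<bar>w\<bar> * radical d"
    using radical_le_abs[OF assms(2)] radical_ge_1[of d] by (intro mult_right_mono) auto
  finally show ?thesis .
qed

lemma ln_radical_of_nat:
  assumes "d \<ge> 1"
  shows "ln (real_of_int (radical (int d))) = (\<Sum>p\<in>prime_factors d. ln (real p))"
proof -
  have "prime_factors (int d) = int ` prime_factors d"
  proof (intro equalityI subsetI)
    fix p assume "p \<in> prime_factors (int d)"
    then have p: "prime p" "p dvd int d" by (auto simp: prime_factors_dvd)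
    then obtain q where q: "p = int q" using prime_ge_0_int nonneg_int_cases by metis
    then have "q \<in> prime_factors d" using p assms by (simp add: prime_factors_dvd)
    then show "p \<in> int ` prime_factors d" using q by simp
  qed (use assms in \<open>auto simp: prime_factors_dvd\<close>)
  then have "radical (int d) = (\<Prod>p\<in>prime_factors d. int p)"
    unfolding radical_def by (simp add: prod.reindex)
  then have "real_of_int (radical (int d)) = (\<Prod>p\<in>prime_factors d. real p)" by simp
  then show ?thesis
    by (simp only:) (rule ln_prod, auto intro: prime_gt_0_nat)
qed

text \<open>The gcd of the triple divides the fixed M, so dividing by it costs only an additive
  constant and makes the triple coprime. The primes of X Y Z are split into those of d, kept as a
  radical, and those of w, estimated by size. If X Y Z = 0 the radical is 1 and w is unrestricted,
  hence the maximum with 1.\<close>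

lemma abc_radical_bound:
  assumes abc: "abc_conjecture" and eps: "\<epsilon> > 0" and M: "M \<noteq> 0"
  obtains c :: real where "\<And>X Y Z w d. X + Y + Z = 0 \<Longrightarrow> gcd X Y dvd M \<Longrightarrow> d \<noteq> 0 \<Longrightarrow>
     max \<bar>X\<bar> (max \<bar>Y\<bar> \<bar>Z\<bar>) \<noteq> 0 \<Longrightarrow> (X * Y * Z \<noteq> 0 \<Longrightarrow> w \<noteq> 0) \<Longrightarrow>
     (\<And>p. prime p \<Longrightarrow> p dvd X * Y * Z \<Longrightarrow> X * Y * Z \<noteq> 0 \<Longrightarrow> p dvd w \<or> p dvd d) \<Longrightarrow>
     ln (real_of_int (max \<bar>X\<bar> (max \<bar>Y\<bar> \<bar>Z\<bar>))) \<le>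
     c + (1 + \<epsilon>) * (ln (real_of_int (max 1 \<bar>w\<bar>)) + ln (real_of_int (radical d)))"
proof -
  obtain K0 where K0: "\<And>a b c :: int. coprime a b \<Longrightarrow> coprime b c \<Longrightarrow> coprime a c \<Longrightarrow> a + b + c = 0 \<Longrightarrow>
     real_of_int (max \<bar>a\<bar> (max \<bar>b\<bar> \<bar>c\<bar>)) \<le> K0 * (real_of_int (radical (a*b*c))) powr (1 + \<epsilon>)"
    using abc eps unfolding abc_conjecture_def by blast
  define K where "K = max K0 1"
  have K: "K \<ge> 1" "K0 \<le> K" by (auto simp: K_def)
  define c where "c = ln (\<bar>real_of_int M\<bar> * K)"
  have "ln (real_of_int (max \<bar>X\<bar> (max \<bar>Y\<bar> \<bar>Z\<bar>))) \<le>
     c + (1 + \<epsilon>) * (ln (real_of_int (max 1 \<bar>w\<bar>)) + ln (real_of_int (radical d)))"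
    if sum: "X + Y + Z = 0" and gM: "gcd X Y dvd M" and d: "d \<noteq> 0" and nz: "max \<bar>X\<bar> (max \<bar>Y\<bar> \<bar>Z\<bar>) \<noteq> 0"
      and w: "X * Y * Z \<noteq> 0 \<Longrightarrow> w \<noteq> 0"
      and pr: "\<And>p. prime p \<Longrightarrow> p dvd X * Y * Z \<Longrightarrow> X * Y * Z \<noteq> 0 \<Longrightarrow> p dvd w \<or> p dvd d" for X Y Z w d :: int
  proof -
    define g where "g = gcd X Y"
    have "X \<noteq> 0 \<or> Y \<noteq> 0" using sum nz by auto
    then have g: "g > 0" by (auto simp: g_def)
    have gle: "g \<le> \<bar>M\<bar>" using gM M dvd_imp_le_int[of M g] g by (simp add: g_def)
    obtain x y where x: "X = g * x" and y: "Y = g * y" by (metis g_def gcd_dvd1 gcd_dvd2 dvdE)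
    define z where "z = - x - y"
    have z: "Z = g * z" using sum x y by (simp add: z_def algebra_simps)
    have cxy: "coprime x y"
    proof -
      have "gcd (g * x) (g * y) = g" using g_def x y by metis
      moreover have "gcd (g * x) (g * y) = g * gcd x y" using g by (simp add: gcd_mult_left)
      ultimately have "g * gcd x y = g * 1" by simp
      then have "gcd x y = 1" using g by (subst (asm) mult_cancel_left) auto
      then show ?thesis by (simp add: coprime_iff_gcd_eq_1)
    qed
    have cyz: "coprime y z" and cxz: "coprime x z"
    proof -
      show "coprime y z"
      proof (rule coprimeI)
        fix k assume k: "k dvd y" "k dvd z"
        then have "k dvd - (y + z)" by simp
        then have "k dvd x" by (simp add: z_def)
        then show "is_unit k" using k(1) by (rule coprime_common_divisor[OF cxy])
      qed
      show "coprime x z"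
      proof (rule coprimeI)
        fix k assume k: "k dvd x" "k dvd z"
        then have "k dvd - (x + z)" by simp
        then have "k dvd y" by (simp add: z_def)
        with k(1) show "is_unit k" by (rule coprime_common_divisor[OF cxy])
      qed
    qed
    have XYZ: "X * Y * Z = g^3 * (x * y * z)" by (simp add: x y z power3_eq_cube)
    define R where "R = max 1 \<bar>w\<bar> * radical d"
    have "1 * 1 \<le> max 1 \<bar>w\<bar> * radical d" using radical_ge_1[of d] by (intro mult_mono) auto
    then have R1: "R \<ge> 1" by (simp add: R_def)
    have rad: "radical (x * y * z) \<le> R"
    proof (cases "x * y * z = 0")
      case True
      show ?thesis unfolding True using R1 by (simp add: radical_def)
    next
      case False
      then have n0: "X * Y * Z \<noteq> 0" using g XYZ by simp
      have "radical (x * y * z) \<le> \<bar>w\<bar> * radical d"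
      proof (rule radical_le_mult[OF False w[OF n0] d])
        fix p assume p: "prime p" "p dvd x * y * z"
        from p(2) have "p dvd X * Y * Z" unfolding XYZ by (rule dvd_mult)
        then show "p dvd w \<or> p dvd d" using pr p(1) n0 by blast
      qed
      also have "\<dots> \<le> R" unfolding R_def using radical_ge_1[of d] by (intro mult_right_mono) auto
      finally show ?thesis .
    qed
    define m where "m = max \<bar>x\<bar> (max \<bar>y\<bar> \<bar>z\<bar>)"
    have mX: "max \<bar>X\<bar> (max \<bar>Y\<bar> \<bar>Z\<bar>) = g * m"
      unfolding m_def x y z abs_mult using g by (simp add: max_mult_distrib_left)
    have "m \<ge> 0" by (simp add: m_def le_max_iff_disj)
    moreover have "m \<noteq> 0" using nz unfolding mX by auto
    ultimately have m0: "m > 0" by simp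
    have "real_of_int m \<le> K0 * real_of_int (radical (x * y * z)) powr (1 + \<epsilon>)"
      unfolding m_def by (rule K0[OF cxy cyz cxz]) (simp add: z_def)
    also have "\<dots> \<le> K * real_of_int R powr (1 + \<epsilon>)"
      using K rad radical_ge_1[of "x * y * z"] eps by (intro mult_mono powr_mono2) auto
    finally have mle: "real_of_int m \<le> K * real_of_int R powr (1 + \<epsilon>)" .
    have "real_of_int (g * m) = real_of_int g * real_of_int m" by simp
    also have "\<dots> \<le> \<bar>real_of_int M\<bar> * (K * real_of_int R powr (1 + \<epsilon>))"
      using gle mle m0 g K by (intro mult_mono) (auto simp flip: of_int_abs)
    finally have "ln (real_of_int (g * m)) \<le> ln (\<bar>real_of_int M\<bar> * K * real_of_int R powr (1 + \<epsilon>))"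
      using g m0 M K R1 by (subst ln_le_cancel_iff) (auto simp: mult.assoc)
    also have "\<dots> = c + (1 + \<epsilon>) * ln (real_of_int R)"
      unfolding c_def using M K R1 by (subst ln_mult_pos) (auto simp: ln_powr)
    also have "ln (real_of_int R) = ln (real_of_int (max 1 \<bar>w\<bar>)) + ln (real_of_int (radical d))"
      unfolding R_def of_int_mult using radical_ge_1[of d] by (intro ln_mult_pos) auto
    finally show ?thesis unfolding mX .
  qed
  then show thesis using that by blast
qed

lemma ln_le_of_power_le:
  fixes x y :: real
  assumes "x > 0" "y > 0" "C > 0" "x ^ 2 \<le> C * y ^ n"
  shows "ln x \<le> ln C / 2 + real n / 2 * ln y"
proof -
  have "ln (x^2) \<le> ln (C * y ^ n)" using assms by (subst ln_le_cancel_iff) auto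
  then have "2 * ln x \<le> ln C + real n * ln y" using assms by (simp add: ln_mult_pos ln_realpow)
  then show ?thesis by simp
qed

text \<open>Put h = ln H with H the maximum of |a| and d^2. For a4 = 0 the largest term is at least
  H^3 and w = a b a6 is at most a multiple of H^(5/2), so ABC with exponent 1 + 1/11 leaves (11/12)
  3 - 5/2 = 1/4 of h for the radical of d. For a6 = 0 the sizes are H^2 and H^(3/2), and exponent 1
  + 1/7 leaves (7/8) 2 - 3/2 = 1/4 again.\<close>

lemma abc_radical_denominator:
  fixes a4 a6 :: int
  assumes abc: "abc_conjecture" and nonsing: "4 * a4^3 + 27 * a6^2 \<noteq> 0" and j: "a4 = 0 \<or> a6 = 0"
  obtains c :: real where "\<And>a b d. d \<ge> 1 \<Longrightarrow> b^2 = a^3 + a4 * a * d^4 + a6 * d^6 \<Longrightarrow> coprime a d \<Longrightarrow>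
     ln (real_of_int (max \<bar>a\<bar> (d^2))) / 4 - c \<le> ln (real_of_int (radical d))"
proof (cases "a4 = 0")
  case True
  then have a6: "a6 \<noteq> 0" using nonsing by auto
  obtain c where c: "\<And>X Y Z w d. X + Y + Z = 0 \<Longrightarrow> gcd X Y dvd a6 \<Longrightarrow> d \<noteq> 0 \<Longrightarrow>
     max \<bar>X\<bar> (max \<bar>Y\<bar> \<bar>Z\<bar>) \<noteq> 0 \<Longrightarrow> (X * Y * Z \<noteq> 0 \<Longrightarrow> w \<noteq> 0) \<Longrightarrow>
     (\<And>p. prime p \<Longrightarrow> p dvd X * Y * Z \<Longrightarrow> X * Y * Z \<noteq> 0 \<Longrightarrow> p dvd w \<or> p dvd d) \<Longrightarrow>
     ln (real_of_int (max \<bar>X\<bar> (max \<bar>Y\<bar> \<bar>Z\<bar>))) \<le>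
     c + (1 + 1/11) * (ln (real_of_int (max 1 \<bar>w\<bar>)) + ln (real_of_int (radical d)))"
    using abc_radical_bound[OF abc _ a6, of "1/11"] by (metis zero_less_divide_1_iff zero_less_numeral)
  define C where "C = 1 + \<bar>a6\<bar>^2 * (1 + \<bar>a6\<bar>)"
  have C: "C \<ge> 1" by (simp add: C_def)
  define c' where "c' = 11 / 12 * c + ln (real_of_int C) / 2"
  have "ln (real_of_int (max \<bar>a\<bar> (d^2))) / 4 - c' \<le> ln (real_of_int (radical d))"
    if d: "d \<ge> 1" and eq0: "b^2 = a^3 + a4 * a * d^4 + a6 * d^6" and cop: "coprime a d" for a b d :: int
  proof -
    have eq: "b^2 = a^3 + a6 * d^6" using eq0 True by simp
    define H where "H = max \<bar>a\<bar> (d^2)"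
    have d2: "d^2 \<ge> 1" using d by (simp add: one_le_power)
    have H: "H \<ge> 1" "\<bar>a\<bar> \<le> H" "d^2 \<le> H" using d2 by (auto simp: H_def)
    define e where "e = d^2"
    have d6: "d^6 = e^3" unfolding e_def by (simp flip: power_mult)
    have e: "e \<ge> 1" "e \<le> H" using d2 H(3) by (simp_all add: e_def)
    define Z where "Z = - (a6 * d^6)"
    have gcd: "gcd (b^2) (- (a^3)) dvd a6"
    proof -
      define g where "g = gcd (b^2) (- (a^3))"
      have ga: "g dvd a^3" "g dvd b^2" unfolding g_def by (metis dvd_minus_iff gcd_dvd2) (rule gcd_dvd1)
      then have "g dvd b^2 - a^3" by (intro dvd_diff)
      then have "g dvd a6 * d^6" using eq by simp
      moreover have "coprime g (d^6)"
        using ga(1) cop by (meson coprime_divisors coprime_power_left_iff coprime_power_right_iff dvd_refl)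
      ultimately show ?thesis unfolding g_def[symmetric] by (simp add: coprime_dvd_mult_left_iff)
    qed
    have Hmax: "H^3 \<le> max \<bar>b^2\<bar> (max \<bar>- (a^3)\<bar> \<bar>Z\<bar>)"
    proof (cases "\<bar>a\<bar> \<le> d^2")
      case T: True
      have "1 * H^3 \<le> \<bar>a6\<bar> * H^3" using a6 H by (intro mult_right_mono) auto
      moreover have "H = e" using T by (simp add: H_def e_def)
      moreover have "\<bar>a6\<bar> * e^3 = \<bar>Z\<bar>" using e by (simp add: Z_def d6 abs_mult)
      ultimately show ?thesis by simp
    next
      case False
      then have "H^3 = \<bar>- (a^3)\<bar>" by (simp add: H_def power_abs)
      then show ?thesis by simp
    qed
    have H3: "H^3 \<ge> 1" using H by (simp add: one_le_power)
    have W: "(max 1 \<bar>a * b * a6\<bar>)^2 \<le> C * H^5"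
    proof -
      have "\<bar>b^2\<bar> \<le> \<bar>a\<bar>^3 + \<bar>a6\<bar> * e^3" unfolding eq d6
        using e by (intro order_trans[OF abs_triangle_ineq]) (simp add: abs_mult power_abs)
      also have "\<dots> \<le> H^3 + \<bar>a6\<bar> * H^3"
        using H e by (intro add_mono mult_left_mono power_mono) auto
      finally have b: "b^2 \<le> (1 + \<bar>a6\<bar>) * H^3" by (simp add: distrib_right)
      have a2: "a^2 \<le> H^2" using power_mono[OF H(2), of 2] by simp
      have "(a * b * a6)^2 = \<bar>a6\<bar>^2 * (a^2 * b^2)" by (simp add: power_mult_distrib)
      also have "\<dots> \<le> \<bar>a6\<bar>^2 * (H^2 * ((1 + \<bar>a6\<bar>) * H^3))"
        using a2 b by (intro mult_left_mono mult_mono) auto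
      also have "\<dots> = (\<bar>a6\<bar>^2 * (1 + \<bar>a6\<bar>)) * H^5" by (simp add: power_add[symmetric] mult_ac)
      finally have 1: "(a * b * a6)^2 \<le> (\<bar>a6\<bar>^2 * (1 + \<bar>a6\<bar>)) * H^5" .
      have H5: "H^5 \<ge> 1" using H by (simp add: one_le_power)
      have "(max 1 \<bar>a * b * a6\<bar>)^2 \<le> 1 + (a * b * a6)^2" by (simp add: max_def)
      also have "\<dots> \<le> C * H^5" using 1 H5 by (simp add: C_def distrib_right)
      finally show ?thesis .
    qed
    have "ln (real_of_int (H^3)) \<le> ln (real_of_int (max \<bar>b^2\<bar> (max \<bar>- (a^3)\<bar> \<bar>Z\<bar>)))"
    proof (rule iffD2[OF ln_le_cancel_iff])
      show "real_of_int (H^3) \<le> real_of_int (max \<bar>b^2\<bar> (max \<bar>- (a^3)\<bar> \<bar>Z\<bar>))" using Hmax by (simp only: of_int_le_iff)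
      show "0 < real_of_int (H^3)" using H3 by (simp only: of_int_0_less_iff)
      show "0 < real_of_int (max \<bar>b^2\<bar> (max \<bar>- (a^3)\<bar> \<bar>Z\<bar>))" using H3 Hmax by (simp only: of_int_0_less_iff)
    qed
    also have "\<dots> \<le> c + (1 + 1/11) * (ln (real_of_int (max 1 \<bar>a * b * a6\<bar>)) + ln (real_of_int (radical d)))"
    proof (rule c)
      show "b^2 + - (a^3) + Z = 0" using eq by (simp add: Z_def)
      show "max \<bar>b^2\<bar> (max \<bar>- (a^3)\<bar> \<bar>Z\<bar>) \<noteq> 0" using H3 Hmax by linarith
      show "a * b * a6 \<noteq> 0" if "b^2 * - (a^3) * Z \<noteq> 0" using that by (auto simp: Z_def)
      fix p assume "prime p" "p dvd b^2 * - (a^3) * Z"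
      then show "p dvd a * b * a6 \<or> p dvd d"
        by (auto simp: Z_def prime_dvd_mult_iff prime_dvd_power_iff)
    qed (use gcd d in auto)
    finally have 1: "3 * ln (real_of_int H) \<le> c + (12/11) * (ln (real_of_int (max 1 \<bar>a * b * a6\<bar>)) + ln (real_of_int (radical d)))"
      using H by (simp add: ln_realpow)
    have "ln (real_of_int (max 1 \<bar>a * b * a6\<bar>)) \<le> ln (real_of_int C) / 2 + real 5 / 2 * ln (real_of_int H)"
    proof (rule ln_le_of_power_le)
      show "(real_of_int (max 1 \<bar>a * b * a6\<bar>))^2 \<le> real_of_int C * real_of_int H ^ 5"
        using W by (metis of_int_le_iff of_int_mult of_int_power)
    qed (use H C in auto)
    moreover have "h / 4 - (11 / 12 * c + l / 2) \<le> r" if "w \<le> l / 2 + real 5 / 2 * h" "3 * h \<le> c + (12/11) * (w + r)"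
      for w l h r :: real using that by (simp add: field_simps)
    ultimately show ?thesis using 1 unfolding H_def[symmetric] c'_def by blast
  qed
  then show thesis using that by blast
next
  case False
  then have a6: "a6 = 0" using j by simp
  obtain c where c: "\<And>X Y Z w d. X + Y + Z = 0 \<Longrightarrow> gcd X Y dvd a4 \<Longrightarrow> d \<noteq> 0 \<Longrightarrow>
     max \<bar>X\<bar> (max \<bar>Y\<bar> \<bar>Z\<bar>) \<noteq> 0 \<Longrightarrow> (X * Y * Z \<noteq> 0 \<Longrightarrow> w \<noteq> 0) \<Longrightarrow>
     (\<And>p. prime p \<Longrightarrow> p dvd X * Y * Z \<Longrightarrow> X * Y * Z \<noteq> 0 \<Longrightarrow> p dvd w \<or> p dvd d) \<Longrightarrow>
     ln (real_of_int (max \<bar>X\<bar> (max \<bar>Y\<bar> \<bar>Z\<bar>))) \<le>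
     c + (1 + 1/7) * (ln (real_of_int (max 1 \<bar>w\<bar>)) + ln (real_of_int (radical d)))"
    using abc_radical_bound[OF abc _ False, of "1/7"] by (metis zero_less_divide_1_iff zero_less_numeral)
  define C where "C = 1 + \<bar>a4\<bar>^2 * (1 + \<bar>a4\<bar>)"
  have C: "C \<ge> 1" by (simp add: C_def)
  define c' where "c' = 7 / 8 * c + ln (real_of_int C) / 2"
  have "ln (real_of_int (max \<bar>a\<bar> (d^2))) / 4 - c' \<le> ln (real_of_int (radical d))"
    if d: "d \<ge> 1" and eq0: "b^2 = a^3 + a4 * a * d^4 + a6 * d^6" and cop: "coprime a d" for a b d :: int
  proof -
    have eq: "b^2 = a^3 + a4 * a * d^4" using eq0 a6 by simp
    define H where "H = max \<bar>a\<bar> (d^2)"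
    have d2: "d^2 \<ge> 1" using d by (simp add: one_le_power)
    have H: "H \<ge> 1" "\<bar>a\<bar> \<le> H" "d^2 \<le> H" using d2 by (auto simp: H_def)
    define e where "e = d^2"
    have d4: "d^4 = e^2" unfolding e_def by (simp flip: power_mult)
    have e: "e \<ge> 1" "e \<le> H" using d2 H(3) by (simp_all add: e_def)
    \<comment> \<open>The terms of the curve equation share the factor a, which may be large, so the
      equation is divided by a before ABC is applied. As a s = b^2, the primes of a and s are those
      of b.\<close>
    define s where "s = a^2 + a4 * d^4"
    have bs: "b^2 = a * s" unfolding eq s_def by (simp add: power2_eq_square power3_eq_cube algebra_simps)
    have gcd: "gcd (a^2) (a4 * d^4) dvd a4"
    proof -
      define g where "g = gcd (a^2) (a4 * d^4)"
      have ga: "g dvd a^2" "g dvd a4 * d^4" unfolding g_def by simp_all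
      moreover have "coprime g (d^4)"
        using ga(1) cop by (meson coprime_divisors coprime_power_left_iff coprime_power_right_iff dvd_refl)
      ultimately show ?thesis unfolding g_def[symmetric] by (simp add: coprime_dvd_mult_left_iff)
    qed
    have Hmax: "H^2 \<le> max \<bar>a^2\<bar> (max \<bar>a4 * d^4\<bar> \<bar>- s\<bar>)"
    proof (cases "\<bar>a\<bar> \<le> d^2")
      case T: True
      have "1 * H^2 \<le> \<bar>a4\<bar> * H^2" using False H by (intro mult_right_mono) auto
      moreover have "H = e" using T by (simp add: H_def e_def)
      moreover have "\<bar>a4\<bar> * e^2 = \<bar>a4 * d^4\<bar>" using e by (simp add: d4 abs_mult)
      ultimately show ?thesis by simp
    next
      case F: False
      then have "H^2 = \<bar>a^2\<bar>" by (simp add: H_def)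
      then show ?thesis by simp
    qed
    have H2: "H^2 \<ge> 1" using H by (simp add: one_le_power)
    have W: "(max 1 \<bar>b * a4\<bar>)^2 \<le> C * H^3"
    proof -
      have "\<bar>s\<bar> \<le> \<bar>a\<bar>^2 + \<bar>a4\<bar> * e^2" unfolding s_def d4
        using e by (intro order_trans[OF abs_triangle_ineq]) (simp add: abs_mult)
      also have "\<dots> \<le> H^2 + \<bar>a4\<bar> * H^2"
        using H e by (intro add_mono mult_left_mono power_mono) auto
      finally have s: "\<bar>s\<bar> \<le> (1 + \<bar>a4\<bar>) * H^2" by (simp add: distrib_right)
      have "\<bar>a\<bar> * \<bar>s\<bar> \<le> H * ((1 + \<bar>a4\<bar>) * H^2)" using H s by (intro mult_mono) auto
      moreover have "b^2 = \<bar>a\<bar> * \<bar>s\<bar>" using bs by (metis abs_mult abs_power2)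
      ultimately have b: "b^2 \<le> (1 + \<bar>a4\<bar>) * H^3" by (simp add: power2_eq_square power3_eq_cube mult_ac)
      have "(b * a4)^2 = \<bar>a4\<bar>^2 * b^2" by (simp add: power_mult_distrib)
      also have "\<dots> \<le> \<bar>a4\<bar>^2 * ((1 + \<bar>a4\<bar>) * H^3)"
        using b by (intro mult_left_mono) auto
      finally have 1: "(b * a4)^2 \<le> (\<bar>a4\<bar>^2 * (1 + \<bar>a4\<bar>)) * H^3" by (simp add: mult_ac)
      have H3: "H^3 \<ge> 1" using H by (simp add: one_le_power)
      have "(max 1 \<bar>b * a4\<bar>)^2 \<le> 1 + (b * a4)^2" by (simp add: max_def)
      also have "\<dots> \<le> C * H^3" using 1 H3 by (simp add: C_def distrib_right)
      finally show ?thesis .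
    qed
    have "ln (real_of_int (H^2)) \<le> ln (real_of_int (max \<bar>a^2\<bar> (max \<bar>a4 * d^4\<bar> \<bar>- s\<bar>)))"
    proof (rule iffD2[OF ln_le_cancel_iff])
      show "real_of_int (H^2) \<le> real_of_int (max \<bar>a^2\<bar> (max \<bar>a4 * d^4\<bar> \<bar>- s\<bar>))" using Hmax by (simp only: of_int_le_iff)
      show "0 < real_of_int (H^2)" using H2 by (simp only: of_int_0_less_iff)
      show "0 < real_of_int (max \<bar>a^2\<bar> (max \<bar>a4 * d^4\<bar> \<bar>- s\<bar>))" using H2 Hmax by (simp only: of_int_0_less_iff)
    qed
    also have "\<dots> \<le> c + (1 + 1/7) * (ln (real_of_int (max 1 \<bar>b * a4\<bar>)) + ln (real_of_int (radical d)))"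
    proof (rule c)
      show "a^2 + a4 * d^4 + - s = 0" by (simp add: s_def)
      show "max \<bar>a^2\<bar> (max \<bar>a4 * d^4\<bar> \<bar>- s\<bar>) \<noteq> 0" using H2 Hmax by linarith
      show "b * a4 \<noteq> 0" if "a^2 * (a4 * d^4) * - s \<noteq> 0"
      proof -
        have "a * s \<noteq> 0" using that by auto
        then show ?thesis using bs False by auto
      qed
      fix p assume p: "prime p" "p dvd a^2 * (a4 * d^4) * - s"
      then have "p dvd a * s \<or> p dvd a4 \<or> p dvd d"
        by (auto simp: prime_dvd_mult_iff prime_dvd_power_iff)
      then show "p dvd b * a4 \<or> p dvd d" using p(1) unfolding bs[symmetric]
        by (auto simp: prime_dvd_power_iff)
    qed (use gcd d in auto)
    finally have 1: "2 * ln (real_of_int H) \<le> c + (8/7) * (ln (real_of_int (max 1 \<bar>b * a4\<bar>)) + ln (real_of_int (radical d)))"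
      using H by (simp add: ln_realpow)
    have "ln (real_of_int (max 1 \<bar>b * a4\<bar>)) \<le> ln (real_of_int C) / 2 + real 3 / 2 * ln (real_of_int H)"
    proof (rule ln_le_of_power_le)
      show "(real_of_int (max 1 \<bar>b * a4\<bar>))^2 \<le> real_of_int C * real_of_int H ^ 3"
        using W by (metis of_int_le_iff of_int_mult of_int_power)
    qed (use H C in auto)
    moreover have "h / 4 - (7 / 8 * c + l / 2) \<le> r" if "w \<le> l / 2 + real 3 / 2 * h" "2 * h \<le> c + (8/7) * (w + r)"
      for w l h r :: real using that by (simp add: field_simps)
    ultimately show ?thesis using 1 unfolding H_def[symmetric] c'_def by blast
  qed
  then show thesis using that by blast
qed

section \<open>The theorem\<close>

fun point_of :: "ecpt \<Rightarrow> rat point" where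
  "point_of Inf = Infty"
| "point_of (Pt x y) = Aff x y"

context rational_curve
begin

lemma on_point_of: "on (point_of P) \<longleftrightarrow> on_curve a4 a6 P"
  by (cases P) (auto simp: on_curve_def)

lemma point_of_add: "point_of (ec_add a4 a6 P R) = add (point_of P) (point_of R)"
  by (cases P; cases R) (auto simp: ec_add_def Let_def)

lemma point_of_mult: "point_of (ec_mult a4 a6 n P) = mul n (point_of P)"
  by (induction n) (simp_all add: point_of_add)

text \<open>This resolves the definite description in \<open>ec_denom\<close>: d is unique because
  d^2 is the denominator of x in lowest terms.\<close>

lemma ec_denom_normal_form:
  assumes "on (Aff x y)"
  obtains a b :: int and d :: nat where "ec_denom (Pt x y) = d" "d \<ge> 1" "x = of_int a / of_nat d ^ 2"
    "coprime a (int d)" "quotient_of x = (a, int d ^ 2)" "b^2 = a^3 + a4 * a * int d ^ 4 + a6 * int d ^ 6"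
proof -
  have on: "y^2 = x^3 + of_int a4 * x + of_int a6" using assms by simp
  obtain a b d where d: "d \<ge> 1" "x = of_int a / of_nat d ^ 2" "y = of_int b / of_nat d ^ 3"
    "coprime a (int d)" "coprime b (int d)"
    using rational_point_normal_form[OF on] .
  have q: "quotient_of x = (a, int d ^ 2)" unfolding d(2) by (rule quotient_of_normal_form[OF d(1,4)])
  have "ec_denom (Pt x y) = d"
    unfolding ec_denom_def ecpt.case
  proof (rule the_equality)
    show "d \<ge> 1 \<and> (\<exists>a b. x = of_int a / of_nat d ^ 2 \<and> y = of_int b / of_nat d ^ 3
        \<and> coprime a (int d) \<and> coprime b (int d))" using d by blast
    fix d' :: nat
    assume "d' \<ge> 1 \<and> (\<exists>a b. x = of_int a / of_nat d' ^ 2 \<and> y = of_int b / of_nat d' ^ 3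
        \<and> coprime a (int d') \<and> coprime b (int d'))"
    then obtain a' where d': "d' \<ge> 1" "x = of_int a' / of_nat d' ^ 2" "coprime a' (int d')" by blast
    have "quotient_of x = (a', int d' ^ 2)" unfolding d'(2) by (rule quotient_of_normal_form[OF d'(1,3)])
    then have "int d' ^ 2 = int d ^ 2" using q by simp
    then show "d' = d" by simp
  qed
  moreover have "b^2 = a^3 + a4 * a * int d ^ 4 + a6 * int d ^ 6"
  proof -
    define e where "e = rat_of_nat d"
    have e: "e \<noteq> 0" using d(1) by (simp add: e_def)
    have xe: "of_int a = x * e^2" "of_int b = y * e^3" using d(2,3) e by (simp_all add: e_def)
    have "rat_of_int (b^2) = y^2 * e^6" by (simp add: xe power_mult_distrib flip: power_mult)
    also have "\<dots> = rat_of_int (a^3 + a4 * a * int d ^ 4 + a6 * int d ^ 6)"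
      unfolding on by (simp add: xe e_def[symmetric] power_mult_distrib distrib_right mult.assoc
          flip: power_mult power_add)
    finally show ?thesis by (simp only: of_int_eq_iff)
  qed
  ultimately show thesis using that d q by blast
qed

end

theorem mainTheorem4:
  fixes A B :: int and Q :: ecpt
  assumes abc: "abc_conjecture"
    and nonsing: "4 * A^3 + 27 * B^2 \<noteq> 0"
    and j: "A = 0 \<or> B = 0"
    and onE: "on_curve A B Q"
    and inf_order: "\<forall>n::nat. n \<ge> 1 \<longrightarrow> ec_mult A B n Q \<noteq> Inf"
  shows "\<forall>\<epsilon>::real. \<epsilon> > 0 \<longrightarrow> (\<exists>c::real. c > 0 \<and> (\<forall>n::nat. n \<ge> 1 \<longrightarrow>
           real (gpf (ell_denom_seq A B Q n)) \<ge> c * real n powr (3 - \<epsilon>)))"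
proof (intro allI impI)
  fix \<epsilon> :: real assume eps: "\<epsilon> > 0"
  interpret rational_curve A B by unfold_locales (rule nonsing)
  define q where "q = point_of Q"
  define D where "D n = ell_denom_seq A B Q n" for n
  have onq: "on q" using onE by (simp add: q_def on_point_of)
  have ord: "mul n q \<noteq> Infty" if "n \<ge> 1" for n
  proof -
    have "ec_mult A B n Q \<noteq> Inf" using inf_order that by blast
    then have "point_of (ec_mult A B n Q) \<noteq> Infty" by (cases "ec_mult A B n Q") auto
    then show ?thesis unfolding point_of_mult q_def .
  qed
  have nf: "\<exists>a b. D n \<ge> 1 \<and> coprime a (int (D n)) \<and> b^2 = a^3 + A * a * int (D n) ^ 4 + B * int (D n) ^ 6 \<and>
      xdenom (mul n q) = int (D n) ^ 2 \<and> log_height (mul n q) = ln (real_of_int (max \<bar>a\<bar> (int (D n) ^ 2)))"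
    if n: "n \<ge> 1" for n
  proof -
    obtain x y where xy: "ec_mult A B n Q = Pt x y" using inf_order n by (cases "ec_mult A B n Q") auto
    then have m: "mul n q = Aff x y" using point_of_mult[of n Q] by (simp add: q_def)
    then have "on (Aff x y)" using on_mul[OF onq, of n] by simp
    then obtain a b d where d: "ec_denom (Pt x y) = d" "d \<ge> 1" "coprime a (int d)"
      "quotient_of x = (a, int d ^ 2)" "b^2 = a^3 + A * a * int d ^ 4 + B * int d ^ 6"
      using ec_denom_normal_form by metis
    have "D n = d" using d(1) xy by (simp add: D_def ell_denom_seq_def)
    then show ?thesis
      using d m by - (rule exI[of _ a], rule exI[of _ b], auto simp: rat_height_def)
  qed
  have D1: "D n \<ge> 1" if "n \<ge> 1" for n using nf[OF that] by blast
  have xd: "xdenom (mul n q) = int (D n) ^ 2" if "n \<ge> 1" for n using nf[OF that] by blast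
  obtain c c' d0 where g: "c > 0" "c' > 0" "\<And>n. c * real n ^ 2 - d0 \<le> log_height (mul n q)"
    "\<And>n. log_height (mul n q) \<le> c' * real n ^ 2"
    using log_height_mul_quadratic[OF onq ord] by metis
  obtain c0 where c0: "\<And>a b d. d \<ge> 1 \<Longrightarrow> b^2 = a^3 + A * a * d^4 + B * d^6 \<Longrightarrow> coprime a d \<Longrightarrow>
     ln (real_of_int (max \<bar>a\<bar> (d^2))) / 4 - c0 \<le> ln (real_of_int (radical d))"
    using abc_radical_denominator[OF abc nonsing j] by metis
  \<comment> \<open>Excluded are 2 and the primes dividing the discriminant, and the primes dividing
    d_1, for which Q itself already reduces to infinity. The set depends only on the curve and
    Q.\<close>
  define Bd where "Bd = prime_factors (nat \<bar>2 * (4 * A^3 + 27 * B^2)\<bar>) \<union> prime_factors (D 1)"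
  have "\<exists>c>0. \<forall>n\<ge>1. real (gpf (D n)) \<ge> c * real n powr (3 - \<epsilon>)"
  proof (rule gpf_growth[OF D1])
    fix n :: nat assume n: "n \<ge> 1"
    obtain a b where ab: "coprime a (int (D n))" "b^2 = a^3 + A * a * int (D n) ^ 4 + B * int (D n) ^ 6"
      "log_height (mul n q) = ln (real_of_int (max \<bar>a\<bar> (int (D n) ^ 2)))" using nf[OF n] by blast
    have Dn: "D n \<ge> 1" using D1[OF n] .
    then have i: "1 \<le> int (D n)" by simp
    \<comment> \<open>The sum is the logarithm of the radical of d_n;
      \<open>abc_radical_denominator\<close> gives a quarter of the height of nQ, which is at least
      c n^2 - d0.\<close>
    show "c / 4 * real n ^ 2 - (d0 / 4 + c0) \<le> (\<Sum>p\<in>prime_factors (D n). ln (real p))"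
      using c0[OF i ab(2,1)] g(3)[of n] unfolding ab(3)[symmetric] ln_radical_of_nat[OF Dn] by (simp add: field_simps)
    have "real (D n) \<ge> 1" using Dn by simp
    then have "real (D n) \<le> real (D n) ^ 2" by (simp add: power2_eq_square)
    also have "\<dots> = real_of_int (int (D n) ^ 2)" by simp
    also have "\<dots> \<le> real_of_int (max \<bar>a\<bar> (int (D n) ^ 2))" by (simp only: of_int_le_iff max.cobounded2)
    finally have "ln (real (D n)) \<le> log_height (mul n q)"
      unfolding ab(3) using Dn by (intro iffD2[OF ln_le_cancel_iff]) auto
    then show "ln (real (D n)) \<le> c' * real n ^ 2" using g(4)[of n] by linarith
    fix p assume "p \<in> prime_factors (D n) - Bd"
    then have p: "prime p" "p dvd D n" "p \<notin> Bd" by auto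
    have good: "\<not> int p dvd 2 * (4 * A^3 + 27 * B^2)"
    proof
      assume "int p dvd 2 * (4 * A^3 + 27 * B^2)"
      then have "p dvd nat \<bar>2 * (4 * A^3 + 27 * B^2)\<bar>" by (simp add: nat_abs_dvd_iff dvd_nat_abs_iff)
      then have "p \<in> Bd" using p(1) nonsing by (auto simp: Bd_def prime_factors_dvd)
      then show False using p(3) by simp
    qed
    have pp: "prime (int p)" using p(1) by simp
    have xdp: "int p dvd xdenom (mul m q) \<longleftrightarrow> p dvd D m" if "m \<ge> 1" for m
      unfolding xd[OF that] using pp by (simp add: prime_dvd_power_iff)
    have "\<not> p dvd D 1"
    proof
      assume "p dvd D 1"
      then have "p \<in> prime_factors (D 1)" using p(1) D1[of 1] by (simp add: prime_factors_dvd)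
      then show False using p(3) by (simp add: Bd_def)
    qed
    then have "\<not> int p dvd xdenom q" using xdp[of 1] by simp
    then have "\<exists>m\<ge>1. m dvd n \<and> int p dvd xdenom (mul m q) \<and> CM_order p m"
      using rank_property[OF p(1), unfolded rank_property_def, rule_format, OF j good onq _ _ n] ord xdp[OF n] p(2)
      by blast
    then show "\<exists>m\<ge>1. m dvd n \<and> p dvd D m \<and> CM_order p m" using xdp by blast
  next
    show "finite Bd" by (simp add: Bd_def)
    show "p > 0" if "p \<in> Bd" for p using that by (auto simp: Bd_def intro: prime_gt_0_nat)
  qed (use g eps in auto)
  then show "\<exists>c::real. c > 0 \<and> (\<forall>n::nat. n \<ge> 1 \<longrightarrow>
           real (gpf (ell_denom_seq A B Q n)) \<ge> c * real n powr (3 - \<epsilon>))"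
    unfolding D_def by blast
qed

end
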